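(* Let $s\ge1$. Let $(\alpha,\chi)$ be a smooth solution of the system $$\partial_\tau^2\alpha+\frac1\tau\partial_\tau\alpha+4q'\alpha-\frac{4}{(\tau^2+1)^2}\Delta\alpha=f_1(\tau)\tau\partial_\tau\alpha+f_2(\tau)\tau^2\alpha+f_3(\tau)\chi,\qquad \partial_\tau\chi=2\tau\alpha\tag{M}$$ on $(0,\infty)\times S^n$ with asymptotic initial data $(\chi(0),\mathcal{O},h)$ at $\tau=0$, and define $$\mathfrak{h}:=h-(\log\nabla)\mathcal{O}:=h-\sum_{l=1}^\infty l\log2\cdot\mathcal{O}_l.$$ Then $$\Big(\|\alpha\|_{H^{s+1/2}}+\|\partial_\tau\alpha\|_{H^{s-1/2}}\Big)\Big|_{\tau=1}\lesssim\|\mathfrak{h}\|_{H^s}+\|\mathcal{O}\|_{H^s}+\|\chi(0)\|_{H^{s-1/2}},$$ $$\|\chi(1)\|_{H^{s+1/2}}\lesssim\|\mathfrak{h}\|_{H^s}+\|\mathcal{O}\|_{H^s}+\|\chi(0)\|_{H^{s+1/2}},$$ with implicit constants independent of the solution.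
   Context: $n\ge4$ is even, $q'\ge1$ is a constant, $f_1,f_2,f_3:[0,\infty)\to\mathbb{R}$ are fixed bounded smooth functions, and $\Delta$ is the Laplace–Beltrami operator of the standard metric on $S^n$. **Frequency notation.** Let $\{\varphi_i\}_{i\ge0}\subset C^\infty(S^n)$ be an orthonormal basis of $L^2(S^n)$ with $-\Delta\varphi_i=\lambda_i^2\varphi_i$, $0=\lambda_0<\lambda_1\le\cdots$. $\|f\|_{H^s}^2=\sum_i(1+\lambda_i^2)^s|\langle f,\varphi_i\rangle|^2$. $f_0=\sum_{\lambda_i\le1}\langle f,\varphi_i\rangle\varphi_i$ and, for $l\ge1$, $f_l=\sum_{2^{l-1}<\lambda_i\le2^l}\langle f,\varphi_i\rangle\varphi_i$. **Asymptotic data.** For $\chi(0),\mathcal{O},h\in C^\infty(S^n)$, a pair $\alpha,\chi\in C^\infty((0,\infty)\times S^n)$ solving (M) is a *smooth solution with asymptotic initial data $(\chi(0),\mathcal{O},h)$* if $\alpha-\mathcal{O}\log\tau-h$ and $\chi$ belong to $C^1_\tau([0,\infty);C^\infty(S^n))$, $\chi|_{\tau=0}=\chi(0)$, and as $\tau\to0$, $\alpha=\mathcal{O}\log\tau+h+O(\tau^2|\log\tau|^2)$, $\partial_\tau\alpha=\mathcal{O}/\tau+O(\tau|\log\tau|^2)$ in $C^\infty(S^n)$ (i.e. in every $H^k(S^n)$). *)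

theory Defs
  imports "HOL-Analysis.Analysis" "HOL-Library.Landau_Symbols"
begin

text \<open>
  The unit sphere of dimension \<open>n\<close> is \<open>sphere 0 1\<close> in a Euclidean space of dimension \<open>n + 1\<close>.
  Functions and vector fields on it are total functions on the ambient space, whose values off
  the sphere are never used: calculus on the sphere is done through the extension that is
  constant along rays.  As \<open>x \<mapsto> x / |x|\<close> is a smooth retraction of the punctured space onto the
  sphere, a function on the sphere is smooth iff this extension is smooth away from the origin.
\<close>

definition radial_ext :: "('a::euclidean_space \<Rightarrow> 'b) \<Rightarrow> 'a \<Rightarrow> 'b" where
  "radial_ext f x = f (x /\<^sub>R norm x)"


subsection \<open>Smoothness\<close>

text \<open>For open \<open>U\<close>, \<open>Ck_on k f U\<close> says that \<open>f\<close> is of class \<open>C\<^sup>k\<close> on \<open>U\<close>.\<close>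

primrec Ck_on :: "nat \<Rightarrow> ('a::euclidean_space \<Rightarrow> real) \<Rightarrow> 'a set \<Rightarrow> bool" where
  "Ck_on 0 f U \<longleftrightarrow> continuous_on U f"
| "Ck_on (Suc k) f U \<longleftrightarrow>
     (\<forall>x\<in>U. f differentiable (at x)) \<and> (\<forall>v. Ck_on k (\<lambda>x. frechet_derivative f (at x) v) U)"

definition smooth_on :: "('a::euclidean_space \<Rightarrow> real) \<Rightarrow> 'a set \<Rightarrow> bool" where
  "smooth_on f U \<longleftrightarrow> (\<forall>k. Ck_on k f U)"

definition smooth_sphere :: "('a::euclidean_space \<Rightarrow> real) \<Rightarrow> bool" where
  "smooth_sphere f \<longleftrightarrow> smooth_on (radial_ext f) (UNIV - {0})"

text \<open>Membership in \<open>C\<^sup>\<infinity>((0,\<infinity>) \<times> S\<^sup>n)\<close>.\<close>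

definition smooth_time_sphere :: "(real \<Rightarrow> 'a::euclidean_space \<Rightarrow> real) \<Rightarrow> bool" where
  "smooth_time_sphere u \<longleftrightarrow>
     smooth_on (\<lambda>(t, x). radial_ext (u t) x) ({0<..} \<times> (UNIV - {0}))"

text \<open>Smoothness on \<open>[0,\<infinity>)\<close>, with one-sided derivatives of all orders at \<open>0\<close>.\<close>

definition smooth_half_line :: "(real \<Rightarrow> real) \<Rightarrow> bool" where
  "smooth_half_line f \<longleftrightarrow>
     (\<exists>D :: nat \<Rightarrow> real \<Rightarrow> real. (\<forall>t\<ge>0. D 0 t = f t) \<and>
       (\<forall>k. \<forall>t\<ge>0. (D k has_real_derivative D (Suc k) t) (at t within {0..})))"


subsection \<open>Riemannian geometry of the round sphere\<close>

text \<open>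
  The gradient of the ray-constant extension at a point of the sphere is tangent to the sphere.
  The Levi-Civita connection of the induced metric is the tangential part of the ambient
  derivative; since the radial derivative of the ray-constant extension of a vector field
  vanishes, the trace over an orthonormal basis of the ambient space equals the trace over the
  tangent space, which is the Riemannian divergence.
\<close>

definition grad_sphere :: "('a::euclidean_space \<Rightarrow> real) \<Rightarrow> 'a \<Rightarrow> 'a" where
  "grad_sphere f x = (\<Sum>b\<in>Basis. frechet_derivative (radial_ext f) (at x) b *\<^sub>R b)"

definition div_sphere :: "('a::euclidean_space \<Rightarrow> 'a) \<Rightarrow> 'a \<Rightarrow> real" where
  "div_sphere X x = (\<Sum>b\<in>Basis. frechet_derivative (radial_ext X) (at x) b \<bullet> b)"

definition laplace_beltrami :: "('a::euclidean_space \<Rightarrow> real) \<Rightarrow> 'a \<Rightarrow> real" where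
  "laplace_beltrami f = div_sphere (grad_sphere f)"

text \<open>
  The surface measure from polar coordinates: the measure of \<open>A\<close> is \<open>n + 1\<close> times the
  Lebesgue measure of the cone \<open>{r x | 0 < r < 1, x \<in> A}\<close>.
\<close>

definition sphere_measure :: "'a::euclidean_space measure" where
  "sphere_measure = scale_measure (of_nat DIM('a))
     (distr (restrict_space lborel (ball 0 1 - {0})) (restrict_space borel (sphere 0 1))
       (\<lambda>x. x /\<^sub>R norm x))"

definition L2_sphere :: "('a::euclidean_space \<Rightarrow> real) set" where
  "L2_sphere = {f \<in> borel_measurable sphere_measure. integrable sphere_measure (\<lambda>x. (f x)\<^sup>2)}"

definition inner_sphere :: "('a::euclidean_space \<Rightarrow> real) \<Rightarrow> ('a \<Rightarrow> real) \<Rightarrow> real" where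
  "inner_sphere f g = (\<integral>x. f x * g x \<partial>sphere_measure)"


subsection \<open>Frequency decomposition\<close>

definition laplace_eigenbasis :: "(nat \<Rightarrow> 'a::euclidean_space \<Rightarrow> real) \<Rightarrow> (nat \<Rightarrow> real) \<Rightarrow> bool" where
  "laplace_eigenbasis \<phi> lam \<longleftrightarrow>
     (\<forall>i. smooth_sphere (\<phi> i)) \<and>
     (\<forall>i j. inner_sphere (\<phi> i) (\<phi> j) = (if i = j then 1 else 0)) \<and>
     (\<forall>f\<in>L2_sphere. (\<lambda>N. \<integral>x. (f x - (\<Sum>i<N. inner_sphere f (\<phi> i) * \<phi> i x))\<^sup>2 \<partial>sphere_measure)
        \<longlonglongrightarrow> 0) \<and>
     (\<forall>i. \<forall>x\<in>sphere 0 1. - laplace_beltrami (\<phi> i) x = (lam i)\<^sup>2 * \<phi> i x) \<and>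
     lam 0 = 0 \<and> 0 < lam 1 \<and> (\<forall>i\<ge>1. lam i \<le> lam (Suc i))"

text \<open>The series converges for every smooth function and every real \<open>s\<close>.\<close>

definition sobolev_norm ::
  "(nat \<Rightarrow> 'a::euclidean_space \<Rightarrow> real) \<Rightarrow> (nat \<Rightarrow> real) \<Rightarrow> real \<Rightarrow> ('a \<Rightarrow> real) \<Rightarrow> real" where
  "sobolev_norm \<phi> lam s f = sqrt (\<Sum>i. (1 + (lam i)\<^sup>2) powr s * \<bar>inner_sphere f (\<phi> i)\<bar>\<^sup>2)"

text \<open>The index sets are finite, since the eigenvalues of the Laplacian tend to infinity.\<close>

definition freq_block ::
  "(nat \<Rightarrow> 'a::euclidean_space \<Rightarrow> real) \<Rightarrow> (nat \<Rightarrow> real) \<Rightarrow> nat \<Rightarrow> ('a \<Rightarrow> real) \<Rightarrow> 'a \<Rightarrow> real" where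
  "freq_block \<phi> lam l f x =
     (\<Sum>i\<in>(if l = 0 then {i. lam i \<le> 1} else {i. 2 ^ (l - 1) < lam i \<and> lam i \<le> 2 ^ l}).
        inner_sphere f (\<phi> i) * \<phi> i x)"

text \<open>
  \<open>(log \<nabla>) f = (\<Sum>l\<ge>1. l log 2 f\<^sub>l)\<close>; the summation index is shifted by one.  For smooth \<open>f\<close>
  the series converges in \<open>C\<^sup>\<infinity>(S\<^sup>n)\<close>, in particular pointwise.
\<close>

definition log_nabla ::
  "(nat \<Rightarrow> 'a::euclidean_space \<Rightarrow> real) \<Rightarrow> (nat \<Rightarrow> real) \<Rightarrow> ('a \<Rightarrow> real) \<Rightarrow> 'a \<Rightarrow> real" where
  "log_nabla \<phi> lam f x = (\<Sum>l. real (Suc l) * ln 2 * freq_block \<phi> lam (Suc l) f x)"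


subsection \<open>Solutions with asymptotic initial data\<close>

text \<open>
  \<open>C\<^sup>1([0,\<infinity>); C\<^sup>\<infinity>(S\<^sup>n))\<close>, where \<open>C\<^sup>\<infinity>(S\<^sup>n)\<close> carries the topology given by all \<open>H\<^sup>k\<close> norms.
\<close>

definition C1_smooth ::
  "(nat \<Rightarrow> 'a::euclidean_space \<Rightarrow> real) \<Rightarrow> (nat \<Rightarrow> real) \<Rightarrow> (real \<Rightarrow> 'a \<Rightarrow> real) \<Rightarrow> bool" where
  "C1_smooth \<phi> lam u \<longleftrightarrow>
     (\<exists>v. (\<forall>t\<ge>0. smooth_sphere (u t) \<and> smooth_sphere (v t)) \<and>
       (\<forall>t\<ge>0. \<forall>k::nat.
          ((\<lambda>r. sobolev_norm \<phi> lam (real k) (\<lambda>x. (u r x - u t x) / (r - t) - v t x)) \<longlongrightarrow> 0)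
            (at t within {0..}) \<and>
          ((\<lambda>r. sobolev_norm \<phi> lam (real k) (\<lambda>x. v r x - v t x)) \<longlongrightarrow> 0) (at t within {0..})))"

definition solves_M ::
  "real \<Rightarrow> (real \<Rightarrow> real) \<Rightarrow> (real \<Rightarrow> real) \<Rightarrow> (real \<Rightarrow> real) \<Rightarrow>
   (real \<Rightarrow> 'a::euclidean_space \<Rightarrow> real) \<Rightarrow> (real \<Rightarrow> 'a \<Rightarrow> real) \<Rightarrow> bool" where
  "solves_M q' f1 f2 f3 \<alpha> chi \<longleftrightarrow>
     (\<forall>\<tau>>0. \<forall>x\<in>sphere 0 1.
        deriv (deriv (\<lambda>t. \<alpha> t x)) \<tau> + 1 / \<tau> * deriv (\<lambda>t. \<alpha> t x) \<tau> + 4 * q' * \<alpha> \<tau> x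
          - 4 / (\<tau>\<^sup>2 + 1)\<^sup>2 * laplace_beltrami (\<alpha> \<tau>) x
        = f1 \<tau> * \<tau> * deriv (\<lambda>t. \<alpha> t x) \<tau> + f2 \<tau> * \<tau>\<^sup>2 * \<alpha> \<tau> x + f3 \<tau> * chi \<tau> x \<and>
        deriv (\<lambda>t. chi t x) \<tau> = 2 * \<tau> * \<alpha> \<tau> x)"

text \<open>
  A function given for \<open>\<tau> > 0\<close> belongs to \<open>C\<^sup>1([0,\<infinity>); C\<^sup>\<infinity>(S\<^sup>n))\<close> if it has an extension \<open>w\<close> to
  \<open>\<tau> \<ge> 0\<close> of that class; the values of \<open>\<alpha>\<close> and \<open>chi\<close> for \<open>\<tau> \<le> 0\<close> are irrelevant, and
  \<open>chi0\<close> is the value at \<open>\<tau> = 0\<close> of the extension of \<open>chi\<close>.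
\<close>

definition smooth_solution ::
  "(nat \<Rightarrow> 'a::euclidean_space \<Rightarrow> real) \<Rightarrow> (nat \<Rightarrow> real) \<Rightarrow>
   real \<Rightarrow> (real \<Rightarrow> real) \<Rightarrow> (real \<Rightarrow> real) \<Rightarrow> (real \<Rightarrow> real) \<Rightarrow>
   ('a \<Rightarrow> real) \<Rightarrow> ('a \<Rightarrow> real) \<Rightarrow> ('a \<Rightarrow> real) \<Rightarrow>
   (real \<Rightarrow> 'a \<Rightarrow> real) \<Rightarrow> (real \<Rightarrow> 'a \<Rightarrow> real) \<Rightarrow> bool" where
  "smooth_solution \<phi> lam q' f1 f2 f3 chi0 \<O> h \<alpha> chi \<longleftrightarrow>
     smooth_sphere chi0 \<and> smooth_sphere \<O> \<and> smooth_sphere h \<and>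
     smooth_time_sphere \<alpha> \<and> smooth_time_sphere chi \<and>
     solves_M q' f1 f2 f3 \<alpha> chi \<and>
     (\<exists>w. C1_smooth \<phi> lam w \<and>
        (\<forall>\<tau>>0. \<forall>x\<in>sphere 0 1. w \<tau> x = \<alpha> \<tau> x - \<O> x * ln \<tau> - h x)) \<and>
     (\<exists>w. C1_smooth \<phi> lam w \<and>
        (\<forall>\<tau>>0. \<forall>x\<in>sphere 0 1. w \<tau> x = chi \<tau> x) \<and> (\<forall>x\<in>sphere 0 1. w 0 x = chi0 x)) \<and>
     (\<forall>k::nat. (\<lambda>\<tau>. sobolev_norm \<phi> lam (real k) (\<lambda>x. \<alpha> \<tau> x - (\<O> x * ln \<tau> + h x)))
        \<in> O[at_right 0](\<lambda>\<tau>. \<tau>\<^sup>2 * \<bar>ln \<tau>\<bar>\<^sup>2)) \<and>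
     (\<forall>k::nat. (\<lambda>\<tau>. sobolev_norm \<phi> lam (real k) (\<lambda>x. deriv (\<lambda>t. \<alpha> t x) \<tau> - \<O> x / \<tau>))
        \<in> O[at_right 0](\<lambda>\<tau>. \<tau> * \<bar>ln \<tau>\<bar>\<^sup>2))"

end

theory Submission
  imports Defs
begin

text \<open>
  Projecting on an eigenfunction of frequency \<open>\<lambda>\<close> turns the system into an ODE, for which a bound
  uniform in \<open>\<lambda>\<close> is needed.  Put \<open>\<mu> = max 1 \<lambda>\<close>.  On \<open>(0, 1/\<mu>]\<close> the term \<open>\<lambda>\<^sup>2 \<alpha>\<close> is a perturbation of
  \<open>\<alpha>'' + \<alpha>'/\<tau>\<close>, and \<open>\<tau> \<alpha>'\<close>, \<open>\<alpha> - \<tau> \<alpha>' ln (\<mu> \<tau>)\<close> stay comparable to their limits \<open>\<O>\<close> and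
  \<open>h - \<O> ln \<mu>\<close> at \<open>\<tau> = 0\<close>; the latter is the corresponding coefficient of \<open>h - (log \<nabla>) \<O>\<close> up to a
  bounded multiple of \<open>\<O>\<close>.  On \<open>[1/\<mu>, 1]\<close> the solution oscillates, and the energy of \<open>\<surd>\<tau> \<alpha>\<close> is
  controlled because the relative error \<open>1/(\<mu> \<tau>\<^sup>2)\<close> has integral at most \<open>1\<close>.  At \<open>\<tau> = 1/\<mu>\<close> this
  energy is of size \<open>\<mu>\<close> and at \<open>\<tau> = 1\<close> it controls \<open>\<mu>\<^sup>2 \<alpha>\<^sup>2\<close>: this is the gain of half a derivative.
  Adding \<open>r \<chi>\<^sup>2\<close> with \<open>r = 1/\<mu>\<close> or \<open>r = \<mu>\<close> to the energies gives the two estimates, which are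
  then summed over the modes.

  The rapid decay of the coefficients, needed for all series to converge, follows from Bessel's
  inequality and Green's identity for iterates of the Laplacian.  Green's identity on the sphere
  reduces to the fact that a compactly supported \<open>C\<^sup>1\<close> vector field on the ambient space has a
  divergence of integral zero.
\<close>

subsection \<open>The ordinary differential equation of a single mode\<close>

text \<open>Neither energy works on all of (0, 1]. In the logarithmic variables the growth rate is
  of size \<open>\<mu>\<^sup>2 * t * (1 + |ln (\<mu> * t)|)\<^sup>2\<close>, whose integral is
  bounded up to 1/\<mu> but grows with \<mu> beyond. For the energy of sqrt t * \<alpha> the rate
  contains \<open>1 / (4 * \<mu> * t\<^sup>2)\<close>, which is not integrable at 0. Both errors
  balance at t = 1/\<mu>; there ln (\<mu> t) vanishes as well, so the two quantities can be compared
  at that time up to a numerical factor. \<chi> is coupled in both directions, through f3 \<chi> and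
  through \<chi>' = 2 t \<alpha>, and cannot be estimated separately. Every weight r between 1/\<mu>
  and \<mu> leaves both couplings harmless, and the end points are the values for which r
  \<chi>(0)^2 has Sobolev order s - 1/2 or s + 1/2 when the other data have order s.\<close>

lemma gronwall_mult:
  fixes N G :: "real \<Rightarrow> real"
  assumes "a \<le> b"
    and N: "\<And>x. a \<le> x \<Longrightarrow> x \<le> b \<Longrightarrow> (N has_real_derivative N' x) (at x)"
    and G: "\<And>x. a \<le> x \<Longrightarrow> x \<le> b \<Longrightarrow> (G has_real_derivative k x) (at x)"
    and le: "\<And>x. a \<le> x \<Longrightarrow> x \<le> b \<Longrightarrow> N' x \<le> k x * N x"
  shows "N b \<le> N a * exp (G b - G a)"
proof -
  have "N b * exp (- G b) \<le> N a * exp (- G a)"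
  proof (rule DERIV_nonpos_imp_nonincreasing[OF \<open>a \<le> b\<close>])
    fix x assume x: "a \<le> x" "x \<le> b"
    have "((\<lambda>x. N x * exp (- G x)) has_real_derivative (N' x - k x * N x) * exp (- G x)) (at x)"
      by (rule derivative_eq_intros N[OF x] G[OF x] refl)+ (simp add: algebra_simps)
    moreover have "(N' x - k x * N x) * exp (- G x) \<le> 0"
      using le[OF x] by (simp add: mult_nonpos_nonneg)
    ultimately show "\<exists>d. ((\<lambda>x. N x * exp (- G x)) has_real_derivative d) (at x) \<and> d \<le> 0"
      by blast
  qed
  then have "N b * exp (- G b) * exp (G b) \<le> N a * exp (- G a) * exp (G b)"
    by (rule mult_right_mono) simp
  moreover have "N b * exp (- G b) * exp (G b) = N b"
    by (simp add: exp_minus field_simps)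
  moreover have "N a * exp (- G a) * exp (G b) = N a * exp (G b - G a)"
    by (simp add: mult.assoc flip: exp_add)
  ultimately show ?thesis
    by simp
qed

text \<open>Passing to sqrt x halves the logarithm, and ln (1/s) \<le> 1/s - 1 does the rest. At x =
  \<mu> t the squared logarithmic weight is thus absorbed by a single factor \<mu> t, which keeps
  the growth rate on (0, 1/\<mu>] below a multiple of \<mu>.\<close>

lemma mult_ln_square_le:
  fixes x :: real
  assumes "0 < x" "x \<le> 1"
  shows "x * (1 + \<bar>ln x\<bar>)\<^sup>2 \<le> 4"
proof -
  define s where "s = sqrt x"
  have s: "0 < s" "s \<le> 1" "x = s\<^sup>2"
    using assms by (auto simp: s_def)
  have "ln (1 / s) \<le> 1 / s - 1"
    using s by (intro ln_le_minus_one) auto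
  then have "1 - 2 * ln s \<le> 2 / s"
    using s by (simp add: ln_div)
  moreover have "\<bar>ln x\<bar> = - 2 * ln s"
    using s by (simp add: ln_realpow)
  ultimately have "1 + \<bar>ln x\<bar> \<le> 2 / s"
    by simp
  then have "(1 + \<bar>ln x\<bar>)\<^sup>2 \<le> (2 / s)\<^sup>2"
    by (intro power_mono) auto
  then have "s\<^sup>2 * (1 + \<bar>ln x\<bar>)\<^sup>2 \<le> s\<^sup>2 * (2 / s)\<^sup>2"
    by (intro mult_left_mono) auto
  then show ?thesis
    using s by (simp add: power_divide)
qed

lemma sq_plus_1_pos: "t\<^sup>2 + 1 > (0::real)"
  by (smt (verit) zero_le_power2)

text \<open>\<open>y\<close> and \<open>chi\<close> stand for one Fourier coefficient of \<alpha>
  and \<chi>, and \<omega> for its frequency, so the Laplacian has become multiplication by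
  \<open>- \<omega>\<^sup>2\<close>. Only t > 0 occurs; the data at t = 0 enter later, as
  limits.\<close>

locale freq_mode =
  fixes q' B \<omega> :: real and f1 f2 f3 y dy ddy chi :: "real \<Rightarrow> real"
  assumes q': "q' \<ge> 0" and B: "B \<ge> 0" and \<omega>: "\<omega> \<ge> 0"
    and f1: "\<And>t. t > 0 \<Longrightarrow> \<bar>f1 t\<bar> \<le> B"
    and f2: "\<And>t. t > 0 \<Longrightarrow> \<bar>f2 t\<bar> \<le> B"
    and f3: "\<And>t. t > 0 \<Longrightarrow> \<bar>f3 t\<bar> \<le> B"
    and y: "\<And>t. t > 0 \<Longrightarrow> (y has_real_derivative dy t) (at t)"
    and dy: "\<And>t. t > 0 \<Longrightarrow> (dy has_real_derivative ddy t) (at t)"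
    and chi: "\<And>t. t > 0 \<Longrightarrow> (chi has_real_derivative 2 * t * y t) (at t)"
    and ode: "\<And>t. t > 0 \<Longrightarrow> ddy t + 1 / t * dy t + 4 * q' * y t + 4 / (t\<^sup>2 + 1)\<^sup>2 * (\<omega>\<^sup>2 * y t)
                = f1 t * t * dy t + f2 t * t\<^sup>2 * y t + f3 t * chi t"
begin

definition "\<mu> = max 1 \<omega>"
definition "a t = 4 * \<omega>\<^sup>2 / (t\<^sup>2 + 1)\<^sup>2"
definition "w t = t * dy t"
text \<open>By the equation \<open>Q\<close> is y'' + y'/t, that is (t y')'/t, whence w' = t Q.
  \<open>R\<close> is the part whose coefficients are bounded independently of \<omega>; it is kept
  apart because \<open>a t * y t\<close> is an error near 0 but part of the energy later.\<close>

definition "R t = - 4 * q' * y t + f1 t * w t + f2 t * t\<^sup>2 * y t + f3 t * chi t"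
definition "Q t = R t - a t * y t"

lemma mu: "\<mu> \<ge> 1" "\<omega> \<le> \<mu>" "\<mu> > 0"
  by (auto simp: \<mu>_def)

lemma w_deriv:
  assumes "t > 0"
  shows "(w has_real_derivative t * Q t) (at t)"
proof -
  have "(w has_real_derivative (dy t + t * ddy t)) (at t)"
    unfolding w_def[abs_def] by (rule derivative_eq_intros dy[OF assms] refl)+ (simp add: algebra_simps)
  moreover have "dy t + t * ddy t = t * (ddy t + 1 / t * dy t)"
    using assms by (simp add: field_simps)
  moreover have "ddy t + 1 / t * dy t = Q t"
    using ode[OF assms] by (simp add: Q_def R_def a_def w_def algebra_simps)
  ultimately show ?thesis by simp
qed

lemma y_deriv: "t > 0 \<Longrightarrow> (y has_real_derivative w t / t) (at t)"
  using y[of t] by (simp add: w_def)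

lemma a_bounds: "0 \<le> a t" "a t \<le> 4 * \<mu>\<^sup>2"
proof -
  show "0 \<le> a t" by (simp add: a_def)
  have "4 * \<omega>\<^sup>2 / (t\<^sup>2 + 1)\<^sup>2 \<le> 4 * \<omega>\<^sup>2 / 1"
    by (intro divide_left_mono) (auto simp: one_le_power sq_plus_1_pos[THEN less_imp_neq, symmetric])
  also have "\<dots> \<le> 4 * \<mu>\<^sup>2"
    using \<omega> mu by (auto intro!: power_mono)
  finally show "a t \<le> 4 * \<mu>\<^sup>2" by (simp add: a_def)
qed

lemma R_bound:
  assumes "t > 0" "t \<le> 1"
  shows "\<bar>R t\<bar> \<le> (4 * q' + B) * \<bar>y t\<bar> + B * \<bar>w t\<bar> + B * \<bar>chi t\<bar>"
proof -
  have 2: "\<bar>f2 t * t\<^sup>2 * y t\<bar> \<le> B * \<bar>y t\<bar>"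
  proof -
    have "\<bar>f2 t\<bar> * t\<^sup>2 \<le> B * 1"
      using assms f2[of t] B by (intro mult_mono) (auto simp: power_le_one)
    then show ?thesis
      by (simp add: abs_mult mult_right_mono)
  qed
  have 1: "\<bar>f1 t * w t\<bar> \<le> B * \<bar>w t\<bar>" and 3: "\<bar>f3 t * chi t\<bar> \<le> B * \<bar>chi t\<bar>"
    using f1[OF assms(1)] f3[OF assms(1)] by (simp_all add: abs_mult mult_right_mono)
  have 4: "\<bar>- 4 * q' * y t\<bar> = 4 * q' * \<bar>y t\<bar>"
    using q' by (simp add: abs_mult)
  have "\<bar>R t\<bar> \<le> \<bar>- 4 * q' * y t\<bar> + \<bar>f1 t * w t\<bar> + \<bar>f2 t * t\<^sup>2 * y t\<bar> + \<bar>f3 t * chi t\<bar>"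
    unfolding R_def by linarith
  with 1 2 3 4 show ?thesis
    by (simp add: algebra_simps)
qed

section \<open>The non-oscillatory region, up to t = 1/\<mu>\<close>

text \<open>
  As \<open>t \<rightarrow> 0\<close>, \<open>y = c ln t + h + o(1)\<close> and \<open>w \<rightarrow> c\<close>.  Subtracting the logarithm at the scale of the
  transition time \<open>1 / \<mu>\<close> makes \<open>u \<rightarrow> h - c ln \<mu>\<close>, which is where the renormalised datum comes from.
\<close>

definition "u t = y t - w t * ln (\<mu> * t)"

lemma u_deriv:
  assumes "t > 0"
  shows "(u has_real_derivative - (t * Q t) * ln (\<mu> * t)) (at t)"
  unfolding u_def[abs_def]
  using assms mu
  by (auto intro!: derivative_eq_intros y_deriv w_deriv simp: field_simps)

definition "N r t = (u t)\<^sup>2 + (w t)\<^sup>2 + r * (chi t)\<^sup>2"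

definition "dN r t = 2 * t * (w t - u t * ln (\<mu> * t)) * Q t + 4 * r * t * chi t * y t"

lemma N_deriv:
  assumes "t > 0"
  shows "(N r has_real_derivative dN r t) (at t)"
  unfolding N_def[abs_def] dN_def
  using assms
  by (auto intro!: derivative_eq_intros u_deriv w_deriv chi simp: algebra_simps)

text \<open>The factor of \<open>\<mu>\<^sup>2\<close> in the bound for \<open>Q\<close>:
  \<open>4 * q' + B\<close> bounds the coefficients of y in \<open>R\<close>, and 4 comes from
  \<open>a t \<le> 4 * \<mu>\<^sup>2\<close>.\<close>

definition "K = 4 * q' + 4 + B"

text \<open>With S = |u| + |w| + sqrt r |\<chi>| and L = |ln (\<mu> t)|, both y and w - u ln (\<mu>
  t) are bounded by (1 + L) S, and \<open>Q\<close> by K \<mu>^2 (1 + L) S. Hence dN is at most (2 K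
  + 4) \<mu>^2 t (1 + L)^2 S^2. Here \<mu> t (1 + L)^2 \<le> 4 by \<open>mult_ln_square_le\<close>
  and S^2 \<le> 3 N, which gives the factor 12.\<close>

lemma dN_le:
  assumes t: "0 < t" "t * \<mu> \<le> 1" and r: "1 / \<mu> \<le> r" "r \<le> \<mu>"
  shows "dN r t \<le> 12 * (2 * K + 4) * \<mu> * N r t"
proof -
  define L where "L = \<bar>ln (\<mu> * t)\<bar>"
  define \<nu> where "\<nu> = sqrt r * \<bar>chi t\<bar>"
  define S where "S = \<bar>u t\<bar> + \<bar>w t\<bar> + \<nu>"
  have r0: "r > 0"
    using r mu by (auto intro: less_le_trans[of _ "1/\<mu>"])
  have t1: "t \<le> 1"
    using t mu by (smt (verit) mult_less_cancel_left2)
  have mu2: "1 \<le> \<mu>\<^sup>2" "\<mu> \<le> \<mu>\<^sup>2"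
    using mu by (simp_all add: self_le_power)
  have K: "K \<ge> 4" "K \<ge> B"
    using q' B by (auto simp: K_def)
  have \<nu>: "\<nu> \<ge> 0" "\<nu>\<^sup>2 = r * (chi t)\<^sup>2"
    using r0 by (auto simp: \<nu>_def power_mult_distrib)
  have S: "S \<ge> 0" and L: "L \<ge> 0"
    using \<nu> by (auto simp: S_def L_def)
  have ya: "\<bar>y t\<bar> \<le> \<bar>u t\<bar> + \<bar>w t\<bar> * L"
  proof -
    have "y t = u t + w t * ln (\<mu> * t)" by (simp add: u_def)
    then show ?thesis
      unfolding L_def abs_mult[symmetric] by (metis abs_triangle_ineq)
  qed
  \<comment> \<open>The lower bound on \<open>r\<close> controls \<chi> in the forcing by sqrt r
    |\<chi>|; the upper bound gives \<open>sq2\<close>, which controls y in the derivative of r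
    \<chi>^2.\<close>
  have sq: "1 \<le> sqrt r * \<mu>\<^sup>2"
  proof -
    have "(1 / \<mu>)\<^sup>2 \<le> 1 / \<mu>"
      using mu by (simp add: power2_eq_square field_simps)
    also have "\<dots> \<le> r" by (rule r)
    finally have "1 / \<mu> \<le> sqrt r"
      by (rule real_le_rsqrt)
    then have "1 \<le> sqrt r * \<mu>"
      using mu by (simp add: field_simps)
    also have "\<dots> \<le> sqrt r * \<mu>\<^sup>2"
      using mu2 r0 by (intro mult_left_mono) auto
    finally show ?thesis .
  qed
  have chib: "\<bar>chi t\<bar> \<le> \<mu>\<^sup>2 * \<nu>"
    using mult_right_mono[OF sq, of "\<bar>chi t\<bar>"] by (simp add: \<nu>_def mult_ac)
  have sq2: "sqrt r \<le> \<mu>\<^sup>2"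
  proof -
    have "r \<le> \<mu>\<^sup>2" using r mu2 by linarith
    also have "\<dots> \<le> (\<mu>\<^sup>2)\<^sup>2"
      using mu2 by (intro self_le_power) auto
    finally show ?thesis
      by (intro real_le_lsqrt) (use r0 in auto)
  qed
  have Y: "\<bar>y t\<bar> + \<bar>w t\<bar> + \<nu> \<le> (1 + L) * S"
  proof -
    have "(1 + L) * S = \<bar>u t\<bar> + \<bar>w t\<bar> + \<nu> + L * \<bar>u t\<bar> + L * \<bar>w t\<bar> + L * \<nu>"
      by (simp add: S_def algebra_simps)
    moreover have "0 \<le> L * \<bar>u t\<bar>" "0 \<le> L * \<nu>"
      using L \<nu> by auto
    ultimately show ?thesis
      using ya by (simp add: mult.commute)
  qed
  have "\<bar>Q t\<bar> \<le> \<bar>R t\<bar> + \<bar>a t * y t\<bar>"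
    unfolding Q_def by linarith
  also have "\<dots> \<le> (4 * q' + B) * \<bar>y t\<bar> + B * \<bar>w t\<bar> + B * \<bar>chi t\<bar> + 4 * \<mu>\<^sup>2 * \<bar>y t\<bar>"
    using R_bound[OF t(1) t1] a_bounds[of t] by (auto simp: abs_mult intro!: add_mono mult_right_mono)
  also have "\<dots> \<le> (4 * q' + B) * \<mu>\<^sup>2 * \<bar>y t\<bar> + K * \<mu>\<^sup>2 * \<bar>w t\<bar> + K * (\<mu>\<^sup>2 * \<nu>) + 4 * \<mu>\<^sup>2 * \<bar>y t\<bar>"
  proof (intro add_mono order.refl)
    show "(4 * q' + B) * \<bar>y t\<bar> \<le> (4 * q' + B) * \<mu>\<^sup>2 * \<bar>y t\<bar>"
      using mu2 q' B by (intro mult_right_mono mult_left_mono) (auto simp: mult_le_cancel_left1)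
    have "B * 1 \<le> K * \<mu>\<^sup>2"
      using K B mu2 by (intro mult_mono) auto
    then show "B * \<bar>w t\<bar> \<le> K * \<mu>\<^sup>2 * \<bar>w t\<bar>"
      by (simp add: mult_right_mono)
    show "B * \<bar>chi t\<bar> \<le> K * (\<mu>\<^sup>2 * \<nu>)"
      using K B chib by (intro mult_mono) auto
  qed
  also have "\<dots> = K * \<mu>\<^sup>2 * (\<bar>y t\<bar> + \<bar>w t\<bar> + \<nu>)"
    by (simp add: K_def algebra_simps)
  also have "\<dots> \<le> K * \<mu>\<^sup>2 * ((1 + L) * S)"
    using K Y by (intro mult_left_mono) auto
  finally have Qb: "\<bar>Q t\<bar> \<le> K * \<mu>\<^sup>2 * ((1 + L) * S)" .
  have wb: "\<bar>w t - u t * ln (\<mu> * t)\<bar> \<le> (1 + L) * S"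
  proof -
    have "\<bar>w t - u t * ln (\<mu> * t)\<bar> \<le> \<bar>w t\<bar> + \<bar>u t\<bar> * L"
      unfolding L_def abs_mult[symmetric] by linarith
    also have "\<dots> \<le> (1 + L) * S"
    proof -
      have "(1 + L) * S = \<bar>u t\<bar> + \<bar>w t\<bar> + \<nu> + L * \<bar>u t\<bar> + L * \<bar>w t\<bar> + L * \<nu>"
        by (simp add: S_def algebra_simps)
      moreover have "0 \<le> L * \<bar>w t\<bar>" "0 \<le> L * \<nu>"
        using L \<nu> by auto
      ultimately show ?thesis
        using \<nu> by (simp add: mult.commute)
    qed
    finally show ?thesis .
  qed
  have "2 * t * (w t - u t * ln (\<mu> * t)) * Q t \<le> 2 * t * (((1 + L) * S) * (K * \<mu>\<^sup>2 * ((1 + L) * S)))"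
  proof -
    have "(w t - u t * ln (\<mu> * t)) * Q t \<le> \<bar>w t - u t * ln (\<mu> * t)\<bar> * \<bar>Q t\<bar>"
      by (simp flip: abs_mult)
    also have "\<dots> \<le> ((1 + L) * S) * (K * \<mu>\<^sup>2 * ((1 + L) * S))"
      using wb Qb S L by (intro mult_mono) auto
    finally show ?thesis
      using t by (simp add: mult.assoc)
  qed
  moreover have "4 * r * t * chi t * y t \<le> 4 * t * (((1 + L) * S) * (\<mu>\<^sup>2 * ((1 + L) * S)))"
  proof -
    have "\<nu> \<le> (1 + L) * S"
      using Y by linarith
    moreover have "sqrt r * \<bar>y t\<bar> \<le> \<mu>\<^sup>2 * ((1 + L) * S)"
      using sq2 Y r0 \<nu> by (intro mult_mono) auto
    ultimately have "\<nu> * (sqrt r * \<bar>y t\<bar>) \<le> ((1 + L) * S) * (\<mu>\<^sup>2 * ((1 + L) * S))"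
      by (rule mult_mono) (use r0 S L in auto)
    moreover have "\<nu> * (sqrt r * \<bar>y t\<bar>) = r * \<bar>chi t * y t\<bar>"
      using r0 by (simp add: \<nu>_def abs_mult)
    moreover have "r * (chi t * y t) \<le> r * \<bar>chi t * y t\<bar>"
      using r0 by simp
    ultimately have "r * (chi t * y t) \<le> ((1 + L) * S) * (\<mu>\<^sup>2 * ((1 + L) * S))"
      by linarith
    from mult_left_mono[OF this, of "4 * t"] show ?thesis
      using t by (simp add: mult_ac)
  qed
  ultimately have "dN r t \<le> (2 * K + 4) * \<mu> * ((\<mu> * t) * (1 + L)\<^sup>2) * S\<^sup>2"
    unfolding dN_def by (simp add: power2_eq_square algebra_simps)
  also have "\<dots> \<le> (2 * K + 4) * \<mu> * 4 * S\<^sup>2"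
  proof (intro mult_right_mono mult_left_mono)
    show "(\<mu> * t) * (1 + L)\<^sup>2 \<le> 4"
      unfolding L_def using t mu by (intro mult_ln_square_le) (auto simp: mult_ac)
  qed (use K mu in auto)
  also have "\<dots> \<le> (2 * K + 4) * \<mu> * 4 * (3 * N r t)"
  proof (rule mult_left_mono)
    have "S\<^sup>2 \<le> 3 * (\<bar>u t\<bar>\<^sup>2 + \<bar>w t\<bar>\<^sup>2 + \<nu>\<^sup>2)"
      unfolding S_def
      using zero_le_power2[of "\<bar>u t\<bar> - \<bar>w t\<bar>"] zero_le_power2[of "\<bar>u t\<bar> - \<nu>"] zero_le_power2[of "\<bar>w t\<bar> - \<nu>"]
      by (simp add: power2_eq_square algebra_simps)
    then show "S\<^sup>2 \<le> 3 * N r t"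
      by (simp add: N_def \<nu>)
  qed (use K mu in auto)
  finally show ?thesis by (simp add: algebra_simps)
qed

section \<open>The energy in the oscillatory region, from t = 1/\<mu> to t = 1\<close>

text \<open>
  \<open>E\<close> is the energy \<open>z'\<^sup>2 + a z\<^sup>2\<close> of \<open>z = \<surd>t y\<close>, for which the equation has no first-order term
  apart from the forcing, written in terms of \<open>y\<close> and \<open>w\<close>.
\<close>

definition "p t = w t + y t / 2"
definition "E t = (p t)\<^sup>2 / t + a t * t * (y t)\<^sup>2"
definition "da t = - 16 * \<omega>\<^sup>2 * t / (t\<^sup>2 + 1) ^ 3"
text \<open>Division by \<mu> brings the energy to the size of \<open>N\<close> at t = 1/\<mu>, so
  that the bounds on the two regions can be chained with the same \<open>r\<close>.\<close>

definition "M r t = E t / \<mu> + r * (chi t)\<^sup>2"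
definition "dM r t = (2 * p t * R t - p t * y t / (2 * t\<^sup>2) + da t * t * (y t)\<^sup>2) / \<mu>
  + 4 * r * t * chi t * y t"

lemma a_deriv: "(a has_real_derivative da t) (at t)"
proof -
  define v where "v = t\<^sup>2 + 1"
  have v: "v \<noteq> 0" using sq_plus_1_pos[of t] by (simp add: v_def)
  have "((\<lambda>t. (t\<^sup>2 + 1)\<^sup>2) has_real_derivative 4 * t * v) (at t)"
    by (auto intro!: derivative_eq_intros simp: v_def)
  from DERIV_divide[OF DERIV_const this, of "4 * \<omega>\<^sup>2"]
  have "(a has_real_derivative (0 * v\<^sup>2 - 4 * \<omega>\<^sup>2 * (4 * t * v)) / (v\<^sup>2 * v\<^sup>2)) (at t)"
    using v by (simp add: a_def[abs_def] v_def)
  moreover have "(0 * v\<^sup>2 - 4 * \<omega>\<^sup>2 * (4 * t * v)) / (v\<^sup>2 * v\<^sup>2) = - 16 * \<omega>\<^sup>2 * t / v ^ 3"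
    using v by (simp add: field_simps eval_nat_numeral)
  ultimately show ?thesis
    by (simp add: da_def v_def)
qed

text \<open>For z = sqrt t * y the equation is
  \<open>z'' + (a + 1 / (4 * t\<^sup>2)) * z = sqrt t * R\<close>, with z' = p / sqrt t. The three
  terms come, in this order, from the forcing, from the potential \<open>1 / (4 * t\<^sup>2)\<close>
  that the energy leaves out, and from the time dependence of \<open>a\<close>.\<close>

lemma E_deriv:
  assumes "t > 0"
  shows "(E has_real_derivative 2 * p t * R t - p t * y t / (2 * t\<^sup>2) + da t * t * (y t)\<^sup>2) (at t)"
proof -
  have "(E has_real_derivative
    (2 * p t * (t * Q t + w t / t / 2) * t - (p t)\<^sup>2) / (t * t)
      + ((da t * t + a t) * (y t)\<^sup>2 + a t * t * (2 * y t * (w t / t)))) (at t)"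
    unfolding E_def[abs_def] p_def using assms
    by (auto intro!: derivative_eq_intros y_deriv w_deriv a_deriv simp: power2_eq_square algebra_simps)
  moreover have "(2 * p t * (t * Q t + w t / t / 2) * t - (p t)\<^sup>2) / (t * t)
      + ((da t * t + a t) * (y t)\<^sup>2 + a t * t * (2 * y t * (w t / t)))
      = 2 * p t * R t - p t * y t / (2 * t\<^sup>2) + da t * t * (y t)\<^sup>2"
    using assms unfolding Q_def p_def
    by (simp add: divide_simps power2_eq_square) (simp add: algebra_simps)
  ultimately show ?thesis by simp
qed

lemma M_deriv:
  assumes "t > 0"
  shows "(M r has_real_derivative dM r t) (at t)"
  unfolding M_def[abs_def] dM_def
  using assms mu
  by (auto intro!: derivative_eq_intros E_deriv chi)

text \<open>For t \<le> 1 and \<omega> \<ge> 1 the coefficient \<open>a\<close> is at least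
  \<open>\<mu>\<^sup>2\<close>, so the arithmetic-geometric mean inequality gives |p| |y| \<le> E /
  (2 \<mu>), and the omitted potential costs only the rate
  \<open>1 / (4 * \<mu> * t\<^sup>2)\<close>. The term with \<open>da\<close> has the good sign
  because \<open>a\<close> decreases. Of the remaining rate, \<open>4 * q' + 5 * B\<close> is due to
  the forcing and 2 to the equation for \<chi>.\<close>

lemma dM_le:
  assumes t: "0 < t" "t \<le> 1" and l1: "\<omega> \<ge> 1" and r: "1 / \<mu> \<le> r" "r \<le> \<mu>"
  shows "dM r t \<le> (4 * q' + 5 * B + 2 + 1 / (4 * \<mu> * t\<^sup>2)) * M r t"
proof -
  define e where "e = E t / \<mu>"
  have ml: "\<mu> = \<omega>" using l1 by (simp add: \<mu>_def)
  have r0: "r > 0"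
    using r mu by (auto intro: less_le_trans[of _ "1/\<mu>"])
  have am: "a t \<ge> \<mu>\<^sup>2"
  proof -
    have "t\<^sup>2 + 1 \<le> 2" using t by (simp add: power_le_one)
    then have "(t\<^sup>2 + 1)\<^sup>2 \<le> 2\<^sup>2"
      by (intro power_mono) auto
    then have "4 * \<omega>\<^sup>2 / 4 \<le> 4 * \<omega>\<^sup>2 / (t\<^sup>2 + 1)\<^sup>2"
      by (intro divide_left_mono) (auto simp: sq_plus_1_pos[THEN less_imp_neq, symmetric])
    then show ?thesis by (simp add: a_def ml)
  qed
  have "\<mu>\<^sup>2 * (t * (y t)\<^sup>2) \<le> a t * (t * (y t)\<^sup>2)"
    using am t by (intro mult_right_mono) auto
  then have E1: "(p t)\<^sup>2 / t + \<mu>\<^sup>2 * t * (y t)\<^sup>2 \<le> E t"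
    by (simp add: E_def mult.assoc)
  have pp: "0 \<le> (p t)\<^sup>2 / t" and yy: "0 \<le> \<mu>\<^sup>2 * t * (y t)\<^sup>2"
    using t by auto
  have E0: "E t \<ge> 0" using E1 pp yy by linarith
  then have e0: "e \<ge> 0" using mu by (simp add: e_def)
  have py: "\<bar>p t\<bar> * \<bar>y t\<bar> \<le> e / 2"
  proof -
    have "2 * \<mu> * (\<bar>p t\<bar> * \<bar>y t\<bar>) \<le> (p t)\<^sup>2 / t + \<mu>\<^sup>2 * t * (y t)\<^sup>2"
    proof -
      have "0 \<le> (\<bar>p t\<bar> - \<mu> * t * \<bar>y t\<bar>)\<^sup>2 / t"
        using t by simp
      also have "\<dots> = (p t)\<^sup>2 / t + \<mu>\<^sup>2 * t * (y t)\<^sup>2 - 2 * \<mu> * (\<bar>p t\<bar> * \<bar>y t\<bar>)"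
        using t by (simp add: power2_diff power_mult_distrib diff_divide_distrib add_divide_distrib)
           (simp add: power2_eq_square)
      finally show ?thesis by simp
    qed
    then show ?thesis
      using E1 mu by (simp add: e_def field_simps)
  qed
  have p2: "(p t)\<^sup>2 / \<mu> \<le> e"
  proof -
    have "(p t)\<^sup>2 \<le> (p t)\<^sup>2 / t"
      using t mult_left_le_one_le[of "(p t)\<^sup>2" t] by (simp add: field_simps)
    then have "(p t)\<^sup>2 \<le> E t" using E1 yy by linarith
    then show ?thesis using mu by (simp add: e_def divide_right_mono)
  qed
  have y2: "\<mu> * t * (y t)\<^sup>2 \<le> e"
  proof -
    have "\<mu>\<^sup>2 * t * (y t)\<^sup>2 \<le> E t" using E1 pp by linarith
    then show ?thesis using mu by (simp add: e_def field_simps power2_eq_square)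
  qed
  have Rb: "\<bar>R t\<bar> \<le> (4 * q' + 2 * B) * \<bar>y t\<bar> + B * \<bar>p t\<bar> + B * \<bar>chi t\<bar>"
  proof -
    have "\<bar>w t\<bar> \<le> \<bar>p t\<bar> + \<bar>y t\<bar>"
      unfolding p_def by linarith
    then have "B * \<bar>w t\<bar> \<le> B * (\<bar>p t\<bar> + \<bar>y t\<bar>)"
      using B by (intro mult_left_mono)
    then show ?thesis
      using R_bound[OF t] by (simp add: algebra_simps)
  qed
  have "2 * p t * R t / \<mu> \<le> (4 * q' + 2 * B) * e + 3 * B * e + B * (r * (chi t)\<^sup>2)"
  proof -
    have "p t * R t \<le> \<bar>p t\<bar> * \<bar>R t\<bar>"
      by (simp flip: abs_mult)
    also have "\<dots> \<le> \<bar>p t\<bar> * ((4 * q' + 2 * B) * \<bar>y t\<bar> + B * \<bar>p t\<bar> + B * \<bar>chi t\<bar>)"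
      using Rb by (intro mult_left_mono) auto
    also have "\<dots> = (4 * q' + 2 * B) * (\<bar>p t\<bar> * \<bar>y t\<bar>) + B * (p t)\<^sup>2 + B * (\<bar>p t\<bar> * \<bar>chi t\<bar>)"
      by (simp add: algebra_simps power2_eq_square)
    also have "\<dots> \<le> (4 * q' + 2 * B) * (e / 2) + B * (p t)\<^sup>2 + B * (((p t)\<^sup>2 + (chi t)\<^sup>2) / 2)"
    proof (intro add_mono mult_left_mono order.refl)
      show "\<bar>p t\<bar> * \<bar>chi t\<bar> \<le> ((p t)\<^sup>2 + (chi t)\<^sup>2) / 2"
        using zero_le_power2[of "\<bar>p t\<bar> - \<bar>chi t\<bar>"] by (simp add: power2_diff)
    qed (use py q' B in auto)
    finally have "2 * p t * R t / \<mu> \<le> ((4 * q' + 2 * B) * e + 3 * B * (p t)\<^sup>2 + B * (chi t)\<^sup>2) / \<mu>"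
      using mu by (intro divide_right_mono) (auto simp: field_simps)
    also have "\<dots> = (4 * q' + 2 * B) * e / \<mu> + 3 * B * ((p t)\<^sup>2 / \<mu>) + B * (1 / \<mu> * (chi t)\<^sup>2)"
      by (simp add: add_divide_distrib)
    also have "\<dots> \<le> (4 * q' + 2 * B) * e + 3 * B * e + B * (r * (chi t)\<^sup>2)"
    proof (intro add_mono mult_left_mono mult_right_mono)
      show "(4 * q' + 2 * B) * e / \<mu> \<le> (4 * q' + 2 * B) * e"
        using mu q' B e0 divide_left_mono[of 1 \<mu> "(4 * q' + 2 * B) * e"] by simp
    qed (use p2 r B in auto)
    finally show ?thesis .
  qed
  moreover have "- (p t * y t / (2 * t\<^sup>2)) / \<mu> \<le> 1 / (4 * \<mu> * t\<^sup>2) * e"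
  proof -
    have "- (p t * y t) \<le> e / 2"
      using py by (simp flip: abs_mult)
    then have "- (p t * y t) / (2 * t\<^sup>2 * \<mu>) \<le> (e / 2) / (2 * t\<^sup>2 * \<mu>)"
      using t mu by (intro divide_right_mono) auto
    then show ?thesis by (simp add: mult_ac)
  qed
  moreover have "da t * t * (y t)\<^sup>2 / \<mu> \<le> 0"
  proof -
    have "da t \<le> 0"
      using t by (simp add: da_def divide_nonpos_nonneg)
    then show ?thesis
      using t mu by (intro divide_nonpos_pos mult_nonpos_nonneg) auto
  qed
  moreover have "4 * r * t * chi t * y t \<le> 2 * e + 2 * (r * (chi t)\<^sup>2)"
  proof -
    have "2 * (chi t * (t * y t)) \<le> (chi t)\<^sup>2 + (t * y t)\<^sup>2"
      using zero_le_power2[of "chi t - t * y t"] by (simp add: power2_diff)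
    then have "2 * r * (2 * (chi t * (t * y t))) \<le> 2 * r * ((chi t)\<^sup>2 + (t * y t)\<^sup>2)"
      using r0 by (intro mult_left_mono) auto
    moreover have "r * (t * y t)\<^sup>2 \<le> e"
    proof -
      have "t\<^sup>2 \<le> t" using t by (simp add: power2_eq_square mult_left_le)
      then have "r * (t\<^sup>2 * (y t)\<^sup>2) \<le> \<mu> * (t * (y t)\<^sup>2)"
        using r mu r0 t by (intro mult_mono) auto
      then show ?thesis using y2 by (simp add: power_mult_distrib mult.assoc)
    qed
    ultimately show ?thesis by (simp add: algebra_simps)
  qed
  ultimately have "dM r t \<le> (4 * q' + 5 * B + 2 + 1 / (4 * \<mu> * t\<^sup>2)) * e + (B + 2) * (r * (chi t)\<^sup>2)"
    unfolding dM_def by (simp add: add_divide_distrib diff_divide_distrib algebra_simps)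
  also have "\<dots> \<le> (4 * q' + 5 * B + 2 + 1 / (4 * \<mu> * t\<^sup>2)) * e + (4 * q' + 5 * B + 2 + 1 / (4 * \<mu> * t\<^sup>2)) * (r * (chi t)\<^sup>2)"
  proof (intro add_left_mono mult_right_mono)
    have "0 \<le> 1 / (4 * \<mu> * t\<^sup>2)" using mu by simp
    then show "B + 2 \<le> 4 * q' + 5 * B + 2 + 1 / (4 * \<mu> * t\<^sup>2)"
      using q' B by linarith
  qed (use r0 in auto)
  finally show ?thesis
    by (simp add: M_def e_def ring_distribs)
qed

section \<open>Propagation of the data from t = 0 to t = 1\<close>

definition "G\<^sub>1 = exp (12 * (2 * K + 4))"

text \<open>Gronwall cannot start at the singular time 0, so it is run from each small t, and
  \<open>N r t\<close> then tends to its value on the data. Since \<open>u\<close> contains w ln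
  (\<mu> t), convergence of w to c is not enough: the difference has to beat the logarithm, which is
  the hypothesis with the factor \<open>ln t\<close>. The rate is a multiple of \<mu> on an interval
  shorter than 1/\<mu>, so \<open>G\<^sub>1\<close> does not depend on \<mu>.\<close>

lemma N_at_transition:
  assumes r: "1 / \<mu> \<le> r" "r \<le> \<mu>"
    and y0: "((\<lambda>t. y t - (c * ln t + h)) \<longlongrightarrow> 0) (at_right 0)"
    and w0: "((\<lambda>t. (t * dy t - c) * ln t) \<longlongrightarrow> 0) (at_right 0)" "((\<lambda>t. t * dy t) \<longlongrightarrow> c) (at_right 0)"
    and chi0: "(chi \<longlongrightarrow> b) (at_right 0)"
  shows "N r (1 / \<mu>) \<le> G\<^sub>1 * ((h - c * ln \<mu>)\<^sup>2 + c\<^sup>2 + r * b\<^sup>2)"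
proof -
  have u: "(u \<longlongrightarrow> h - c * ln \<mu>) (at_right 0)"
  proof -
    have "((\<lambda>t. (y t - (c * ln t + h)) + h - (t * dy t - c) * ln t - t * dy t * ln \<mu>)
        \<longlongrightarrow> 0 + h - 0 - c * ln \<mu>) (at_right 0)"
      by (intro tendsto_intros y0 w0)
    moreover have "\<forall>\<^sub>F t in at_right 0.
        (y t - (c * ln t + h)) + h - (t * dy t - c) * ln t - t * dy t * ln \<mu> = u t"
      using eventually_at_right_less[of 0]
      by eventually_elim (use mu in \<open>simp add: u_def w_def ln_mult algebra_simps\<close>)
    ultimately show ?thesis
      by (simp add: tendsto_cong)
  qed
  have "((\<lambda>t. N r t * G\<^sub>1) \<longlongrightarrow> ((h - c * ln \<mu>)\<^sup>2 + c\<^sup>2 + r * b\<^sup>2) * G\<^sub>1) (at_right 0)"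
    unfolding N_def w_def by (intro tendsto_intros u w0 chi0)
  moreover have "\<forall>\<^sub>F t in at_right 0. N r (1 / \<mu>) \<le> N r t * G\<^sub>1"
  proof -
    have "\<forall>\<^sub>F t in at_right 0. t \<in> {0<..<1 / \<mu>}"
      using mu by (intro eventually_at_right_real) auto
    then show ?thesis
    proof eventually_elim
      case (elim t)
      have "N r (1 / \<mu>) \<le> N r t * exp (12 * (2 * K + 4) * \<mu> * (1 / \<mu>) - 12 * (2 * K + 4) * \<mu> * t)"
      proof (rule gronwall_mult)
        fix x assume x: "t \<le> x" "x \<le> 1 / \<mu>"
        then have x0: "x > 0" "x * \<mu> \<le> 1" using elim mu by (auto simp: field_simps)
        show "(N r has_real_derivative dN r x) (at x)"
          by (rule N_deriv[OF x0(1)])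
        show "((\<lambda>x. 12 * (2 * K + 4) * \<mu> * x) has_real_derivative 12 * (2 * K + 4) * \<mu>) (at x)"
          by (auto intro!: derivative_eq_intros)
        show "dN r x \<le> 12 * (2 * K + 4) * \<mu> * N r x"
          by (rule dN_le[OF x0 r])
      qed (use elim in auto)
      also have "\<dots> \<le> N r t * G\<^sub>1"
      proof (rule mult_left_mono)
        have "0 \<le> 12 * (2 * K + 4) * \<mu> * t"
          using q' B mu elim by (auto simp: K_def intro!: mult_nonneg_nonneg)
        then show "exp (12 * (2 * K + 4) * \<mu> * (1 / \<mu>) - 12 * (2 * K + 4) * \<mu> * t) \<le> G\<^sub>1"
          using mu by (simp add: G\<^sub>1_def)
        have "r \<ge> 0"
          using r mu by (auto intro: order.trans[of _ "1/\<mu>"])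
        then show "0 \<le> N r t" by (simp add: N_def)
      qed
      finally show ?case .
    qed
  qed
  ultimately show ?thesis
    by (subst mult.commute) (rule tendsto_lowerbound, auto)
qed

definition "G\<^sub>2 = exp (4 * q' + 5 * B + 3)"

lemma M_at_1:
  assumes l1: "\<omega> \<ge> 1" and r: "1 / \<mu> \<le> r" "r \<le> \<mu>"
  shows "M r 1 \<le> 5 * G\<^sub>2 * N r (1 / \<mu>)"
proof -
  define k where "k = 4 * q' + 5 * B + 2"
  define T where "T = 1 / \<mu>"
  have T: "0 < T" "T \<le> 1" "\<mu> * T = 1"
    using mu by (auto simp: T_def)
  have r0: "r \<ge> 0"
    using r mu by (auto intro: order.trans[of _ "1/\<mu>"])
  \<comment> \<open>The rate is of size \<mu> near t = 1/\<mu>, but its antiderivative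
    \<open>k * t - 1 / (4 * \<mu> * t)\<close> grows by at most k + 1/4 on the interval.\<close>
  have "M r 1 \<le> M r T * exp ((k * 1 - 1 / (4 * \<mu> * 1)) - (k * T - 1 / (4 * \<mu> * T)))"
  proof (rule gronwall_mult[where k = "\<lambda>t. k + 1 / (4 * \<mu> * t\<^sup>2)"])
    fix x assume x: "T \<le> x" "x \<le> 1"
    then have x0: "x > 0" using T by linarith
    show "(M r has_real_derivative dM r x) (at x)"
      by (rule M_deriv[OF x0])
    show "((\<lambda>x. k * x - 1 / (4 * \<mu> * x)) has_real_derivative k + 1 / (4 * \<mu> * x\<^sup>2)) (at x)"
      using x0 mu by (auto intro!: derivative_eq_intros simp: power2_eq_square)
    show "dM r x \<le> (k + 1 / (4 * \<mu> * x\<^sup>2)) * M r x"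
      using dM_le[OF x0 x(2) l1 r] by (simp add: k_def)
  qed (use T in auto)
  also have "\<dots> \<le> M r T * G\<^sub>2"
  proof (rule mult_left_mono)
    have "0 \<le> k * T" "0 \<le> 1 / (4 * \<mu>)" using T q' B mu by (auto simp: k_def)
    moreover have "1 / (4 * \<mu> * T) = 1 / 4" using T by (simp add: mult.assoc)
    moreover have *: "c * 1 - z - (x - v) \<le> c + 1"
      if "0 \<le> x" "0 \<le> z" "v = 1 / 4" for c x z v :: real
      using that by linarith
    ultimately have "k * 1 - 1 / (4 * \<mu> * 1) - (k * T - 1 / (4 * \<mu> * T)) \<le> k + 1"
      by (intro *) (simp_all add: mult.assoc)
    then show "exp ((k * 1 - 1 / (4 * \<mu> * 1)) - (k * T - 1 / (4 * \<mu> * T))) \<le> G\<^sub>2"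
      by (simp add: G\<^sub>2_def k_def)
    show "0 \<le> M r T"
      using r0 mu T a_bounds[of T] by (auto simp: M_def E_def intro!: add_nonneg_nonneg divide_nonneg_pos)
  qed
  \<comment> \<open>At T = 1/\<mu> the logarithm vanishes, so u = y. The energy divided by \<mu> is
    \<open>(p T)\<^sup>2\<close> plus at most \<open>4 * (y T)\<^sup>2\<close>, and splitting the
    cross term of \<open>(p T)\<^sup>2\<close> unevenly, with only 5/16 in front of
    \<open>(y T)\<^sup>2\<close>, keeps the total below the factor 5.\<close>
  also have "\<dots> \<le> 5 * N r T * G\<^sub>2"
  proof (rule mult_right_mono)
    have "E T / \<mu> = (p T)\<^sup>2 + a T / \<mu>\<^sup>2 * (y T)\<^sup>2"
      using mu by (simp add: E_def T_def field_simps power2_eq_square)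
    also have "\<dots> \<le> (p T)\<^sup>2 + 4 * (y T)\<^sup>2"
      using a_bounds[of T] mu by (intro add_left_mono mult_right_mono) (auto simp: divide_le_eq)
    also have "(p T)\<^sup>2 \<le> 5 * (w T)\<^sup>2 + 5 / 16 * (y T)\<^sup>2"
    proof -
      have "0 \<le> (2 * w T - y T / 4)\<^sup>2" by simp
      then show ?thesis unfolding p_def by (simp add: power2_eq_square algebra_simps)
    qed
    finally have "E T / \<mu> \<le> 5 * (w T)\<^sup>2 + 5 * (y T)\<^sup>2"
      using zero_le_power2[of "y T"] by linarith
    moreover have "u T = y T"
      using T by (simp add: u_def)
    moreover have "0 \<le> r * (chi T)\<^sup>2"
      using r0 by simp
    ultimately show "M r T \<le> 5 * N r T"
      by (simp add: M_def N_def)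
  qed (simp add: G\<^sub>2_def)
  finally show ?thesis by (simp add: T_def mult_ac)
qed

lemma mode_bound:
  assumes r: "1 / \<mu> \<le> r" "r \<le> \<mu>"
    and lim: "((\<lambda>t. y t - (c * ln t + h)) \<longlongrightarrow> 0) (at_right 0)"
      "((\<lambda>t. (t * dy t - c) * ln t) \<longlongrightarrow> 0) (at_right 0)" "((\<lambda>t. t * dy t) \<longlongrightarrow> c) (at_right 0)"
      "(chi \<longlongrightarrow> b) (at_right 0)"
  shows "\<mu> * (y 1)\<^sup>2 + (dy 1)\<^sup>2 / \<mu> + r * (chi 1)\<^sup>2
    \<le> 20 * G\<^sub>1 * G\<^sub>2 * ((h - c * ln \<mu>)\<^sup>2 + c\<^sup>2 + r * b\<^sup>2)"
proof -
  define D where "D = (h - c * ln \<mu>)\<^sup>2 + c\<^sup>2 + r * b\<^sup>2"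
  have r0: "r \<ge> 0"
    using r mu by (auto intro: order.trans[of _ "1/\<mu>"])
  have ND: "N r (1 / \<mu>) \<le> G\<^sub>1 * D"
    unfolding D_def by (rule N_at_transition[OF r lim])
  have D: "D \<ge> 0" using r0 by (simp add: D_def)
  have G: "G\<^sub>2 \<ge> 1" "G\<^sub>1 \<ge> 0"
    using q' B by (auto simp: G\<^sub>2_def G\<^sub>1_def)
  show ?thesis
  proof (cases "\<omega> \<ge> 1")
    case True
    then have ml: "\<mu> = \<omega>" by (simp add: \<mu>_def)
    have M1: "M r 1 = (p 1)\<^sup>2 / \<mu> + \<mu> * (y 1)\<^sup>2 + r * (chi 1)\<^sup>2"
      using mu ml by (simp add: M_def E_def a_def field_simps power2_eq_square)
    \<comment> \<open>At t = 1 the energy sees y' only through p = y' + y/2. Recovering y' costs the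
      factor 4, which with the 5 of \<open>M_at_1\<close> makes 20.\<close>
    have "(dy 1)\<^sup>2 \<le> 3 * (p 1)\<^sup>2 + (y 1)\<^sup>2"
    proof -
      have "0 \<le> (2 * dy 1 + 3 / 2 * y 1)\<^sup>2" by simp
      then have "0 \<le> 4 * (dy 1)\<^sup>2 + 6 * (dy 1 * y 1) + 9 / 4 * (y 1)\<^sup>2"
        by (simp add: power2_sum power_mult_distrib power_divide algebra_simps)
      moreover have "(p 1)\<^sup>2 = (dy 1)\<^sup>2 + dy 1 * y 1 + (y 1)\<^sup>2 / 4"
        by (simp add: p_def w_def power2_sum power_divide)
      ultimately show ?thesis
        using zero_le_power2[of "dy 1"] zero_le_power2[of "y 1"] by linarith
    qed
    then have "(dy 1)\<^sup>2 / \<mu> \<le> 3 * ((p 1)\<^sup>2 / \<mu>) + (y 1)\<^sup>2 / \<mu>"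
      using mu by (simp add: field_simps)
    also have "(y 1)\<^sup>2 / \<mu> \<le> \<mu> * (y 1)\<^sup>2"
    proof -
      have "1 * (y 1)\<^sup>2 \<le> (\<mu> * \<mu>) * (y 1)\<^sup>2"
        using mu mult_mono[of 1 \<mu> 1 \<mu>] by (intro mult_right_mono) auto
      then show ?thesis using mu by (simp add: field_simps)
    qed
    finally have *: "(dy 1)\<^sup>2 / \<mu> \<le> 3 * ((p 1)\<^sup>2 / \<mu>) + \<mu> * (y 1)\<^sup>2"
      by simp
    have "\<mu> * (y 1)\<^sup>2 + (dy 1)\<^sup>2 / \<mu> + r * (chi 1)\<^sup>2 \<le> 4 * M r 1"
    proof -
      have "0 \<le> (p 1)\<^sup>2 / \<mu>" "0 \<le> \<mu> * (y 1)\<^sup>2" "0 \<le> r * (chi 1)\<^sup>2"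
        using mu r0 by auto
      with * show ?thesis unfolding M1 by argo
    qed
    also have "\<dots> \<le> 4 * (5 * G\<^sub>2 * (G\<^sub>1 * D))"
    proof -
      have "5 * G\<^sub>2 * N r (1 / \<mu>) \<le> 5 * G\<^sub>2 * (G\<^sub>1 * D)"
        using ND G by (intro mult_left_mono) auto
      then show ?thesis using M_at_1[OF True r] by linarith
    qed
    finally show ?thesis by (simp add: D_def mult_ac)
  next
    case False
    \<comment> \<open>For \<omega> < 1 there is no second region: the transition time is 1, and
      \<open>N\<close> at that time is already the left-hand side.\<close>
    then have m1: "\<mu> = 1" by (simp add: \<mu>_def)
    have "\<mu> * (y 1)\<^sup>2 + (dy 1)\<^sup>2 / \<mu> + r * (chi 1)\<^sup>2 = N r (1 / \<mu>)"
      by (simp add: m1 N_def u_def w_def)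
    also have "\<dots> \<le> G\<^sub>1 * D" by (rule ND)
    also have "\<dots> \<le> (20 * G\<^sub>2) * (G\<^sub>1 * D)"
      using mult_right_mono[of 1 "20 * G\<^sub>2" "G\<^sub>1 * D"] G D by simp
    finally show ?thesis by (simp add: D_def mult_ac)
  qed
qed

end

subsection \<open>Smooth functions on the sphere\<close>

lemma frechet_derivative_eqI:
  "(f has_derivative f') (at x) \<Longrightarrow> frechet_derivative f (at x) v = f' v"
  by (drule frechet_derivative_at) simp

lemma Ck_on_cong:
  assumes "open U" "\<And>x. x \<in> U \<Longrightarrow> f x = g x"
  shows "Ck_on k f U \<longleftrightarrow> Ck_on k g U"
  using assms(2)
proof (induction k arbitrary: f g)
  case 0
  then show ?case by (auto intro: continuous_on_cong)
next
  case (Suc k)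
  have "f differentiable at x \<longleftrightarrow> g differentiable at x" if "x \<in> U" for x
    using Suc.prems that \<open>open U\<close> unfolding differentiable_def
    by (metis has_derivative_transform_within_open)
  moreover have "Ck_on k (\<lambda>x. frechet_derivative f (at x) v) U \<longleftrightarrow> Ck_on k (\<lambda>x. frechet_derivative g (at x) v) U"
    if "\<forall>x\<in>U. f differentiable at x" for v
    using Suc.prems that \<open>open U\<close>
    by (intro Suc.IH) (auto simp: frechet_derivative_transform_within_open)
  ultimately show ?case by auto
qed

lemma smooth_on_cong:
  "open U \<Longrightarrow> (\<And>x. x \<in> U \<Longrightarrow> f x = g x) \<Longrightarrow> smooth_on f U \<longleftrightarrow> smooth_on g U"
  unfolding smooth_on_def using Ck_on_cong by blast

lemma Ck_on_SucD: "Ck_on (Suc k) f U \<Longrightarrow> Ck_on k f U"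
proof (induction k arbitrary: f)
  case 0
  then show ?case
    by (auto intro!: continuous_at_imp_continuous_on differentiable_imp_continuous_within)
next
  case (Suc k)
  then have "\<forall>v. Ck_on k (\<lambda>x. frechet_derivative f (at x) v) U"
    by (metis Ck_on.simps(2))
  with Suc.prems show ?case by auto
qed

lemma Ck_on_const: "Ck_on k (\<lambda>x. c) U"
  by (induction k arbitrary: c) (auto simp: frechet_derivative_const)

lemma Ck_on_bounded_linear:
  assumes "bounded_linear f"
  shows "Ck_on k f U"
proof (cases k)
  case 0
  then show ?thesis using assms by (auto intro: linear_continuous_on)
next
  case (Suc m)
  have "(f has_derivative f) (at x)" for x
    using assms by (rule bounded_linear_imp_has_derivative)
  then have "frechet_derivative f (at x) = f" "f differentiable at x" for x
    by (auto simp: frechet_derivative_at[symmetric] differentiable_def)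
  then show ?thesis using Suc by (simp add: Ck_on_const)
qed

lemma Ck_on_add:
  assumes "open U" "Ck_on k f U" "Ck_on k g U"
  shows "Ck_on k (\<lambda>x. f x + g x) U"
  using assms(2,3)
proof (induction k arbitrary: f g)
  case 0
  then show ?case by (auto intro: continuous_intros)
next
  case (Suc k)
  have "Ck_on k (\<lambda>x. frechet_derivative (\<lambda>x. f x + g x) (at x) v) U" for v
  proof (subst Ck_on_cong[OF \<open>open U\<close>])
    show "frechet_derivative (\<lambda>x. f x + g x) (at x) v
        = frechet_derivative f (at x) v + frechet_derivative g (at x) v" if "x \<in> U" for x
      by (rule frechet_derivative_eqI, intro has_derivative_add)
         (use Suc.prems that in \<open>auto simp flip: frechet_derivative_works\<close>)
  qed (use Suc in auto)
  then show ?case using Suc.prems by auto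
qed

lemma Ck_on_mult:
  assumes "open U" "Ck_on k f U" "Ck_on k g U"
  shows "Ck_on k (\<lambda>x. f x * g x) U"
  using assms(2,3)
proof (induction k arbitrary: f g)
  case 0
  then show ?case by (auto intro: continuous_intros)
next
  case (Suc k)
  have "Ck_on k (\<lambda>x. frechet_derivative (\<lambda>x. f x * g x) (at x) v) U" for v
  proof (subst Ck_on_cong[OF \<open>open U\<close>])
    show "frechet_derivative (\<lambda>x. f x * g x) (at x) v
        = f x * frechet_derivative g (at x) v + frechet_derivative f (at x) v * g x" if "x \<in> U" for x
    proof -
      have "((\<lambda>x. f x * g x) has_derivative
          (\<lambda>v. f x * frechet_derivative g (at x) v + frechet_derivative f (at x) v * g x)) (at x)"
        using Suc.prems that by (intro has_derivative_mult) (auto simp flip: frechet_derivative_works)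
      then show ?thesis by (rule frechet_derivative_eqI)
    qed
    show "Ck_on k (\<lambda>x. f x * frechet_derivative g (at x) v + frechet_derivative f (at x) v * g x) U"
      using Suc.prems Ck_on_SucD[OF Suc.prems(1)] Ck_on_SucD[OF Suc.prems(2)]
      by (intro Ck_on_add[OF \<open>open U\<close>] Suc.IH) auto
  qed
  then show ?case using Suc.prems by auto
qed

text \<open>With an affine inner map, the derivative in direction v is again of the form
  \<open>f (c + A x)\<close>, with f replaced by its derivative in the fixed direction A v, so the
  induction closes. The map in question is the inclusion of a time slice.\<close>

lemma Ck_on_affine:
  fixes f :: "'b::euclidean_space \<Rightarrow> real" and A :: "'a::euclidean_space \<Rightarrow> 'b"
  assumes A: "bounded_linear A" and f: "Ck_on k f U" and V: "open V" "\<And>x. x \<in> V \<Longrightarrow> c + A x \<in> U"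
  shows "Ck_on k (\<lambda>x. f (c + A x)) V"
  using f
proof (induction k arbitrary: f)
  case 0
  have "continuous_on V A" using A by (rule linear_continuous_on)
  then show ?case using 0 V
    by (auto intro!: continuous_on_compose2[of U f] continuous_intros)
next
  case (Suc k)
  have D: "((\<lambda>x. f (c + A x)) has_derivative (\<lambda>v. frechet_derivative f (at (c + A x)) (A v))) (at x)"
    if "x \<in> V" for x
  proof -
    have "(f has_derivative frechet_derivative f (at (c + A x))) (at (c + A x))"
      using Suc.prems V(2)[OF that] by (auto simp flip: frechet_derivative_works)
    moreover have "((\<lambda>x. c + A x) has_derivative A) (at x)"
      using bounded_linear_imp_has_derivative[OF A] by (auto intro!: derivative_eq_intros)
    ultimately show ?thesis
      using has_derivative_compose[of "\<lambda>x. c + A x" A x UNIV f] by auto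
  qed
  have "Ck_on k (\<lambda>x. frechet_derivative (\<lambda>x. f (c + A x)) (at x) v) V" for v
  proof (subst Ck_on_cong[OF V(1)])
    show "frechet_derivative (\<lambda>x. f (c + A x)) (at x) v = frechet_derivative f (at (c + A x)) (A v)"
      if "x \<in> V" for x
      by (rule frechet_derivative_eqI[OF D[OF that]])
    show "Ck_on k (\<lambda>x. frechet_derivative f (at (c + A x)) (A v)) V"
      using Suc.prems by (intro Suc.IH) auto
  qed
  then show ?case using D by (auto simp: differentiable_def)
qed

lemma smooth_onD:
  assumes "smooth_on f U"
  shows "continuous_on U f" and "x \<in> U \<Longrightarrow> f differentiable at x"
    and "x \<in> U \<Longrightarrow> (f has_derivative frechet_derivative f (at x)) (at x)"
    and "smooth_on (\<lambda>x. frechet_derivative f (at x) v) U"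
proof -
  have "Ck_on 0 f U" "Ck_on (Suc 0) f U" "Ck_on (Suc k) f U" for k
    using assms by (auto simp: smooth_on_def simp del: Ck_on.simps)
  then show "continuous_on U f" "x \<in> U \<Longrightarrow> f differentiable at x"
    "smooth_on (\<lambda>x. frechet_derivative f (at x) v) U"
    unfolding smooth_on_def by auto
  then show "x \<in> U \<Longrightarrow> (f has_derivative frechet_derivative f (at x)) (at x)"
    by (auto simp flip: frechet_derivative_works)
qed

lemma smooth_on_intros:
  assumes "open U"
  shows "smooth_on (\<lambda>x. c) U"
    and "bounded_linear A \<Longrightarrow> smooth_on A U"
    and "smooth_on f U \<Longrightarrow> smooth_on g U \<Longrightarrow> smooth_on (\<lambda>x. f x + g x) U"
    and "smooth_on f U \<Longrightarrow> smooth_on g U \<Longrightarrow> smooth_on (\<lambda>x. f x * g x) U"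
  using assms by (auto simp: smooth_on_def intro: Ck_on_const Ck_on_bounded_linear Ck_on_add Ck_on_mult)

lemma smooth_on_sum:
  assumes "open U" "finite I" "\<And>i. i \<in> I \<Longrightarrow> smooth_on (f i) U"
  shows "smooth_on (\<lambda>x. \<Sum>i\<in>I. f i x) U"
  using assms(2,3) by (induction I rule: finite_induct) (auto intro: smooth_on_intros[OF assms(1)])

section \<open>Ray-constant extensions and the Laplace-Beltrami operator\<close>

lemma radial_ext_scale: "r > 0 \<Longrightarrow> radial_ext f (r *\<^sub>R x) = radial_ext f x"
  by (cases "x = 0") (auto simp: radial_ext_def field_simps)

lemma radial_ext_sphere: "norm x = 1 \<Longrightarrow> radial_ext f x = f x"
  by (simp add: radial_ext_def)

lemma radial_ext_has_derivative_scale: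
  assumes D: "(radial_ext f has_derivative D) (at x)" and r: "r > 0"
  shows "(radial_ext f has_derivative (\<lambda>v. D (v /\<^sub>R r))) (at (r *\<^sub>R x))"
proof -
  have "((\<lambda>y. radial_ext f (y /\<^sub>R r)) has_derivative (\<lambda>v. D (v /\<^sub>R r))) (at (r *\<^sub>R x))"
    by (rule has_derivative_compose[where f = "\<lambda>y. y /\<^sub>R r" and f' = "\<lambda>y. y /\<^sub>R r"])
       (use D r in \<open>auto intro!: derivative_eq_intros\<close>)
  moreover have "(\<lambda>y. radial_ext f (y /\<^sub>R r)) = radial_ext f"
    using r by (intro ext radial_ext_scale) auto
  ultimately show ?thesis by simp
qed

text \<open>The extension is homogeneous of degree 0, so its derivative is homogeneous of degree
  -1.\<close>

lemma frechet_derivative_radial_ext_scale: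
  assumes "radial_ext f differentiable (at x)" "r > 0"
  shows "frechet_derivative (radial_ext f) (at (r *\<^sub>R x)) v = frechet_derivative (radial_ext f) (at x) v /\<^sub>R r"
proof -
  have D: "(radial_ext f has_derivative frechet_derivative (radial_ext f) (at x)) (at x)"
    using assms by (simp flip: frechet_derivative_works)
  have "frechet_derivative (radial_ext f) (at (r *\<^sub>R x)) v = frechet_derivative (radial_ext f) (at x) (v /\<^sub>R r)"
    by (rule frechet_derivative_eqI[OF radial_ext_has_derivative_scale[OF D assms(2)]])
  then show ?thesis
    using linear_scale[OF has_derivative_linear[OF D]] by simp
qed

text \<open>Euler's identity in degree 0. It is what makes the gradient tangential and removes the
  radial terms in the formulas for the Laplacian and in Green's identity.\<close>

lemma frechet_derivative_radial_ext_radial: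
  assumes "radial_ext f differentiable (at x)"
  shows "frechet_derivative (radial_ext f) (at x) x = 0"
proof -
  let ?D = "frechet_derivative (radial_ext f) (at x)"
  have D: "(radial_ext f has_derivative ?D) (at x)"
    using assms by (simp flip: frechet_derivative_works)
  have "((\<lambda>r::real. radial_ext f (r *\<^sub>R x)) has_derivative (\<lambda>h. ?D (h *\<^sub>R x))) (at 1)"
    by (rule has_derivative_compose[where f = "\<lambda>r. r *\<^sub>R x" and f' = "\<lambda>h. h *\<^sub>R x"])
       (use D in \<open>auto intro!: derivative_eq_intros\<close>)
  moreover have "((\<lambda>r::real. radial_ext f (r *\<^sub>R x)) has_derivative (\<lambda>h. 0)) (at 1)"
    by (rule has_derivative_transform_within_open[where s = "{0<..}" and f = "\<lambda>_. radial_ext f x"])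
       (auto simp: radial_ext_scale)
  ultimately have "(\<lambda>h. ?D (h *\<^sub>R x)) = (\<lambda>h. 0)"
    by (rule has_derivative_unique)
  from fun_cong[OF this, of 1] show ?thesis by simp
qed

text \<open>The factor |x| restores degree 0: away from the origin and for smooth f, this is the
  ray-constant extension of the component of \<open>grad_sphere f\<close> along b, and
  \<open>dflux\<close> is its derivative.\<close>

definition flux :: "('a::euclidean_space \<Rightarrow> real) \<Rightarrow> 'a \<Rightarrow> 'a \<Rightarrow> real" where
  "flux f b x = norm x * frechet_derivative (radial_ext f) (at x) b"

definition dflux :: "('a::euclidean_space \<Rightarrow> real) \<Rightarrow> 'a \<Rightarrow> 'a \<Rightarrow> 'a \<Rightarrow> real" where
  "dflux f b x v = (x \<bullet> v / norm x) * frechet_derivative (radial_ext f) (at x) b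
    + norm x * frechet_derivative (\<lambda>x. frechet_derivative (radial_ext f) (at x) b) (at x) v"

context
  fixes f :: "'a::euclidean_space \<Rightarrow> real"
  assumes f: "smooth_sphere f"
begin

lemma smooth_sphere_differentiable: "x \<noteq> 0 \<Longrightarrow> radial_ext f differentiable (at x)"
  using f by (auto simp: smooth_sphere_def intro: smooth_onD)

lemma radial_ext_has_derivative:
  "x \<noteq> 0 \<Longrightarrow> (radial_ext f has_derivative frechet_derivative (radial_ext f) (at x)) (at x)"
  using smooth_sphere_differentiable by (simp flip: frechet_derivative_works)

lemma partial_smooth: "smooth_on (\<lambda>x. frechet_derivative (radial_ext f) (at x) b) (UNIV - {0})"
  using f by (auto simp: smooth_sphere_def intro: smooth_onD)

lemma smooth_sphere_continuous: "continuous_on (sphere 0 1) f"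
proof -
  have "continuous_on (sphere 0 1) (radial_ext f)"
    using f by (auto simp: smooth_sphere_def intro: continuous_on_subset smooth_onD(1))
  then show ?thesis
    by (rule continuous_on_eq) (simp add: radial_ext_sphere)
qed

lemma radial_ext_grad_sphere:
  assumes "x \<noteq> 0"
  shows "radial_ext (grad_sphere f) x
    = (\<Sum>b\<in>Basis. (norm x * frechet_derivative (radial_ext f) (at x) b) *\<^sub>R b)"
proof -
  have "radial_ext (grad_sphere f) x
      = (\<Sum>b\<in>Basis. frechet_derivative (radial_ext f) (at (inverse (norm x) *\<^sub>R x)) b *\<^sub>R b)"
    by (simp add: radial_ext_def grad_sphere_def)
  also have "\<dots> = (\<Sum>b\<in>Basis. (norm x * frechet_derivative (radial_ext f) (at x) b) *\<^sub>R b)"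
    using assms by (intro sum.cong refl)
      (subst frechet_derivative_radial_ext_scale, auto intro: smooth_sphere_differentiable)
  finally show ?thesis .
qed

lemma flux_has_derivative:
  assumes "x \<noteq> 0"
  shows "(flux f b has_derivative dflux f b x) (at x)"
proof -
  have "((\<lambda>x. frechet_derivative (radial_ext f) (at x) b) has_derivative
      frechet_derivative (\<lambda>x. frechet_derivative (radial_ext f) (at x) b) (at x)) (at x)"
    using smooth_onD(3)[OF partial_smooth] assms by simp
  moreover have "(norm has_derivative (\<lambda>h. x \<bullet> h / norm x)) (at x)"
    using has_derivative_norm[OF assms] by (simp add: sgn_div_norm inner_commute divide_inverse mult.commute)
  ultimately show ?thesis
    unfolding flux_def[abs_def] dflux_def[abs_def]
    by (auto intro!: derivative_eq_intros simp: algebra_simps)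
qed

lemma radial_ext_grad_has_derivative:
  assumes "x \<noteq> 0"
  shows "(radial_ext (grad_sphere f) has_derivative (\<lambda>v. \<Sum>b\<in>Basis. dflux f b x v *\<^sub>R b)) (at x)"
proof (rule has_derivative_transform_within_open)
  show "((\<lambda>x. \<Sum>b\<in>Basis. flux f b x *\<^sub>R b) has_derivative (\<lambda>v. \<Sum>b\<in>Basis. dflux f b x v *\<^sub>R b)) (at x)"
    by (intro has_derivative_sum has_derivative_scaleR_left flux_has_derivative assms)
  show "open (UNIV - {0::'a})" by (simp add: open_delete)
qed (use assms in \<open>auto simp: radial_ext_grad_sphere flux_def\<close>)

lemma laplace_beltrami_eq_dflux:
  assumes "x \<noteq> 0"
  shows "laplace_beltrami f x = (\<Sum>b\<in>Basis. dflux f b x b)"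
proof -
  have "frechet_derivative (radial_ext (grad_sphere f)) (at x) b \<bullet> b = dflux f b x b" if "b \<in> Basis" for b
  proof -
    have "frechet_derivative (radial_ext (grad_sphere f)) (at x) b = (\<Sum>c\<in>Basis. dflux f c x b *\<^sub>R c)"
      by (rule frechet_derivative_eqI[OF radial_ext_grad_has_derivative[OF assms]])
    then show ?thesis using that by (simp add: inner_sum_left inner_Basis if_distrib sum.delta cong: if_cong)
  qed
  then show ?thesis
    by (simp add: laplace_beltrami_def div_sphere_def)
qed

lemma sum_Basis_radial:
  assumes "x \<noteq> 0"
  shows "(\<Sum>b\<in>Basis. (x \<bullet> b) * frechet_derivative (radial_ext f) (at x) b) = 0"
proof -
  let ?D = "frechet_derivative (radial_ext f) (at x)"
  have lin: "linear ?D"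
    using radial_ext_has_derivative[OF assms] by (rule has_derivative_linear)
  have "0 = ?D (\<Sum>b\<in>Basis. (x \<bullet> b) *\<^sub>R b)"
    using frechet_derivative_radial_ext_radial[OF smooth_sphere_differentiable[OF assms]]
    by (simp add: euclidean_representation)
  also have "\<dots> = (\<Sum>b\<in>Basis. (x \<bullet> b) * ?D b)"
    by (simp add: linear_sum[OF lin] linear_scale[OF lin])
  finally show ?thesis by simp
qed

text \<open>Off the sphere \<open>laplace_beltrami f\<close> is not constant along rays: being the
  divergence of a field homogeneous of degree 0, it has degree -1. The factor |x| compensates for
  this.\<close>

lemma radial_ext_laplace_beltrami:
  assumes "x \<noteq> 0"
  shows "radial_ext (laplace_beltrami f) x = norm x * laplace_beltrami f x"
proof -
  have "laplace_beltrami f (inverse (norm x) *\<^sub>R x) = norm x * laplace_beltrami f x"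
    unfolding laplace_beltrami_def div_sphere_def sum_distrib_left using assms
    by (intro sum.cong refl)
       (subst frechet_derivative_radial_ext_scale,
        auto simp: differentiable_def intro: radial_ext_grad_has_derivative)
  then show ?thesis by (simp add: radial_ext_def)
qed

text \<open>The ray-constant extension of the Laplacian is |x|^2 times the Euclidean Laplacian of
  the ray-constant extension of f, because the terms in which |x| is differentiated add up to a
  radial derivative, which is zero. As |x|^2 is a polynomial in the coordinates, only sums and
  products of smooth functions remain.\<close>

lemma smooth_sphere_laplace_beltrami: "smooth_sphere (laplace_beltrami f)"
proof -
  let ?U = "UNIV - {0::'a}"
  let ?DD = "\<lambda>b x. frechet_derivative (\<lambda>x. frechet_derivative (radial_ext f) (at x) b) (at x) b"
  have U: "open ?U" by (simp add: open_delete)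
  have "radial_ext (laplace_beltrami f) x = (\<Sum>b\<in>Basis. (x \<bullet> b) * (x \<bullet> b)) * (\<Sum>b\<in>Basis. ?DD b x)"
    if "x \<in> ?U" for x
  proof -
    have x: "x \<noteq> 0" using that by simp
    have "laplace_beltrami f x = (\<Sum>b\<in>Basis. (x \<bullet> b) * frechet_derivative (radial_ext f) (at x) b) / norm x
        + norm x * (\<Sum>b\<in>Basis. ?DD b x)"
      by (simp add: laplace_beltrami_eq_dflux[OF x] dflux_def sum.distrib sum_divide_distrib sum_distrib_left)
    then have "laplace_beltrami f x = norm x * (\<Sum>b\<in>Basis. ?DD b x)"
      using sum_Basis_radial[OF x] by simp
    then have "radial_ext (laplace_beltrami f) x = (x \<bullet> x) * (\<Sum>b\<in>Basis. ?DD b x)"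
      using radial_ext_laplace_beltrami[OF x] by (simp add: dot_square_norm power2_eq_square)
    then show ?thesis
      by (simp add: euclidean_inner[of x x])
  qed
  moreover have "smooth_on (\<lambda>x. (\<Sum>b\<in>Basis. (x \<bullet> b) * (x \<bullet> b)) * (\<Sum>b\<in>Basis. ?DD b x)) ?U"
    by (intro smooth_on_intros smooth_on_sum U smooth_onD(4)[OF partial_smooth] bounded_linear_inner_left) auto
  ultimately show ?thesis
    unfolding smooth_sphere_def by (subst smooth_on_cong[OF U])
qed

end

section \<open>Time-dependent functions on the sphere\<close>

context
  fixes u :: "real \<Rightarrow> 'a::euclidean_space \<Rightarrow> real"
  assumes u: "smooth_time_sphere u"
begin

lemma open_time_sphere: "open ({0<..} \<times> (UNIV - {0}) :: (real \<times> 'a) set)"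
  by (intro open_Times) (auto simp: open_delete)

lemma smooth_time_sphere_slice:
  assumes "t > 0"
  shows "smooth_sphere (u t)"
  unfolding smooth_sphere_def smooth_on_def
proof
  fix k
  have "Ck_on k (\<lambda>(t, x). radial_ext (u t) x) ({0<..} \<times> (UNIV - {0}))"
    using u by (simp add: smooth_time_sphere_def smooth_on_def)
  moreover have "bounded_linear (\<lambda>x::'a. (0::real, x))"
    by (simp add: bounded_linear_Pair bounded_linear_zero bounded_linear_ident)
  ultimately have "Ck_on k (\<lambda>x. case (t, 0) + (0, x) of (t, x) \<Rightarrow> radial_ext (u t) x) (UNIV - {0})"
    using assms by (intro Ck_on_affine) (auto simp: open_delete)
  then show "Ck_on k (radial_ext (u t)) (UNIV - {0})" by simp
qed

lemma radial_ext_time_deriv: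
  assumes "t > 0" "x \<noteq> 0"
  shows "((\<lambda>s. radial_ext (u s) x) has_real_derivative
    frechet_derivative (\<lambda>(t, x). radial_ext (u t) x) (at (t, x)) (1, 0)) (at t)"
proof -
  let ?F = "\<lambda>(t, x). radial_ext (u t) x"
  let ?D = "frechet_derivative ?F (at (t, x))"
  have D: "(?F has_derivative ?D) (at (t, x))"
    using u assms smooth_onD(3) unfolding smooth_time_sphere_def by fastforce
  have "((\<lambda>s. ?F (s, x)) has_derivative (\<lambda>h. ?D (h, 0))) (at t)"
    by (rule has_derivative_compose[where f = "\<lambda>s. (s, x)" and f' = "\<lambda>h. (h, 0)"])
       (use D in \<open>auto intro!: derivative_eq_intros\<close>)
  moreover have "(\<lambda>h. ?D (h, 0)) = (*) (?D (1, 0))"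
  proof
    show "?D (h, 0) = ?D (1, 0) * h" for h
      using linear_scale[OF has_derivative_linear[OF D], of h "(1, 0)"] by simp
  qed
  ultimately show ?thesis
    by (simp add: has_field_derivative_def)
qed

lemma radial_ext_deriv:
  assumes "t > 0" "x \<noteq> 0"
  shows "radial_ext (\<lambda>x. deriv (\<lambda>s. u s x) t) x
    = frechet_derivative (\<lambda>(t, x). radial_ext (u t) x) (at (t, x)) (1, 0)"
  using DERIV_imp_deriv[OF radial_ext_time_deriv[OF assms]] by (simp add: radial_ext_def)

lemma smooth_time_sphere_deriv: "smooth_time_sphere (\<lambda>t x. deriv (\<lambda>s. u s x) t)"
proof -
  have "smooth_on (\<lambda>z. frechet_derivative (\<lambda>(t, x). radial_ext (u t) x) (at z) (1, 0))
      ({0<..} \<times> (UNIV - {0}))"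
    using u by (auto simp: smooth_time_sphere_def intro: smooth_onD(4))
  then show ?thesis
    unfolding smooth_time_sphere_def
  proof (subst smooth_on_cong[OF open_time_sphere])
    fix z :: "real \<times> 'a"
    assume "z \<in> {0<..} \<times> (UNIV - {0})"
    then show "(case z of (t, x) \<Rightarrow> radial_ext (\<lambda>x. deriv (\<lambda>s. u s x) t) x)
        = frechet_derivative (\<lambda>(t, x). radial_ext (u t) x) (at z) (1, 0)"
      using radial_ext_deriv[of "fst z" "snd z"] by (simp add: case_prod_unfold mem_Times_iff)
  qed
qed

lemma smooth_time_sphere_DERIV:
  assumes "t > 0" "x \<in> sphere 0 1"
  shows "((\<lambda>s. u s x) has_real_derivative deriv (\<lambda>s. u s x) t) (at t)"
proof -
  have x: "x \<noteq> 0" "norm x = 1" using assms by auto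
  have "((\<lambda>s. u s x) has_real_derivative frechet_derivative (\<lambda>(t, x). radial_ext (u t) x) (at (t, x)) (1, 0)) (at t)"
    using radial_ext_time_deriv[OF assms(1) x(1)] by (simp add: radial_ext_sphere x)
  then show ?thesis by (metis DERIV_imp_deriv)
qed

lemma smooth_time_sphere_continuous: "continuous_on ({0<..} \<times> sphere 0 1) (\<lambda>(t, x). u t x)"
proof -
  have "continuous_on ({0<..} \<times> sphere 0 1) (\<lambda>(t, x). radial_ext (u t) x)"
    using u unfolding smooth_time_sphere_def
    by (rule continuous_on_subset[OF smooth_onD(1)]) auto
  then show ?thesis
    by (rule continuous_on_eq) (auto simp: radial_ext_sphere)
qed

end

subsection \<open>Integration over the sphere\<close>

lemma normalize_measurable:
  "(\<lambda>x::'a::euclidean_space. x /\<^sub>R norm x)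
    \<in> restrict_space lborel (ball 0 1 - {0}) \<rightarrow>\<^sub>M restrict_space borel (sphere 0 1)"
  by (rule measurable_restrict_space2) (auto simp: space_restrict_space intro!: measurable_restrict_space1)

lemma space_sphere_measure [simp]: "space sphere_measure = (sphere 0 1 :: 'a::euclidean_space set)"
  and sets_sphere_measure [measurable_cong]:
    "sets sphere_measure = sets (restrict_space borel (sphere 0 1 :: 'a set))"
  by (simp_all add: sphere_measure_def space_restrict_space space_scale_measure)

lemma finite_measure_sphere: "finite_measure (sphere_measure :: 'a::euclidean_space measure)"
proof
  let ?M = "distr (restrict_space lborel (ball 0 1 - {0})) (restrict_space borel (sphere 0 1)) (\<lambda>x::'a. x /\<^sub>R norm x)"
  have "emeasure ?M (space ?M) = emeasure lborel (ball (0::'a) 1 - {0})"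
    by (subst emeasure_distr[OF normalize_measurable])
       (auto simp: sets_restrict_space space_restrict_space emeasure_restrict_space
         intro!: arg_cong2[where f = emeasure])
  also have "\<dots> \<le> emeasure lborel (cball (0::'a) 1)"
    by (intro emeasure_mono) auto
  also have "\<dots> < \<infinity>"
    by (rule emeasure_lborel_cball_finite)
  finally have "emeasure ?M (space ?M) < \<infinity>" .
  then show "emeasure (sphere_measure :: 'a measure) (space sphere_measure) \<noteq> \<infinity>"
    by (simp add: sphere_measure_def ennreal_mult_eq_top_iff space_restrict_space space_scale_measure)
qed

lemma continuous_on_sphere_measurable:
  "continuous_on (sphere 0 1) f \<Longrightarrow> (f :: 'a::euclidean_space \<Rightarrow> real) \<in> borel_measurable sphere_measure"
  using borel_measurable_continuous_on_restrict measurable_cong_sets[OF sets_sphere_measure refl] by blast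

lemma continuous_on_sphere_integrable:
  assumes "continuous_on (sphere 0 1) (f :: 'a::euclidean_space \<Rightarrow> real)"
  shows "integrable sphere_measure f"
proof -
  interpret finite_measure "sphere_measure :: 'a measure" by (rule finite_measure_sphere)
  have "bounded (f ` sphere 0 1)"
    by (intro compact_imp_bounded compact_continuous_image assms compact_sphere)
  then obtain b where "\<And>x. x \<in> sphere 0 1 \<Longrightarrow> norm (f x) \<le> b"
    by (force simp: bounded_iff)
  then show ?thesis
    by (intro integrable_const_bound[of _ b] AE_I2) (auto intro: continuous_on_sphere_measurable assms)
qed

lemma integral_scale_measure:
  fixes f :: "'a \<Rightarrow> real"
  assumes "f \<in> borel_measurable M" "c \<ge> 0"
  shows "integral\<^sup>L (scale_measure (ennreal c) M) f = c * integral\<^sup>L M f"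
proof -
  have "scale_measure (ennreal c) M = density M (\<lambda>_. ennreal c)"
    by (rule measure_eqI) (simp_all add: emeasure_density_const)
  then show ?thesis
    using assms by (simp add: integral_density)
qed

lemma integral_sphere_measure:
  fixes f :: "'a::euclidean_space \<Rightarrow> real"
  assumes "f \<in> borel_measurable sphere_measure"
  shows "integral\<^sup>L sphere_measure f = DIM('a) * (\<integral>x. indicator (ball 0 1 - {0}) x * radial_ext f x \<partial>lborel)"
proof -
  have f: "f \<in> borel_measurable (restrict_space borel (sphere 0 1))"
    using assms measurable_cong_sets[OF sets_sphere_measure refl] by blast
  have "integral\<^sup>L sphere_measure f
      = DIM('a) * integral\<^sup>L (distr (restrict_space lborel (ball 0 1 - {0})) (restrict_space borel (sphere 0 1)) (\<lambda>x::'a. x /\<^sub>R norm x)) f"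
    unfolding sphere_measure_def
    by (simp add: integral_scale_measure f ennreal_of_nat_eq_real_of_nat)
  also have "\<dots> = DIM('a) * integral\<^sup>L (restrict_space lborel (ball 0 1 - {0})) (radial_ext f)"
    by (subst integral_distr[OF normalize_measurable f]) (simp add: radial_ext_def[abs_def])
  also have "\<dots> = DIM('a) * (\<integral>x. indicator (ball 0 1 - {0}) x * radial_ext f x \<partial>lborel)"
    by (subst integral_restrict_space) auto
  finally show ?thesis .
qed

text \<open>Differentiation under the integral by dominated convergence along sequences. On a
  compact time interval around t that stays away from 0, the time derivative is bounded uniformly on
  the sphere, and by the mean value inequality the same bound dominates the difference
  quotients.\<close>

lemma inner_sphere_has_derivative:
  fixes u :: "real \<Rightarrow> 'a::euclidean_space \<Rightarrow> real"
  assumes u: "smooth_time_sphere u" and g: "continuous_on (sphere 0 1) g" and t: "t > 0"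
  shows "((\<lambda>s. inner_sphere (u s) g) has_real_derivative inner_sphere (\<lambda>x. deriv (\<lambda>s. u s x) t) g) (at t)"
proof -
  define S where "S = {t/2..2*t}"
  define du where "du = (\<lambda>t x. deriv (\<lambda>s. u s x) t)"
  have Spos: "s > 0" if "s \<in> S" for s using that t by (auto simp: S_def)
  have cu: "continuous_on (sphere 0 1) (u s)" "continuous_on (sphere 0 1) (du s)" if "s > 0" for s
    using smooth_time_sphere_slice[OF u that] smooth_time_sphere_slice[OF smooth_time_sphere_deriv[OF u] that]
    by (auto simp: du_def intro: smooth_sphere_continuous)
  have "continuous_on (S \<times> sphere 0 1) (\<lambda>(t, x). du t x)"
    using Spos
    by (intro continuous_on_subset[OF smooth_time_sphere_continuous[OF smooth_time_sphere_deriv[OF u], folded du_def]]) auto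
  moreover have "compact (S \<times> sphere (0::'a) 1)"
    by (intro compact_Times compact_sphere) (simp add: S_def)
  ultimately have "bounded ((\<lambda>(t, x). du t x) ` (S \<times> sphere 0 1))"
    by (intro compact_imp_bounded compact_continuous_image)
  then obtain M where M: "\<And>s x. s \<in> S \<Longrightarrow> x \<in> sphere 0 1 \<Longrightarrow> \<bar>du s x\<bar> \<le> M"
    by (fastforce simp: bounded_iff)
  have "((\<lambda>s. (inner_sphere (u s) g - inner_sphere (u t) g) / (s - t)) \<longlongrightarrow> inner_sphere (du t) g) (at t within S)"
    unfolding tendsto_at_iff_sequentially
  proof (intro allI impI)
    fix X assume X: "\<forall>i. X i \<in> S - {t}" and lim: "X \<longlonglongrightarrow> t"
    have Xp: "X i > 0" for i using X Spos by auto
    have quot: "(\<integral>x. (u (X i) x - u t x) / (X i - t) * g x \<partial>sphere_measure)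
        = (inner_sphere (u (X i)) g - inner_sphere (u t) g) / (X i - t)" for i
    proof -
      have "(inner_sphere (u (X i)) g - inner_sphere (u t) g) = (\<integral>x. u (X i) x * g x - u t x * g x \<partial>sphere_measure)"
        unfolding inner_sphere_def
        by (intro Bochner_Integration.integral_diff[symmetric] continuous_on_sphere_integrable continuous_intros cu g t Xp)
      then show ?thesis
        by (simp add: algebra_simps diff_divide_distrib flip: integral_divide_zero)
    qed
    have "(\<lambda>i. \<integral>x. (u (X i) x - u t x) / (X i - t) * g x \<partial>sphere_measure) \<longlonglongrightarrow> (\<integral>x. du t x * g x \<partial>sphere_measure)"
    proof (rule integral_dominated_convergence[where w = "\<lambda>x. M * \<bar>g x\<bar>"])
      show "(\<lambda>x. du t x * g x) \<in> borel_measurable sphere_measure"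
        by (intro continuous_on_sphere_measurable continuous_intros cu g t)
      show "(\<lambda>x. (u (X i) x - u t x) / (X i - t) * g x) \<in> borel_measurable sphere_measure" for i
        using X by (intro continuous_on_sphere_measurable continuous_intros cu g t Xp) auto
      show "integrable sphere_measure (\<lambda>x. M * \<bar>g x\<bar>)"
        by (intro continuous_on_sphere_integrable continuous_intros g)
      show "AE x in sphere_measure. (\<lambda>i. (u (X i) x - u t x) / (X i - t) * g x) \<longlonglongrightarrow> du t x * g x"
      proof (rule AE_I2)
        fix x :: 'a assume "x \<in> space sphere_measure"
        then have "((\<lambda>s. u s x) has_real_derivative du t x) (at t)"
          using smooth_time_sphere_DERIV[OF u t] by (simp add: du_def)
        then have "((\<lambda>s. (u s x - u t x) / (s - t)) \<longlongrightarrow> du t x) (at t)"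
          by (simp add: has_field_derivative_iff)
        then have "((\<lambda>s. (u s x - u t x) / (s - t)) \<circ> X) \<longlonglongrightarrow> du t x"
          using X lim unfolding tendsto_at_iff_sequentially by auto
        then show "(\<lambda>i. (u (X i) x - u t x) / (X i - t) * g x) \<longlonglongrightarrow> du t x * g x"
          by (intro tendsto_mult tendsto_const) (simp add: o_def)
      qed
      show "AE x in sphere_measure. norm ((u (X i) x - u t x) / (X i - t) * g x) \<le> M * \<bar>g x\<bar>" for i
      proof (rule AE_I2)
        fix x :: 'a assume "x \<in> space sphere_measure"
        then have x: "x \<in> sphere 0 1" by simp
        have "norm (u (X i) x - u t x) \<le> M * norm (X i - t)"
        proof (rule field_differentiable_bound[where S = S and f' = "\<lambda>s. du s x"])
          show "((\<lambda>s. u s x) has_field_derivative du s x) (at s within S)" if "s \<in> S" for s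
            using smooth_time_sphere_DERIV[OF u Spos[OF that] x] by (auto simp: du_def intro: DERIV_subset)
          show "norm (du s x) \<le> M" if "s \<in> S" for s
            using M[OF that x] by simp
        qed (use X t in \<open>auto simp: S_def\<close>)
        then have "\<bar>(u (X i) x - u t x) / (X i - t)\<bar> \<le> M"
          using X by (auto simp: abs_divide field_simps)
        then show "norm ((u (X i) x - u t x) / (X i - t) * g x) \<le> M * \<bar>g x\<bar>"
          by (simp only: real_norm_def abs_mult) (rule mult_right_mono, auto)
      qed
    qed
    then show "((\<lambda>s. (inner_sphere (u s) g - inner_sphere (u t) g) / (s - t)) \<circ> X) \<longlonglongrightarrow> inner_sphere (du t) g"
      by (simp only: quot) (simp add: o_def inner_sphere_def)
  qed
  moreover have "at t within S = at t"
    unfolding S_def using t by (intro at_within_Icc_at) auto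
  ultimately show ?thesis
    by (simp add: has_field_derivative_iff du_def)
qed

section \<open>Green's identity on the sphere\<close>

lemma integral_partial_derivative_eq_0:
  fixes V :: "'a::euclidean_space \<Rightarrow> real"
  assumes D: "\<And>x. (V has_derivative DV x) (at x)"
    and supp: "\<And>x. norm x \<ge> 1 \<Longrightarrow> V x = 0"
    and b: "b \<in> Basis" and M: "\<And>x. \<bar>DV x b\<bar> \<le> M"
  shows "integrable lborel (\<lambda>x. DV x b)" "(\<integral>x. DV x b \<partial>lborel) = 0"
proof -
  define r :: "nat \<Rightarrow> real" where "r k = 1 / (Suc k)" for k
  have r: "r k > 0" "r k \<le> 1" for k by (auto simp: r_def)
  \<comment> \<open>Difference quotients in direction b: their integrals vanish by translation
    invariance of Lebesgue measure, and dominated convergence carries this over to the derivative.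
    Since \<open>r k \<le> 1\<close>, all of them are supported in the ball of radius 2, which
    provides the dominating function.\<close>
  define g where "g k x = (V (x + r k *\<^sub>R b) - V x) / r k" for k x
  have cV: "continuous_on UNIV V"
    using D by (intro continuous_at_imp_continuous_on) (auto intro: has_derivative_continuous)
  then have [measurable]: "V \<in> borel_measurable borel"
    by (rule borel_measurable_continuous_onI)
  have line: "((\<lambda>s. V (x + s *\<^sub>R b)) has_real_derivative DV (x + s *\<^sub>R b) b) (at s)" for x s
  proof -
    have "((\<lambda>s. V (x + s *\<^sub>R b)) has_derivative (\<lambda>h. DV (x + s *\<^sub>R b) (h *\<^sub>R b))) (at s)"
      by (rule has_derivative_compose[where f = "\<lambda>s. x + s *\<^sub>R b" and f' = "\<lambda>h. h *\<^sub>R b"])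
         (use D in \<open>auto intro!: derivative_eq_intros\<close>)
    moreover have "(\<lambda>h. DV (x + s *\<^sub>R b) (h *\<^sub>R b)) = (*) (DV (x + s *\<^sub>R b) b)"
      using linear_scale[OF has_derivative_linear[OF D]] by (auto simp: mult.commute)
    ultimately show ?thesis by (simp add: has_field_derivative_def)
  qed
  have lim: "(\<lambda>k. g k x) \<longlonglongrightarrow> DV x b" for x
  proof -
    have "((\<lambda>h. (V (x + h *\<^sub>R b) - V x) / h) \<longlongrightarrow> DV x b) (at 0)"
      using line[of x 0] by (simp add: DERIV_def)
    moreover have "filterlim r (at 0) sequentially"
    proof (rule filterlim_atI)
      show "r \<longlonglongrightarrow> 0" unfolding r_def by (rule LIMSEQ_Suc[OF lim_1_over_n])
    qed (use r in \<open>auto simp: less_imp_neq[symmetric]\<close>)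
    ultimately show ?thesis
      unfolding g_def by (rule filterlim_compose)
  qed
  have [measurable]: "g k \<in> borel_measurable lborel" for k
    unfolding g_def by measurable
  have bound: "norm (g k x) \<le> M * indicator (cball 0 2) x" for k x
  proof (cases "norm x \<le> 2")
    case True
    have "norm (V (x + r k *\<^sub>R b) - V (x + 0 *\<^sub>R b)) \<le> M * norm (r k - 0)"
      by (rule field_differentiable_bound[where S = UNIV and f' = "\<lambda>s. DV (x + s *\<^sub>R b) b"])
         (use line M in auto)
    then show ?thesis
      using True r[of k] by (simp add: g_def field_simps)
  next
    case False
    have "norm (x + r k *\<^sub>R b) \<ge> norm x - norm (r k *\<^sub>R b)"
      by (metis norm_diff_ineq)
    then have "norm (x + r k *\<^sub>R b) \<ge> 1"
      using False r[of k] b by simp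
    then show ?thesis using False supp by (simp add: g_def)
  qed
  have w: "integrable lborel (\<lambda>x::'a. M * indicator (cball 0 2) x)"
    by (intro integrable_mult_right integrable_real_indicator emeasure_lborel_cball_finite) auto
  have [measurable]: "(\<lambda>x. DV x b) \<in> borel_measurable lborel"
    by (rule borel_measurable_LIMSEQ_real[of _ g]) (use lim in auto)
  show "integrable lborel (\<lambda>x. DV x b)"
    by (rule integrable_dominated_convergence[OF _ _ w, of _ g]) (use lim bound in auto)
  have "(\<lambda>k. integral\<^sup>L lborel (g k)) \<longlonglongrightarrow> (\<integral>x. DV x b \<partial>lborel)"
    by (rule integral_dominated_convergence[OF _ _ w]) (use lim bound in auto)
  moreover have "integral\<^sup>L lborel (g k) = 0" for k
  proof -
    have "compact (V ` cball 0 1)"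
      using cV by (intro compact_continuous_image) (auto intro: continuous_on_subset)
    then obtain m where m: "\<And>x. norm x \<le> 1 \<Longrightarrow> \<bar>V x\<bar> \<le> m"
      by (fastforce dest: compact_imp_bounded simp: bounded_iff)
    have iV: "integrable lborel V"
    proof (rule Bochner_Integration.integrable_bound)
      show "integrable lborel (\<lambda>x::'a. m * indicator (cball 0 1) x)"
        by (intro integrable_mult_right integrable_real_indicator emeasure_lborel_cball_finite) auto
      show "AE x in lborel. norm (V x) \<le> norm (m * indicator (cball 0 1) x :: real)"
        using m supp by (intro AE_I2) (force simp: indicator_def)
    qed auto
    have eq: "lborel = distr lborel borel (\<lambda>x. x + r k *\<^sub>R b)"
      using lborel_distr_plus[of "r k *\<^sub>R b"] by (simp add: add.commute[of _ "r k *\<^sub>R b"])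
    have "integral\<^sup>L lborel V = (\<integral>x. V (x + r k *\<^sub>R b) \<partial>lborel)"
      by (subst eq) (rule integral_distr, auto)
    moreover have "integrable lborel (\<lambda>x. V (x + r k *\<^sub>R b))"
    proof -
      have "integrable (distr lborel borel (\<lambda>x. x + r k *\<^sub>R b)) V"
        using iV eq by simp
      then show ?thesis by (subst (asm) integrable_distr_eq) auto
    qed
    ultimately show ?thesis
      using iV unfolding g_def by simp
  qed
  ultimately show "(\<integral>x. DV x b \<partial>lborel) = 0"
    by (simp add: LIMSEQ_const_iff)
qed

lemma smooth_sphere_dflux_continuous:
  assumes f: "smooth_sphere f"
  shows "continuous_on (UNIV - {0}) (radial_ext f)" "continuous_on (UNIV - {0}) (flux f b)"
    "continuous_on (UNIV - {0}) (\<lambda>x. dflux f b x v)"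
proof -
  have p: "continuous_on (UNIV - {0}) (\<lambda>x. frechet_derivative (radial_ext f) (at x) b)"
    "continuous_on (UNIV - {0}) (\<lambda>x. frechet_derivative (\<lambda>x. frechet_derivative (radial_ext f) (at x) b) (at x) v)"
    using partial_smooth[OF f] by (auto intro: smooth_onD)
  show "continuous_on (UNIV - {0}) (radial_ext f)"
    using f by (auto simp: smooth_sphere_def intro: smooth_onD)
  show "continuous_on (UNIV - {0}) (flux f b)"
    unfolding flux_def[abs_def] by (intro continuous_intros p)
  show "continuous_on (UNIV - {0}) (\<lambda>x. dflux f b x v)"
    unfolding dflux_def[abs_def] by (intro continuous_intros p) auto
qed

text \<open>
  The field with components \<open>V b\<close> is \<open>e(|x|\<^sup>2) |x|\<^sup>2 (G \<nabla>F - F \<nabla>G)\<close> for the ray-constant extensions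
  \<open>F\<close>, \<open>G\<close>.  It is tangent to the spheres around the origin, so the derivative of the radial
  factor does not contribute to its divergence.
\<close>

lemma green_cutoff:
  fixes f g :: "'a::euclidean_space \<Rightarrow> real"
  assumes f: "smooth_sphere f" and g: "smooth_sphere g"
    and e: "\<And>u. (e has_real_derivative e' u) (at u)" and ce: "continuous_on UNIV e'"
    and d: "d > 0" and e0: "\<And>u. u \<le> d \<or> u \<ge> 1 \<Longrightarrow> e u = 0"
  shows "(\<integral>x. e (x \<bullet> x) * radial_ext (\<lambda>y. g y * laplace_beltrami f y - f y * laplace_beltrami g y) x \<partial>lborel) = 0"
proof -
  let ?F = "radial_ext f" and ?G = "radial_ext g"
  let ?DF = "\<lambda>x. frechet_derivative ?F (at x)" and ?DG = "\<lambda>x. frechet_derivative ?G (at x)"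
  define X where "X b x = ?G x * flux f b x - ?F x * flux g b x" for b x
  define DX where "DX b x v = ?G x * dflux f b x v + ?DG x v * flux f b x - (?F x * dflux g b x v + ?DF x v * flux g b x)" for b x v
  define c where "c x = 2 * e' (x \<bullet> x) * norm x + e (x \<bullet> x) / norm x" for x :: 'a
  define V where "V b x = e (x \<bullet> x) * norm x * X b x" for b x
  \<comment> \<open>The second formula makes no sense at the origin, where |x| is a denominator and
    the extensions are singular. On the ball where \<open>e\<close> vanishes the derivative is
    therefore set to 0 directly.\<close>
  define DV where "DV b x v = (if x \<bullet> x < d then 0
      else c x * (x \<bullet> v) * X b x + e (x \<bullet> x) * norm x * DX b x v)" for b x v
  have Xd: "(X b has_derivative DX b x) (at x)" if "x \<noteq> 0" for b x
    unfolding X_def[abs_def] DX_def[abs_def]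
    by (intro has_derivative_diff has_derivative_mult radial_ext_has_derivative flux_has_derivative f g that)
  have Vd: "(V b has_derivative DV b x) (at x)" for b x
  proof (cases "x \<bullet> x < d")
    case True
    have "open {x::'a. x \<bullet> x < d}"
      by (intro open_Collect_less continuous_intros)
    then have "(V b has_derivative (\<lambda>v. 0)) (at x)"
      by (rule has_derivative_transform_within_open[OF has_derivative_const[of 0]])
         (use True in \<open>auto simp: V_def e0\<close>)
    then show ?thesis using True by (simp add: DV_def[abs_def])
  next
    case False
    then have x: "x \<noteq> 0" using d by auto
    have "((\<lambda>x. e (x \<bullet> x)) has_derivative (\<lambda>v. e' (x \<bullet> x) * (2 * (x \<bullet> v)))) (at x)"
      by (rule has_derivative_compose[of "\<lambda>x. x \<bullet> x" "\<lambda>v. 2 * (x \<bullet> v)"])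
         (use e in \<open>auto intro!: derivative_eq_intros simp: has_field_derivative_def inner_commute\<close>)
    moreover have "(norm has_derivative (\<lambda>h. x \<bullet> h / norm x)) (at x)"
      using has_derivative_norm[OF x] by (simp add: sgn_div_norm inner_commute divide_inverse mult.commute)
    ultimately have "((\<lambda>x. e (x \<bullet> x) * norm x * X b x) has_derivative
        (\<lambda>v. e (x \<bullet> x) * norm x * DX b x v + (e (x \<bullet> x) * (x \<bullet> v / norm x) + e' (x \<bullet> x) * (2 * (x \<bullet> v)) * norm x) * X b x)) (at x)"
      by (intro has_derivative_mult Xd x)
    then show ?thesis
      unfolding V_def[abs_def] DV_def[abs_def] using False
      by (simp add: c_def algebra_simps)
  qed
  \<comment> \<open>\<open>e\<close> is zero on the half-line to the right of u, so the one-sided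
    derivative determines e' there, including at u = 1. Thus \<open>DV b x b\<close> vanishes
    outside the annulus, and compactness of the annulus bounds it.\<close>
  have e'1: "e' u = 0" if "u \<ge> 1" for u
  proof -
    have "(e has_real_derivative e' u) (at u within {u..})" using e by (rule DERIV_subset) simp
    moreover have "(e has_real_derivative 0) (at u within {u..})"
      by (rule has_field_derivative_transform_within[OF DERIV_const[of 0], of 1]) (use that e0 in auto)
    ultimately show ?thesis
      unfolding has_real_derivative_iff_has_vector_derivative
      by (intro vector_derivative_unique_within[of u "{u..}" e]) (auto simp: at_within_Ici_at_right)
  qed
  have bound: "\<exists>M. \<forall>x. \<bar>DV b x b\<bar> \<le> M" for b
  proof -
    define A where "A = {x::'a. d \<le> x \<bullet> x \<and> x \<bullet> x \<le> 1}"
    have A0: "A \<subseteq> UNIV - {0}" using d by (auto simp: A_def)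
    have "closed A"
      unfolding A_def by (intro closed_Collect_conj closed_Collect_le continuous_intros)
    moreover have "A \<subseteq> cball 0 1"
      by (auto simp: A_def dot_square_norm abs_square_le_1)
    ultimately have "compact A"
      using compact_Int_closed[OF compact_cball, of A 0 1] by (simp add: Int_absorb1)
    have ceA: "continuous_on A (\<lambda>x. e (x \<bullet> x))" "continuous_on A (\<lambda>x. e' (x \<bullet> x))"
      using ce DERIV_continuous_on[of UNIV e e'] e
      by (auto intro!: continuous_on_compose2[of UNIV e] continuous_on_compose2[of UNIV e'] continuous_intros)
    note cs = smooth_sphere_dflux_continuous[OF f, THEN continuous_on_subset, OF A0]
      smooth_sphere_dflux_continuous[OF g, THEN continuous_on_subset, OF A0]
    have cp: "continuous_on A (\<lambda>x. ?DF x b)" "continuous_on A (\<lambda>x. ?DG x b)"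
      using partial_smooth f g by (auto intro: continuous_on_subset[OF smooth_onD(1) A0])
    have "continuous_on A (\<lambda>x. c x * (x \<bullet> b) * X b x + e (x \<bullet> x) * norm x * DX b x b)"
      unfolding c_def X_def DX_def using A0 by (intro continuous_intros ceA cs cp) auto
    then have "bounded ((\<lambda>x. c x * (x \<bullet> b) * X b x + e (x \<bullet> x) * norm x * DX b x b) ` A)"
      using \<open>compact A\<close> by (intro compact_imp_bounded compact_continuous_image)
    then obtain M where M: "M > 0" "\<And>x. x \<in> A \<Longrightarrow> \<bar>c x * (x \<bullet> b) * X b x + e (x \<bullet> x) * norm x * DX b x b\<bar> \<le> M"
      by (force simp: bounded_pos)
    have "\<bar>DV b x b\<bar> \<le> M" for x
    proof (cases "x \<in> A")
      case True then show ?thesis using M by (auto simp: DV_def)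
    next
      case False
      then have "DV b x b = 0"
        using e0 e'1 by (auto simp: A_def DV_def c_def)
      then show ?thesis using M by simp
    qed
    then show ?thesis by blast
  qed
  have supp: "V b x = 0" if "norm x \<ge> 1" for b x
    using that e0 by (auto simp: V_def dot_square_norm one_le_power)
  have int: "integrable lborel (\<lambda>x. DV b x b)" "(\<integral>x. DV b x b \<partial>lborel) = 0" if "b \<in> Basis" for b
    using bound integral_partial_derivative_eq_0[OF Vd supp that] by metis+
  have "(\<integral>x. (\<Sum>b\<in>Basis. DV b x b) \<partial>lborel) = 0"
    using int by (subst Bochner_Integration.integral_sum) auto
  moreover have "(\<Sum>b\<in>Basis. DV b x b)
      = e (x \<bullet> x) * radial_ext (\<lambda>y. g y * laplace_beltrami f y - f y * laplace_beltrami g y) x" for x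
  proof (cases "x \<bullet> x < d")
    case True
    then show ?thesis by (simp add: DV_def e0)
  next
    case False
    then have x: "x \<noteq> 0" using d by auto
    have "(\<Sum>b\<in>Basis. (x \<bullet> b) * X b x) = norm x * (?G x * (\<Sum>b\<in>Basis. (x \<bullet> b) * ?DF x b) - ?F x * (\<Sum>b\<in>Basis. (x \<bullet> b) * ?DG x b))"
      by (simp add: X_def flux_def sum_distrib_left right_diff_distrib sum_subtractf mult_ac)
    then have 1: "(\<Sum>b\<in>Basis. (x \<bullet> b) * X b x) = 0"
      using sum_Basis_radial[OF f x] sum_Basis_radial[OF g x] by simp
    have 2: "(\<Sum>b\<in>Basis. DX b x b) = ?G x * laplace_beltrami f x - ?F x * laplace_beltrami g x"
      by (simp add: DX_def flux_def laplace_beltrami_eq_dflux[OF f x] laplace_beltrami_eq_dflux[OF g x]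
        sum_distrib_left sum.distrib sum_subtractf algebra_simps)
    have "(\<Sum>b\<in>Basis. DV b x b) = c x * (\<Sum>b\<in>Basis. (x \<bullet> b) * X b x) + e (x \<bullet> x) * norm x * (\<Sum>b\<in>Basis. DX b x b)"
      using False by (simp add: DV_def sum.distrib sum_distrib_left mult_ac)
    also have "\<dots> = e (x \<bullet> x) * (?G x * (norm x * laplace_beltrami f x) - ?F x * (norm x * laplace_beltrami g x))"
      by (simp add: 1 2 algebra_simps)
    also have "\<dots> = e (x \<bullet> x) * (?G x * radial_ext (laplace_beltrami f) x - ?F x * radial_ext (laplace_beltrami g) x)"
      by (simp add: radial_ext_laplace_beltrami[OF f x] radial_ext_laplace_beltrami[OF g x])
    finally show ?thesis by (simp add: radial_ext_def)
  qed
  ultimately show ?thesis by simp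
qed

text \<open>A \<open>C\<^sup>1\<close> sequence converging boundedly to the indicator function of the positive half-line.\<close>

definition cut :: "nat \<Rightarrow> real \<Rightarrow> real" where
  "cut k t = real k * (max 0 t)\<^sup>2 / (1 + real k * (max 0 t)\<^sup>2)"

lemma max_sq_deriv: "((\<lambda>t::real. (max 0 t)\<^sup>2) has_real_derivative 2 * max 0 t) (at t)"
proof -
  consider "t > 0" | "t < 0" | "t = 0" by linarith
  then show ?thesis
  proof cases
    case 1
    have "((\<lambda>t::real. t\<^sup>2) has_real_derivative 2 * max 0 t) (at t)"
      using 1 by (auto intro!: derivative_eq_intros)
    then show ?thesis
      by (rule has_field_derivative_transform_within_open[of _ _ _ "{0<..}"]) (use 1 in auto)
  next
    case 2
    have "((\<lambda>t::real. 0) has_real_derivative 2 * max 0 t) (at t)"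
      using 2 by (auto intro!: derivative_eq_intros)
    then show ?thesis
      by (rule has_field_derivative_transform_within_open[of _ _ _ "{..<0}"]) (use 2 in auto)
  next
    case 3
    have "((\<lambda>h::real. (max 0 h)\<^sup>2 / h) \<longlongrightarrow> 0) (at 0)"
    proof (rule tendsto_0_le[where K = 1])
      show "((\<lambda>h::real. h) \<longlongrightarrow> 0) (at 0)" by (rule tendsto_ident_at)
      show "\<forall>\<^sub>F h in at (0::real). norm ((max 0 h)\<^sup>2 / h) \<le> norm h * 1"
        by (intro always_eventually allI) (simp add: max_def power2_eq_square)
    qed
    then show ?thesis using 3 by (simp add: DERIV_def)
  qed
qed

lemma cut_deriv: "(cut k has_real_derivative real k * (2 * max 0 t) / (1 + real k * (max 0 t)\<^sup>2)\<^sup>2) (at t)"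
proof -
  have nz: "1 + real k * (max 0 t)\<^sup>2 \<noteq> 0"
    by (smt (verit) mult_nonneg_nonneg of_nat_0_le_iff zero_le_power2)
  have D: "((\<lambda>t. 1 + real k * (max 0 t)\<^sup>2) has_real_derivative real k * (2 * max 0 t)) (at t)"
    by (rule DERIV_cong[OF DERIV_add[OF DERIV_const DERIV_cmult[OF max_sq_deriv]]]) simp
  have "(cut k has_real_derivative (real k * (2 * max 0 t) * (1 + real k * (max 0 t)\<^sup>2)
      - real k * (max 0 t)\<^sup>2 * (real k * (2 * max 0 t))) / ((1 + real k * (max 0 t)\<^sup>2) * (1 + real k * (max 0 t)\<^sup>2))) (at t)"
    unfolding cut_def[abs_def] using nz
    by (intro DERIV_divide DERIV_cmult max_sq_deriv D)
  then show ?thesis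
    by (simp add: algebra_simps power2_eq_square)
qed

lemma cut_eq_0: "t \<le> 0 \<Longrightarrow> cut k t = 0"
  by (simp add: cut_def)

lemma cut_bounds: "0 \<le> cut k t" "cut k t \<le> 1"
proof -
  have "0 \<le> real k * (max 0 t)\<^sup>2" by simp
  moreover from this have "0 < 1 + real k * (max 0 t)\<^sup>2" by linarith
  ultimately show "0 \<le> cut k t" "cut k t \<le> 1" unfolding cut_def by (simp_all add: divide_le_eq)
qed

lemma cut_ge:
  assumes "0 < s" "s \<le> t" "k > 0"
  shows "\<bar>1 - cut k t\<bar> \<le> (1 / s\<^sup>2) * (1 / real k)"
proof -
  have pos: "0 < 1 + real k * t\<^sup>2" "0 < real k * s\<^sup>2" using assms by (auto intro: add_pos_nonneg)
  have "1 - cut k t = 1 / (1 + real k * t\<^sup>2)"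
    using assms pos by (simp add: cut_def max_def field_simps)
  also have "\<dots> \<le> 1 / (real k * s\<^sup>2)"
  proof (rule divide_left_mono)
    have "real k * s\<^sup>2 \<le> real k * t\<^sup>2" using assms by (intro mult_left_mono power_mono) auto
    then show "real k * s\<^sup>2 \<le> 1 + real k * t\<^sup>2" by linarith
  qed (use pos in auto)
  finally show ?thesis using cut_bounds[of k t] by (simp add: mult_ac)
qed

text \<open>The argument moves with k because the inner radius of the cutoff below shrinks to 0
  while the cutoff sharpens.\<close>

lemma cut_tendsto:
  assumes t: "(\<lambda>k. t k) \<longlonglongrightarrow> a" and a: "a > 0"
  shows "(\<lambda>k. cut k (t k)) \<longlonglongrightarrow> 1"
proof -
  have "(\<lambda>k. 1 - cut k (t k)) \<longlonglongrightarrow> 0"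
  proof (rule tendsto_0_le[where K = "1 / (a/2)\<^sup>2"])
    show "(\<lambda>k. 1 / real k) \<longlonglongrightarrow> 0" by (rule lim_1_over_n)
    have "\<forall>\<^sub>F k in sequentially. t k > a / 2"
      using t a by (intro order_tendstoD) auto
    then show "\<forall>\<^sub>F k in sequentially. norm (1 - cut k (t k)) \<le> norm (1 / real k) * (1 / (a/2)\<^sup>2)"
      using eventually_gt_at_top[of 0]
      by eventually_elim (use cut_ge[of "a/2"] a in \<open>simp add: mult.commute\<close>)
  qed
  from tendsto_diff[OF tendsto_const[of 1] this] show ?thesis by simp
qed

text \<open>As the surface measure is defined through cones, the claim is that the ray-constant
  extension of g \<Delta>f - f \<Delta>g has integral 0 over the punctured unit ball.
  \<open>green_cutoff\<close> gives this with a radial C^1 weight, and the weights converge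
  boundedly to the indicator function.\<close>

lemma green_identity:
  fixes f g :: "'a::euclidean_space \<Rightarrow> real"
  assumes f: "smooth_sphere f" and g: "smooth_sphere g"
  shows "inner_sphere (laplace_beltrami f) g = inner_sphere f (laplace_beltrami g)"
proof -
  let ?P = "\<lambda>y. g y * laplace_beltrami f y - f y * laplace_beltrami g y"
  \<comment> \<open>With u = |x|^2, the first factor cuts off at the unit sphere and the second near
    the singular origin; \<open>green_cutoff\<close> then applies with d = 1/(k+1).\<close>
  define e where "e k u = cut k (1 - u) * cut k (u - 1 / real (Suc k))" for k u
  note sm = f g smooth_sphere_laplace_beltrami[OF f] smooth_sphere_laplace_beltrami[OF g]
  note cs = sm[THEN smooth_sphere_continuous]
  have P: "continuous_on (sphere 0 1) ?P" by (intro continuous_intros cs)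
  have rP: "continuous_on (UNIV - {0}) (radial_ext ?P)"
    using sm[THEN smooth_sphere_dflux_continuous(1)]
    by (simp add: radial_ext_def[abs_def]) (intro continuous_intros, auto)
  have "bounded (?P ` sphere 0 1)"
    by (intro compact_imp_bounded compact_continuous_image P compact_sphere)
  then obtain M where M: "\<And>x. x \<in> sphere 0 1 \<Longrightarrow> \<bar>?P x\<bar> \<le> M"
    by (force simp: bounded_iff)
  have Mr: "\<bar>radial_ext ?P x\<bar> \<le> M" if "x \<noteq> 0" for x
    using M[of "x /\<^sub>R norm x"] that by (simp add: radial_ext_def)
  have rPm: "(\<lambda>x. indicator (ball 0 1 - {0}) x * radial_ext ?P x) \<in> borel_measurable borel"
  proof -
    have "(\<lambda>x. indicator (UNIV - {0}) x *\<^sub>R radial_ext ?P x) \<in> borel_measurable borel"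
      by (intro borel_measurable_continuous_on_indicator rP) auto
    then have "(\<lambda>x. indicator (ball 0 1) x * (indicator (UNIV - {0}) x *\<^sub>R radial_ext ?P x)) \<in> borel_measurable borel"
      by (intro borel_measurable_times borel_measurable_indicator) auto
    moreover have "indicator (ball 0 1) x * (indicator (UNIV - {0}) x *\<^sub>R radial_ext ?P x)
        = indicator (ball 0 1 - {0}) x * radial_ext ?P x" for x
      by (simp add: indicator_def)
    ultimately show ?thesis by (simp only:)
  qed
  have zero: "(\<integral>x. e k (x \<bullet> x) * radial_ext ?P x \<partial>lborel) = 0" for k
  proof (rule green_cutoff[OF f g])
    let ?c = "\<lambda>t. real k * (2 * max 0 t) / (1 + real k * (max 0 t)\<^sup>2)\<^sup>2"
    show "(e k has_real_derivative
        (- ?c (1 - u) * cut k (u - 1 / real (Suc k)) + ?c (u - 1 / real (Suc k)) * cut k (1 - u))) (at u)" for u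
    proof -
      have 1: "((\<lambda>u. cut k (1 - u)) has_real_derivative ?c (1 - u) * (0 - 1)) (at u)"
        by (rule DERIV_chain2[OF cut_deriv]) (intro derivative_intros)
      have 2: "((\<lambda>u. cut k (u - 1 / real (Suc k))) has_real_derivative ?c (u - 1 / real (Suc k)) * (1 - 0)) (at u)"
        by (rule DERIV_chain2[OF cut_deriv]) (intro derivative_intros)
      show ?thesis
        unfolding e_def[abs_def] using DERIV_mult[OF 1 2] by simp
    qed
    have cc: "continuous_on UNIV (cut k)"
      using DERIV_continuous_on[OF cut_deriv] by simp
    have nz: "1 + real k * (max 0 t)\<^sup>2 \<noteq> 0" for t
      by (smt (verit) mult_nonneg_nonneg of_nat_0_le_iff zero_le_power2)
    show "continuous_on UNIV (\<lambda>u. - ?c (1 - u) * cut k (u - 1 / real (Suc k)) + ?c (u - 1 / real (Suc k)) * cut k (1 - u))"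
      using nz by (intro continuous_intros continuous_on_compose2[OF cc]) auto
    show "e k u = 0" if "u \<le> 1 / real (Suc k) \<or> 1 \<le> u" for u
      using that cut_eq_0[of "1 - u" k] cut_eq_0[of "u - 1 / real (Suc k)" k] by (auto simp: e_def)
  qed simp
  have lim: "(\<lambda>k. e k (x \<bullet> x)) \<longlonglongrightarrow> indicator (ball 0 1 - {0}) x" for x :: 'a
  proof (cases "x \<in> ball 0 1 - {0}")
    case True
    then have x: "0 < x \<bullet> x" "x \<bullet> x < 1"
      by (auto simp: dot_square_norm abs_square_less_1)
    have "(\<lambda>k. 1 / real (Suc k)) \<longlonglongrightarrow> 0" by (rule LIMSEQ_Suc[OF lim_1_over_n])
    then have "(\<lambda>k. x \<bullet> x - 1 / real (Suc k)) \<longlonglongrightarrow> x \<bullet> x - 0"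
      by (intro tendsto_intros)
    then have "(\<lambda>k. e k (x \<bullet> x)) \<longlonglongrightarrow> 1 * 1"
      unfolding e_def using x by (intro tendsto_mult cut_tendsto) auto
    then show ?thesis using True by simp
  next
    case False
    then consider "x = 0" | "norm x \<ge> 1" by force
    then have "e k (x \<bullet> x) = 0" for k
    proof cases
      case 1 then show ?thesis by (simp add: e_def cut_eq_0)
    next
      case 2
      then have "x \<bullet> x \<ge> 1" by (simp add: dot_square_norm one_le_power)
      then show ?thesis by (simp add: e_def cut_eq_0)
    qed
    then show ?thesis using False by simp
  qed
  have eb: "norm (e k (x \<bullet> x) * radial_ext ?P x) \<le> M * indicator (cball 0 1) x" for k and x :: 'a
  proof (cases "x \<in> ball 0 1 - {0}")
    case True
    have "\<bar>e k (x \<bullet> x)\<bar> \<le> 1"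
      unfolding e_def abs_mult using cut_bounds by (intro mult_le_one) auto
    then have "\<bar>e k (x \<bullet> x)\<bar> * \<bar>radial_ext ?P x\<bar> \<le> 1 * M"
      using Mr[of x] True by (intro mult_mono) auto
    then show ?thesis using True by (simp add: abs_mult)
  next
    case False
    then consider "x = 0" | "norm x \<ge> 1" by force
    then have "e k (x \<bullet> x) = 0"
    proof cases
      case 1 then show ?thesis by (simp add: e_def cut_eq_0)
    next
      case 2
      then have "x \<bullet> x \<ge> 1" by (simp add: dot_square_norm one_le_power)
      then show ?thesis by (simp add: e_def cut_eq_0)
    qed
    moreover have "M \<ge> 0"
    proof -
      obtain b :: 'a where "b \<in> Basis" using nonempty_Basis by blast
      then have "b \<in> sphere 0 1" by simp
      from M[OF this] show ?thesis by linarith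
    qed
    ultimately show ?thesis by simp
  qed
  have cute: "(\<lambda>x::'a. e k (x \<bullet> x)) \<in> borel_measurable borel" for k
  proof -
    have "continuous_on UNIV (cut k)"
      using DERIV_continuous_on[OF cut_deriv] by simp
    then show ?thesis
      unfolding e_def
      by (intro borel_measurable_continuous_onI continuous_on_mult)
         (auto intro!: continuous_on_compose2[of UNIV "cut k"] continuous_intros)
  qed
  have "(\<lambda>k. \<integral>x. e k (x \<bullet> x) * radial_ext ?P x \<partial>lborel) \<longlonglongrightarrow> (\<integral>x. indicator (ball 0 1 - {0}) x * radial_ext ?P x \<partial>lborel)"
  proof (rule integral_dominated_convergence[where w = "\<lambda>x. M * indicator (cball 0 1) x"])
    show "integrable lborel (\<lambda>x::'a. M * indicator (cball 0 1) x)"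
      by (intro integrable_mult_right integrable_real_indicator emeasure_lborel_cball_finite) auto
    show "AE x in lborel. (\<lambda>k. e k (x \<bullet> x) * radial_ext ?P x) \<longlonglongrightarrow> indicator (ball 0 1 - {0}) x * radial_ext ?P x"
      by (intro AE_I2 tendsto_mult lim tendsto_const)
    show "AE x in lborel. norm (e k (x \<bullet> x) * radial_ext ?P x) \<le> M * indicator (cball 0 1) x" for k
      by (intro AE_I2 eb)
    show "(\<lambda>x. indicator (ball 0 1 - {0}) x * radial_ext ?P x) \<in> borel_measurable lborel"
      using rPm by simp
    show "(\<lambda>x. e k (x \<bullet> x) * radial_ext ?P x) \<in> borel_measurable lborel" for k
    proof -
      have eq: "e k (x \<bullet> x) * radial_ext ?P x = e k (x \<bullet> x) * (indicator (ball 0 1 - {0}) x * radial_ext ?P x)" for x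
      proof (cases "x \<in> ball 0 1 - {0}")
        case False
        then have "norm (e k (x \<bullet> x)) = 0"
        proof -
          consider "x = 0" | "norm x \<ge> 1" using False by force
          then show ?thesis
            by cases (auto simp: e_def cut_eq_0 dot_square_norm one_le_power)
        qed
        then show ?thesis by simp
      qed simp
      show ?thesis
        unfolding eq measurable_lborel2 by (rule borel_measurable_times[OF cute rPm])
    qed
  qed
  then have "(\<integral>x. indicator (ball 0 1 - {0}) x * radial_ext ?P x \<partial>lborel) = 0"
    by (simp add: zero LIMSEQ_const_iff)
  then have "integral\<^sup>L sphere_measure ?P = 0"
    using integral_sphere_measure[OF continuous_on_sphere_measurable[OF P]] by simp
  moreover have "integral\<^sup>L sphere_measure ?P = inner_sphere (laplace_beltrami f) g - inner_sphere f (laplace_beltrami g)"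
    unfolding inner_sphere_def
    by (subst Bochner_Integration.integral_diff)
       (auto intro!: continuous_on_sphere_integrable continuous_intros cs simp: mult.commute)
  ultimately show ?thesis by simp
qed

subsection \<open>Fourier coefficients\<close>

lemma inner_sphere_commute: "inner_sphere f g = inner_sphere g f"
  by (simp add: inner_sphere_def mult.commute)

lemma inner_sphere_cong:
  "(\<And>x. x \<in> sphere 0 1 \<Longrightarrow> f x = f' x) \<Longrightarrow> inner_sphere f g = inner_sphere f' g"
  unfolding inner_sphere_def by (intro Bochner_Integration.integral_cong) auto

lemma inner_sphere_diff:
  assumes "continuous_on (sphere 0 1) f" "continuous_on (sphere 0 1) g" "continuous_on (sphere 0 1) h"
  shows "inner_sphere (\<lambda>x. f x - g x) h = inner_sphere f h - inner_sphere g h"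
  unfolding inner_sphere_def left_diff_distrib
  by (intro Bochner_Integration.integral_diff continuous_on_sphere_integrable continuous_intros assms)

lemma inner_sphere_add:
  assumes "continuous_on (sphere 0 1) f" "continuous_on (sphere 0 1) g" "continuous_on (sphere 0 1) h"
  shows "inner_sphere (\<lambda>x. f x + g x) h = inner_sphere f h + inner_sphere g h"
  unfolding inner_sphere_def distrib_right
  by (intro Bochner_Integration.integral_add continuous_on_sphere_integrable continuous_intros assms)

lemma inner_sphere_cmult: "inner_sphere (\<lambda>x. c * f x) g = c * inner_sphere f g"
  unfolding inner_sphere_def by (simp add: mult.assoc)

lemma inner_sphere_sum:
  assumes "\<And>i. i \<in> I \<Longrightarrow> continuous_on (sphere 0 1) (g i)" "continuous_on (sphere 0 1) h"
  shows "inner_sphere (\<lambda>x. \<Sum>i\<in>I. a i * g i x) h = (\<Sum>i\<in>I. a i * inner_sphere (g i) h)"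
proof -
  have "inner_sphere (\<lambda>x. \<Sum>i\<in>I. a i * g i x) h = (\<integral>x. (\<Sum>i\<in>I. a i * g i x * h x) \<partial>sphere_measure)"
    by (simp add: inner_sphere_def sum_distrib_right)
  also have "\<dots> = (\<Sum>i\<in>I. (\<integral>x. a i * g i x * h x \<partial>sphere_measure))"
    by (intro Bochner_Integration.integral_sum continuous_on_sphere_integrable continuous_intros assms)
  finally show ?thesis
    by (simp add: inner_sphere_cmult[symmetric]) (simp add: inner_sphere_def)
qed

lemma inner_sphere_nonneg: "inner_sphere f f \<ge> 0"
  unfolding inner_sphere_def by (intro Bochner_Integration.integral_nonneg) auto

lemma AE_summable:
  fixes G :: "nat \<Rightarrow> 'b \<Rightarrow> real"
  assumes int: "\<And>l. integrable M (G l)" and sum: "summable (\<lambda>l. \<integral>x. \<bar>G l x\<bar> \<partial>M)"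
  shows "AE x in M. summable (\<lambda>l. \<bar>G l x\<bar>)"
proof -
  have [measurable]: "G l \<in> borel_measurable M" for l using int by auto
  have "(\<integral>\<^sup>+x. (\<Sum>l. ennreal \<bar>G l x\<bar>) \<partial>M) = (\<Sum>l. \<integral>\<^sup>+x. ennreal \<bar>G l x\<bar> \<partial>M)"
    by (rule nn_integral_suminf) measurable
  also have "\<dots> = (\<Sum>l. ennreal (\<integral>x. \<bar>G l x\<bar> \<partial>M))"
    using int by (intro suminf_cong nn_integral_eq_integral) auto
  also have "\<dots> \<noteq> \<infinity>"
    using sum by (subst suminf_ennreal2) auto
  finally have "AE x in M. (\<Sum>l. ennreal \<bar>G l x\<bar>) \<noteq> \<infinity>"
    by (intro nn_integral_PInf_AE) measurable
  then show ?thesis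
    by eventually_elim (auto intro: summable_suminf_not_top)
qed

section \<open>Coefficients and convergence of the Sobolev series\<close>

locale eigenbasis =
  fixes \<phi> :: "nat \<Rightarrow> 'a::euclidean_space \<Rightarrow> real" and lam :: "nat \<Rightarrow> real"
  assumes basis: "laplace_eigenbasis \<phi> lam"
begin

lemma phi_smooth: "smooth_sphere (\<phi> i)"
  and phi_orth: "inner_sphere (\<phi> i) (\<phi> j) = (if i = j then 1 else 0)"
  using basis unfolding laplace_eigenbasis_def by blast+

lemma phi_eigen: "x \<in> sphere 0 1 \<Longrightarrow> laplace_beltrami (\<phi> i) x = - (lam i)\<^sup>2 * \<phi> i x"
  using basis unfolding laplace_eigenbasis_def by (metis minus_minus mult_minus_left)

lemma phi_cont: "continuous_on (sphere 0 1) (\<phi> i)"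
  by (rule smooth_sphere_continuous[OF phi_smooth])

lemma lam_mono:
  assumes "1 \<le> i" "i \<le> j"
  shows "lam i \<le> lam j"
  using assms(2)
proof (induction j rule: dec_induct)
  case (step j)
  then have "lam j \<le> lam (Suc j)"
    using basis \<open>1 \<le> i\<close> unfolding laplace_eigenbasis_def by simp
  with step.IH show ?case by linarith
qed simp

lemma lam_nonneg: "lam i \<ge> 0"
proof (cases "i = 0")
  case True
  then show ?thesis using basis by (simp add: laplace_eigenbasis_def)
next
  case False
  then show ?thesis
    using basis lam_mono[of 1 i] by (simp add: laplace_eigenbasis_def)
qed

definition "fcoeff f i = inner_sphere f (\<phi> i)"
definition "wt i = 1 + (lam i)\<^sup>2"

lemma wt: "wt i \<ge> 1" "wt i > 0"
  by (auto simp: wt_def add_pos_nonneg)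

lemma fcoeff_diff:
  "continuous_on (sphere 0 1) f \<Longrightarrow> continuous_on (sphere 0 1) g \<Longrightarrow>
    fcoeff (\<lambda>x. f x - g x) i = fcoeff f i - fcoeff g i"
  unfolding fcoeff_def by (intro inner_sphere_diff phi_cont)

lemma fcoeff_add:
  "continuous_on (sphere 0 1) f \<Longrightarrow> continuous_on (sphere 0 1) g \<Longrightarrow>
    fcoeff (\<lambda>x. f x + g x) i = fcoeff f i + fcoeff g i"
  unfolding fcoeff_def by (intro inner_sphere_add phi_cont)

lemma fcoeff_cmult: "fcoeff (\<lambda>x. c * f x) i = c * fcoeff f i"
  unfolding fcoeff_def by (rule inner_sphere_cmult)

lemma fcoeff_laplace:
  assumes "smooth_sphere f"
  shows "fcoeff (laplace_beltrami f) i = - (lam i)\<^sup>2 * fcoeff f i"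
proof -
  have "fcoeff (laplace_beltrami f) i = inner_sphere (laplace_beltrami (\<phi> i)) f"
    unfolding fcoeff_def by (simp add: green_identity[OF assms phi_smooth] inner_sphere_commute)
  also have "\<dots> = inner_sphere (\<lambda>x. - (lam i)\<^sup>2 * \<phi> i x) f"
    by (intro inner_sphere_cong phi_eigen)
  finally show ?thesis
    by (simp only: inner_sphere_cmult fcoeff_def inner_sphere_commute)
qed

lemma bessel_finite:
  assumes f: "continuous_on (sphere 0 1) f" and "finite I"
  shows "(\<Sum>i\<in>I. (fcoeff f i)\<^sup>2) \<le> inner_sphere f f"
proof -
  define S where "S x = (\<Sum>i\<in>I. fcoeff f i * \<phi> i x)" for x
  have cS: "continuous_on (sphere 0 1) S"
    unfolding S_def by (intro continuous_intros phi_cont)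
  have Sh: "inner_sphere S h = (\<Sum>i\<in>I. fcoeff f i * inner_sphere (\<phi> i) h)" if "continuous_on (sphere 0 1) h" for h
    unfolding S_def by (intro inner_sphere_sum phi_cont that)
  have Sf: "inner_sphere S f = (\<Sum>i\<in>I. (fcoeff f i)\<^sup>2)"
    by (simp add: Sh[OF f] fcoeff_def inner_sphere_commute[of f] power2_eq_square)
  have Sphi: "inner_sphere (\<phi> i) S = fcoeff f i" if "i \<in> I" for i
    using that \<open>finite I\<close>
    by (subst inner_sphere_commute) (simp add: Sh[OF phi_cont] phi_orth if_distrib cong: if_cong)
  have SS: "inner_sphere S S = (\<Sum>i\<in>I. (fcoeff f i)\<^sup>2)"
    by (simp add: Sh[OF cS] Sphi power2_eq_square)
  have c: "continuous_on (sphere 0 1) (\<lambda>x. f x - S x)" by (intro continuous_intros f cS)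
  have "0 \<le> inner_sphere (\<lambda>x. f x - S x) (\<lambda>x. f x - S x)" by (rule inner_sphere_nonneg)
  also have "\<dots> = inner_sphere f (\<lambda>x. f x - S x) - inner_sphere S (\<lambda>x. f x - S x)"
    by (intro inner_sphere_diff f cS c)
  also have "inner_sphere f (\<lambda>x. f x - S x) = inner_sphere f f - inner_sphere S f"
    by (subst inner_sphere_commute) (intro inner_sphere_diff f cS)
  also have "inner_sphere S (\<lambda>x. f x - S x) = inner_sphere f S - inner_sphere S S"
    by (subst inner_sphere_commute) (intro inner_sphere_diff f cS)
  finally show ?thesis
    using Sf SS inner_sphere_commute[of f S] by linarith
qed

lemma bessel: "continuous_on (sphere 0 1) f \<Longrightarrow> summable (\<lambda>i. (fcoeff f i)\<^sup>2)"
  using bessel_finite by (intro bounded_imp_summable[of _ "inner_sphere f f"]) (auto simp del: sum.lessThan_Suc simp: lessThan_Suc_atMost[symmetric])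

text \<open>One term is bounded by the whole series only if the series converges, which is Bessel's
  inequality. Through this bound the order 0 norms suffice to pass to the limit in each single
  mode.\<close>

lemma fcoeff_le_sobolev_0:
  assumes "continuous_on (sphere 0 1) f"
  shows "\<bar>fcoeff f i\<bar> \<le> sobolev_norm \<phi> lam (real 0) f"
proof -
  have "(fcoeff f i)\<^sup>2 \<le> (\<Sum>i. (fcoeff f i)\<^sup>2)"
    using sum_le_suminf[OF bessel[OF assms], of "{i}"] by simp
  then have "sqrt ((fcoeff f i)\<^sup>2) \<le> sqrt (\<Sum>i. (fcoeff f i)\<^sup>2)"
    by (rule real_sqrt_le_mono)
  then show ?thesis
    using wt by (simp add: sobolev_norm_def flip: fcoeff_def wt_def) (simp add: less_imp_neq[symmetric])
qed

lemma fcoeff_laplace_pow: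
  assumes "smooth_sphere f"
  shows "smooth_sphere ((laplace_beltrami ^^ k) f)"
    "fcoeff ((laplace_beltrami ^^ k) f) i = (- (lam i)\<^sup>2) ^ k * fcoeff f i"
proof (induction k)
  case 0
  show "smooth_sphere ((laplace_beltrami ^^ 0) f)"
    "fcoeff ((laplace_beltrami ^^ 0) f) i = (- (lam i)\<^sup>2) ^ 0 * fcoeff f i"
    using assms by auto
next
  case (Suc k)
  then show "smooth_sphere ((laplace_beltrami ^^ Suc k) f)"
    "fcoeff ((laplace_beltrami ^^ Suc k) f) i = (- (lam i)\<^sup>2) ^ Suc k * fcoeff f i"
    using smooth_sphere_laplace_beltrami fcoeff_laplace by auto
qed

lemma summable_sobolev:
  assumes f: "smooth_sphere f"
  shows "summable (\<lambda>i. wt i powr s * (fcoeff f i)\<^sup>2)"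
proof -
  obtain k :: nat where k: "s \<le> k" using real_arch_simple by blast
  let ?g = "(laplace_beltrami ^^ k) f"
  have "summable (\<lambda>i. 4 ^ k * ((fcoeff f i)\<^sup>2 + (fcoeff ?g i)\<^sup>2))"
    by (intro summable_mult summable_add bessel smooth_sphere_continuous fcoeff_laplace_pow f)
  moreover have "norm (wt i powr s * (fcoeff f i)\<^sup>2) \<le> 4 ^ k * ((fcoeff f i)\<^sup>2 + (fcoeff ?g i)\<^sup>2)" for i
  proof -
    \<comment> \<open>The exponent is doubled because the squared coefficient of the k-th iterated
      Laplacian carries the factor \<open>((lam i)\<^sup>2) ^ (2 * k)\<close>. The constant
      \<open>4 ^ k\<close> then comes from 1 + x \<le> 2 max 1 x.\<close>
    have "wt i powr s \<le> wt i powr real (2 * k)"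
      using k wt(1)[of i] by (intro powr_mono) auto
    also have "\<dots> = wt i ^ (2 * k)"
      using wt(2)[of i] by (rule powr_realpow)
    also have "\<dots> \<le> 4 ^ k * (1 + ((lam i)\<^sup>2) ^ (2 * k))"
    proof -
      have "wt i \<le> 2 * max 1 ((lam i)\<^sup>2)" by (simp add: wt_def)
      then have "wt i ^ (2 * k) \<le> (2 * max 1 ((lam i)\<^sup>2)) ^ (2 * k)"
        using wt(2)[of i] by (intro power_mono) auto
      also have "\<dots> = 4 ^ k * max 1 ((lam i)\<^sup>2) ^ (2 * k)"
        by (simp add: power_mult_distrib power_mult)
      also have "max 1 ((lam i)\<^sup>2) ^ (2 * k) \<le> 1 + ((lam i)\<^sup>2) ^ (2 * k)"
        by (auto simp: max_def)
      finally show ?thesis by simp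
    qed
    finally have "wt i powr s * (fcoeff f i)\<^sup>2 \<le> 4 ^ k * (1 + ((lam i)\<^sup>2) ^ (2 * k)) * (fcoeff f i)\<^sup>2"
      by (rule mult_right_mono) simp
    also have "\<dots> = 4 ^ k * ((fcoeff f i)\<^sup>2 + (fcoeff ?g i)\<^sup>2)"
    proof -
      have "(fcoeff ?g i)\<^sup>2 = ((lam i)\<^sup>2) ^ (2 * k) * (fcoeff f i)\<^sup>2"
        by (simp add: fcoeff_laplace_pow[OF f] power_mult_distrib power_even_eq power_mult flip: power_mult)
      then show ?thesis by (simp add: algebra_simps)
    qed
    finally show ?thesis by simp
  qed
  ultimately show ?thesis
    by (rule summable_comparison_test'[of _ 0])
qed

section \<open>The multiplier of the logarithmic derivative\<close>

definition "blk l = {i. 2 ^ l < lam i \<and> lam i \<le> 2 ^ Suc l}"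
text \<open>\<open>blk l\<close> is the frequency block number l + 1, in accordance with the shifted
  series in \<open>log_nabla\<close>. The finiteness test reproduces the value 0 that a sum over an
  infinite set has by convention.\<close>

definition "lmult l i = (if i \<in> blk l \<and> finite (blk l) then real (Suc l) * ln 2 else 0)"
definition "logmult i = (\<Sum>l. lmult l i)"

lemma blk_unique: "i \<in> blk l \<Longrightarrow> i \<in> blk m \<Longrightarrow> l = m"
proof (rule ccontr)
  assume i: "i \<in> blk l" "i \<in> blk m" and "l \<noteq> m"
  then consider "Suc l \<le> m" | "Suc m \<le> l" by linarith
  then show False
  proof cases
    case 1
    then have "(2::real) ^ Suc l \<le> 2 ^ m" by (intro power_increasing) auto
    with i show False by (auto simp: blk_def)
  next
    case 2
    then have "(2::real) ^ Suc m \<le> 2 ^ l" by (intro power_increasing) auto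
    with i show False by (auto simp: blk_def)
  qed
qed

lemma lmult_sums: "(\<lambda>l. lmult l i) sums logmult i"
  and logmult_eq: "i \<in> blk l \<Longrightarrow> finite (blk l) \<Longrightarrow> logmult i = real (Suc l) * ln 2"
  and logmult_0: "(\<And>l. i \<in> blk l \<Longrightarrow> infinite (blk l)) \<Longrightarrow> logmult i = 0"
proof -
  have 1: "(\<lambda>l. lmult l i) sums (real (Suc l) * ln 2)" if "i \<in> blk l" "finite (blk l)" for l
  proof -
    have "(\<lambda>m. lmult m i) = (\<lambda>m. if m = l then real (Suc l) * ln 2 else 0)"
      using that blk_unique by (fastforce simp: lmult_def)
    then show ?thesis using sums_single[of l "\<lambda>_. real (Suc l) * ln 2"] by simp
  qed
  have 0: "(\<lambda>l. lmult l i) sums 0" if "\<And>l. i \<in> blk l \<Longrightarrow> infinite (blk l)"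
  proof -
    have "(\<lambda>l. lmult l i) = (\<lambda>l. 0)" using that by (auto simp: lmult_def)
    then show ?thesis by simp
  qed
  show "(\<lambda>l. lmult l i) sums logmult i"
    using 0 1 unfolding logmult_def by (metis sums_unique)
  show "logmult i = real (Suc l) * ln 2" if "i \<in> blk l" "finite (blk l)"
    using sums_unique[OF 1[OF that]] by (simp add: logmult_def)
  show "logmult i = 0" if "\<And>l. i \<in> blk l \<Longrightarrow> infinite (blk l)"
    using sums_unique[OF 0[OF that]] by (simp add: logmult_def)
qed

lemma logmult_le:
  assumes "lam i \<le> 2 ^ m"
  shows "0 \<le> logmult i" "logmult i \<le> real m * ln 2"
proof -
  have "0 \<le> logmult i \<and> logmult i \<le> real m * ln 2"
  proof (cases "\<exists>l. i \<in> blk l \<and> finite (blk l)")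
    case True
    then obtain l where l: "i \<in> blk l" "finite (blk l)" by blast
    then have "2 ^ l < lam i" by (simp add: blk_def)
    then have "(2::real) ^ l < 2 ^ m" using assms by linarith
    then have "Suc l \<le> m" by simp
    then have "real (Suc l) * ln 2 \<le> real m * ln 2" by (intro mult_right_mono) auto
    then show ?thesis by (simp add: logmult_eq[OF l])
  next
    case False
    then have "logmult i = 0" by (intro logmult_0) auto
    then show ?thesis by simp
  qed
  then show "0 \<le> logmult i" "logmult i \<le> real m * ln 2" by auto
qed

text \<open>
  An infinite block contributes \<open>0\<close> to \<^const>\<open>log_nabla\<close>, but then \<open>lam\<close> is bounded; so there is
  no need to show that the eigenvalues tend to infinity.
\<close>

lemma logmult_approx: "\<exists>C\<ge>0. \<forall>i. \<bar>logmult i - ln (max 1 (lam i))\<bar> \<le> C"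
proof (cases "\<exists>l. infinite (blk l)")
  case True
  then obtain l where l: "infinite (blk l)" by blast
  have le: "lam i \<le> 2 ^ Suc l" for i
  proof -
    \<comment> \<open>Beyond every i the infinite block contains a larger index j, so monotonicity
      of the frequencies bounds \<open>lam i\<close> by the upper end of that block.\<close>
    obtain j where j: "j \<in> blk l" "max 1 i < j"
      using l by (meson infinite_nat_iff_unbounded)
    show ?thesis
    proof (cases "i = 0")
      case True then show ?thesis using basis by (simp add: laplace_eigenbasis_def)
    next
      case False
      then have "lam i \<le> lam j" using j by (intro lam_mono) auto
      then show ?thesis using j by (auto simp: blk_def)
    qed
  qed
  have "\<bar>logmult i - ln (max 1 (lam i))\<bar> \<le> real (Suc l) * ln 2" for i
  proof -
    have "max 1 (lam i) \<le> 2 ^ Suc l"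
      by (intro max.boundedI one_le_power le) auto
    then have "ln (max 1 (lam i)) \<le> ln (2 ^ Suc l)" by (subst ln_le_cancel_iff) auto
    then have "ln (max 1 (lam i)) \<le> real (Suc l) * ln 2" by (simp only: ln_realpow)
    moreover have "0 \<le> ln (max 1 (lam i))" by simp
    ultimately show ?thesis using logmult_le[OF le, of i] by linarith
  qed
  then show ?thesis by (intro exI[of _ "real (Suc l) * ln 2"]) auto
next
  case False
  have "\<bar>logmult i - ln (max 1 (lam i))\<bar> \<le> ln 2" for i
  proof (cases "lam i \<le> 1")
    case True
    then have "lam i \<le> 2 ^ 0" by simp
    from logmult_le[OF this] True show ?thesis by (simp add: max_def)
  next
    case gt: False
    \<comment> \<open>By minimality \<open>lam i\<close> lies in block m - 1, where m > 0 since
      \<open>lam i > 1\<close>. Its logarithm is between (m - 1) ln 2 and m ln 2, and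
      \<open>logmult\<close> takes the upper value.\<close>
    define m where "m = (LEAST m. lam i \<le> 2 ^ m)"
    have ex: "\<exists>m. lam i \<le> 2 ^ m" using real_arch_pow[of 2 "lam i"] by (auto intro: less_imp_le)
    have m: "lam i \<le> 2 ^ m" unfolding m_def using ex by (rule LeastI_ex)
    then obtain l where l: "m = Suc l" using gt by (cases m) auto
    have "\<not> lam i \<le> 2 ^ l" using not_less_Least[of l "\<lambda>m. lam i \<le> 2 ^ m"] l by (simp add: m_def)
    with m l have bl: "2 ^ l < lam i" "lam i \<le> 2 ^ Suc l" by auto
    then have i: "i \<in> blk l" by (simp add: blk_def)
    have "ln (2 ^ l) < ln (lam i)" "ln (lam i) \<le> ln (2 ^ Suc l)"
      using bl gt by (subst ln_less_cancel_iff ln_le_cancel_iff; simp)+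
    then have "real l * ln 2 < ln (lam i)" "ln (lam i) \<le> real (Suc l) * ln 2"
      by (simp_all only: ln_realpow)
    then show ?thesis
      using gt logmult_eq[OF i] False by (simp add: max_def algebra_simps)
  qed
  then show ?thesis by (intro exI[of _ "ln 2"]) auto
qed

text \<open>
  The series converges absolutely almost everywhere because \<open>\<Sum>\<integral>|G l| < \<infinity>\<close>, which avoids
  pointwise bounds on the eigenfunctions.
\<close>

lemma fcoeff_log_nabla:
  assumes f: "smooth_sphere f" and h: "smooth_sphere h"
  shows "fcoeff (\<lambda>x. h x - log_nabla \<phi> lam f x) i = fcoeff h i - logmult i * fcoeff f i"
proof -
  define c where "c l = (if finite (blk l) then real (Suc l) * ln 2 else 0)" for l
  define G where "G l x = (\<Sum>j\<in>blk l. (c l * fcoeff f j) * \<phi> j x)" for l x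
  have ln: "log_nabla \<phi> lam f x = (\<Sum>l. G l x)" for x
  proof -
    have "real (Suc l) * ln 2 * freq_block \<phi> lam (Suc l) f x = G l x" for l
    proof -
      have "freq_block \<phi> lam (Suc l) f x = (\<Sum>j\<in>blk l. fcoeff f j * \<phi> j x)"
        by (simp add: freq_block_def blk_def fcoeff_def)
      then show ?thesis
        by (cases "finite (blk l)") (simp_all add: G_def c_def sum_distrib_left mult.assoc)
    qed
    then show ?thesis by (simp only: log_nabla_def)
  qed
  have cG: "continuous_on (sphere 0 1) (G l)" for l
    unfolding G_def by (intro continuous_intros phi_cont)
  have Gh: "inner_sphere (G l) g = (\<Sum>j\<in>blk l. (c l * fcoeff f j) * inner_sphere (\<phi> j) g)"
    if "continuous_on (sphere 0 1) g" for l g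
    unfolding G_def by (intro inner_sphere_sum phi_cont that)
  have Gphi: "inner_sphere (G l) (\<phi> i) = lmult l i * fcoeff f i" for l i
  proof -
    have "inner_sphere (G l) (\<phi> i) = (\<Sum>j\<in>blk l. (c l * fcoeff f j) * (if j = i then 1 else 0))"
      by (simp add: Gh[OF phi_cont] phi_orth)
    also have "\<dots> = lmult l i * fcoeff f i"
      by (cases "finite (blk l)") (auto simp: c_def lmult_def if_distrib sum.delta' cong: if_cong)
    finally show ?thesis .
  qed
  \<comment> \<open>On block l the weight is at least 4^l, so its fourth power is at least 4^l *
    64^l. The factor 4^l absorbs the squared multiplier, and the remaining decay 64^-l pays for the
    factor 2^l in the L^1 bound below.\<close>
  define K where "K = (\<Sum>i. wt i powr 4 * (fcoeff f i)\<^sup>2)"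
  have K: "K \<ge> 0" unfolding K_def by (intro suminf_nonneg summable_sobolev f) auto
  have GG: "inner_sphere (G l) (G l) \<le> K / 64 ^ l" for l
  proof (cases "finite (blk l)")
    case True
    have "inner_sphere (G l) (G l) = (\<Sum>j\<in>blk l. (c l * fcoeff f j) * inner_sphere (\<phi> j) (G l))"
      by (rule Gh[OF cG])
    also have "\<dots> = (\<Sum>j\<in>blk l. (c l)\<^sup>2 * (fcoeff f j)\<^sup>2)"
      using True
      by (intro sum.cong refl)
         (simp add: inner_sphere_commute[of "\<phi> _"] Gphi c_def lmult_def power2_eq_square)
    also have "\<dots> \<le> (\<Sum>j\<in>blk l. (wt j powr 4 * (fcoeff f j)\<^sup>2) / 64 ^ l)"
    proof (rule sum_mono)
      fix j assume j: "j \<in> blk l"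
      have "c l \<le> 2 ^ l"
      proof -
        have "real (Suc l) \<le> 2 ^ l"
          using of_nat_le_iff[where 'a = real, of "Suc l" "2 ^ l"] less_exp[of l] by simp
        moreover have "ln 2 \<le> (1::real)" using ln_2_less_1 by simp
        ultimately have "real (Suc l) * ln 2 \<le> 2 ^ l * 1" by (intro mult_mono) auto
        then show ?thesis by (simp add: c_def)
      qed
      moreover have "0 \<le> c l" by (simp add: c_def)
      ultimately have "(c l)\<^sup>2 \<le> (2 ^ l)\<^sup>2" by (intro power_mono)
      also have "\<dots> = 4 ^ l" by (simp add: power2_eq_square flip: power_mult_distrib)
      finally have c2: "(c l)\<^sup>2 \<le> 4 ^ l" .
      have "(2 ^ l)\<^sup>2 \<le> (lam j)\<^sup>2" using j by (intro power_mono) (auto simp: blk_def)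
      then have "4 ^ l \<le> wt j"
        by (simp add: wt_def power2_eq_square flip: power_mult_distrib)
      then have "(4 ^ l) ^ 4 \<le> wt j ^ 4" by (intro power_mono) auto
      moreover have "wt j powr 4 = wt j ^ 4"
        using powr_realpow[OF wt(2), of j 4] by simp
      moreover have "((4::real) ^ l) ^ 4 = 4 ^ l * 64 ^ l"
        by (simp add: power_mult_distrib[symmetric] power_mult[symmetric] mult.commute[of l])
           (simp add: power_mult power_mult_distrib[symmetric])
      ultimately have "4 ^ l * 64 ^ l \<le> wt j powr 4" by simp
      then have "4 ^ l \<le> wt j powr 4 / 64 ^ l" by (simp add: field_simps)
      with c2 have "(c l)\<^sup>2 * (fcoeff f j)\<^sup>2 \<le> wt j powr 4 / 64 ^ l * (fcoeff f j)\<^sup>2"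
        by (intro mult_right_mono) auto
      then show "(c l)\<^sup>2 * (fcoeff f j)\<^sup>2 \<le> (wt j powr 4 * (fcoeff f j)\<^sup>2) / 64 ^ l" by simp
    qed
    also have "\<dots> = (\<Sum>j\<in>blk l. wt j powr 4 * (fcoeff f j)\<^sup>2) / 64 ^ l"
      by (simp add: sum_divide_distrib)
    also have "\<dots> \<le> K / 64 ^ l"
      unfolding K_def by (intro divide_right_mono sum_le_suminf summable_sobolev f True) auto
    finally show ?thesis .
  next
    case False
    then show ?thesis using K by (simp add: G_def inner_sphere_def)
  qed
  define \<sigma> where "\<sigma> = measure sphere_measure (sphere (0::'a) 1)"
  have G1: "(\<integral>x. \<bar>G l x\<bar> \<partial>sphere_measure) \<le> (\<sigma> + K) * (1 / 2) ^ l" for l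
  proof -
    \<comment> \<open>Young's inequality with weight 2^l: it bounds the L^1 norm by the squared L^2
      norm and the finite total measure, both with geometrically decaying factors.\<close>
    have "(\<integral>x. \<bar>G l x\<bar> \<partial>sphere_measure) \<le> (\<integral>x. (1 / 2) ^ l + 2 ^ l * (G l x * G l x) \<partial>sphere_measure)"
    proof (intro integral_mono continuous_on_sphere_integrable continuous_intros cG)
      fix x
      have "0 \<le> (2 ^ l * \<bar>G l x\<bar> - 1)\<^sup>2" by simp
      then have "2 * (2 ^ l * \<bar>G l x\<bar>) \<le> 2 ^ l * (2 ^ l * (G l x * G l x)) + 1"
        by (simp add: power2_eq_square algebra_simps)
      moreover have "0 \<le> 2 ^ l * \<bar>G l x\<bar>" by simp
      ultimately have "2 ^ l * \<bar>G l x\<bar> \<le> 2 ^ l * (2 ^ l * (G l x * G l x)) + 1" by linarith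
      then show "\<bar>G l x\<bar> \<le> (1 / 2) ^ l + 2 ^ l * (G l x * G l x)"
        by (simp add: power_divide field_simps)
    qed
    also have "\<dots> = (1 / 2) ^ l * \<sigma> + 2 ^ l * inner_sphere (G l) (G l)"
      unfolding inner_sphere_def
      by (subst Bochner_Integration.integral_add)
         (auto intro!: continuous_on_sphere_integrable continuous_intros cG simp: \<sigma>_def)
    also have "\<dots> \<le> (1 / 2) ^ l * \<sigma> + 2 ^ l * (K / 64 ^ l)"
      using GG by (intro add_left_mono mult_left_mono) auto
    also have "2 ^ l * (K / 64 ^ l) = K * (1 / 32) ^ l"
    proof -
      have "(64::real) ^ l = 2 ^ l * 32 ^ l" by (simp flip: power_mult_distrib)
      then show ?thesis by (simp add: power_divide)
    qed
    also have "K * (1 / 32) ^ l \<le> K * (1 / 2) ^ l"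
      using K by (intro mult_left_mono power_mono) auto
    finally show ?thesis by (simp add: algebra_simps)
  qed
  have iG: "integrable sphere_measure (G l)" for l
    by (intro continuous_on_sphere_integrable cG)
  have geo: "summable (\<lambda>l. C * (1 / 2) ^ l)" for C :: real
    by (intro summable_mult summable_geometric) auto
  have sG: "summable (\<lambda>l. \<integral>x. \<bar>G l x\<bar> \<partial>sphere_measure)"
    by (rule summable_comparison_test'[OF geo[of "\<sigma> + K"], of 0]) (use G1 in auto)
  have AEs: "AE x in sphere_measure. summable (\<lambda>l. \<bar>G l x\<bar>)"
    by (rule AE_summable[OF iG sG])
  have "bounded (\<phi> i ` sphere 0 1)"
    by (intro compact_imp_bounded compact_continuous_image phi_cont compact_sphere)
  then obtain m where m: "\<And>x. x \<in> sphere 0 1 \<Longrightarrow> \<bar>\<phi> i x\<bar> \<le> m"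
    by (force simp: bounded_iff)
  have iGp: "integrable sphere_measure (\<lambda>x. G l x * \<phi> i x)" for l
    by (intro continuous_on_sphere_integrable continuous_intros cG phi_cont)
  have AEp: "AE x in sphere_measure. summable (\<lambda>l. norm (G l x * \<phi> i x))"
    using AEs by eventually_elim (simp add: abs_mult summable_mult2)
  have sGp: "summable (\<lambda>l. \<integral>x. norm (G l x * \<phi> i x) \<partial>sphere_measure)"
  proof (rule summable_comparison_test'[OF summable_mult[OF sG, of m], of 0])
    fix l
    have "(\<integral>x. norm (G l x * \<phi> i x) \<partial>sphere_measure) \<le> (\<integral>x. m * \<bar>G l x\<bar> \<partial>sphere_measure)"
    proof (intro integral_mono continuous_on_sphere_integrable continuous_intros cG phi_cont)
      fix x :: 'a assume "x \<in> space sphere_measure"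
      then have "\<bar>G l x\<bar> * \<bar>\<phi> i x\<bar> \<le> \<bar>G l x\<bar> * m" using m by (intro mult_left_mono) auto
      then show "norm (G l x * \<phi> i x) \<le> m * \<bar>G l x\<bar>" by (simp add: abs_mult mult.commute)
    qed
    then show "norm (\<integral>x. norm (G l x * \<phi> i x) \<partial>sphere_measure) \<le> m * (\<integral>x. \<bar>G l x\<bar> \<partial>sphere_measure)"
      by (simp add: Bochner_Integration.integral_nonneg)
  qed
  have eq: "(\<Sum>l. G l x * \<phi> i x) = log_nabla \<phi> lam f x * \<phi> i x" if "summable (\<lambda>l. \<bar>G l x\<bar>)" for x
    using suminf_mult2[OF summable_rabs_cancel[OF that], of "\<phi> i x"] by (simp add: ln)
  \<comment> \<open>Where the series diverges, the value of \<open>log_nabla\<close> is unspecified;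
    these points form a null set, so the coefficient does not see them.\<close>
  have cancel: "AE x in sphere_measure. log_nabla \<phi> lam f x * \<phi> i x = (\<Sum>l. G l x * \<phi> i x)"
    using AEs by eventually_elim (simp add: eq)
  have isum: "integrable sphere_measure (\<lambda>x. \<Sum>l. G l x * \<phi> i x)"
    by (rule integrable_suminf[OF iGp AEp sGp])
  have meas: "(\<lambda>x. log_nabla \<phi> lam f x * \<phi> i x) \<in> borel_measurable sphere_measure"
    unfolding ln using cG phi_cont[of i]
    by (intro borel_measurable_times borel_measurable_suminf continuous_on_sphere_measurable) auto
  have il: "integrable sphere_measure (\<lambda>x. log_nabla \<phi> lam f x * \<phi> i x)"
    by (rule integrable_cong_AE_imp[OF isum meas]) (use cancel in \<open>auto simp: eq_commute\<close>)
  have "(\<integral>x. log_nabla \<phi> lam f x * \<phi> i x \<partial>sphere_measure) = (\<integral>x. (\<Sum>l. G l x * \<phi> i x) \<partial>sphere_measure)"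
    by (rule integral_cong_AE[OF meas borel_measurable_integrable[OF isum] cancel])
  also have "\<dots> = (\<Sum>l. inner_sphere (G l) (\<phi> i))"
    unfolding inner_sphere_def by (rule integral_suminf[OF iGp AEp sGp])
  also have "\<dots> = logmult i * fcoeff f i"
    unfolding Gphi using sums_unique[OF sums_mult2[OF lmult_sums]] by simp
  finally have "(\<integral>x. log_nabla \<phi> lam f x * \<phi> i x \<partial>sphere_measure) = logmult i * fcoeff f i" .
  moreover have "integrable sphere_measure (\<lambda>x. h x * \<phi> i x)"
    by (intro continuous_on_sphere_integrable continuous_on_mult smooth_sphere_continuous h phi_cont)
  ultimately show ?thesis
    using il by (simp add: fcoeff_def inner_sphere_def left_diff_distrib)
qed

end

subsection \<open>Summation over the modes\<close>

lemma mult_abs_ln_le: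
  assumes "0 < t" "t \<le> (1::real)"
  shows "t * \<bar>ln t\<bar>\<^sup>2 \<le> 4" "t * \<bar>ln t\<bar> \<le> 2 * sqrt t"
proof -
  have "t * \<bar>ln t\<bar>\<^sup>2 \<le> t * (1 + \<bar>ln t\<bar>)\<^sup>2"
    using assms by (intro mult_left_mono power_mono) auto
  also have "\<dots> \<le> 4" by (rule mult_ln_square_le[OF assms])
  finally show 1: "t * \<bar>ln t\<bar>\<^sup>2 \<le> 4" .
  have "(t * \<bar>ln t\<bar>)\<^sup>2 = t * (t * \<bar>ln t\<bar>\<^sup>2)"
    by (simp add: power2_eq_square)
  also have "\<dots> \<le> t * 4" using 1 assms by (intro mult_left_mono) auto
  also have "\<dots> = (2 * sqrt t)\<^sup>2" using assms by (simp add: power_mult_distrib)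
  finally show "t * \<bar>ln t\<bar> \<le> 2 * sqrt t"
    by (rule power2_le_imp_le) (use assms in auto)
qed

lemma eventually_at_right_0_le_1: "\<forall>\<^sub>F t in at_right (0::real). 0 < t \<and> t \<le> 1"
  using eventually_at_right_real[of 0 1] by (auto elim: eventually_mono)

lemma sqrt_at_right_0: "((\<lambda>t. sqrt t) \<longlongrightarrow> 0) (at_right 0)"
proof -
  have "((\<lambda>t. sqrt t) \<longlongrightarrow> sqrt 0) (at_right 0)" by (intro tendsto_intros)
  then show ?thesis by simp
qed

definition time_deriv :: "(real \<Rightarrow> 'a \<Rightarrow> real) \<Rightarrow> real \<Rightarrow> 'a \<Rightarrow> real" where
  "time_deriv u t x = deriv (\<lambda>s. u s x) t"

context eigenbasis
begin

lemma sobolev_norm_eq: "sobolev_norm \<phi> lam s f = sqrt (\<Sum>i. wt i powr s * (fcoeff f i)\<^sup>2)"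
  by (simp add: sobolev_norm_def wt_def fcoeff_def)

text \<open>Since \<open>suminf\<close> respects termwise bounds only for convergent series,
  summability on the right is assumed, and on the left it follows by comparison. The three norms are
  separated by subadditivity of the square root.\<close>

lemma sobolev_norm_le:
  assumes le: "\<And>i. wt i powr s * (fcoeff f i)\<^sup>2
      \<le> C * (wt i powr s\<^sub>1 * (fcoeff f\<^sub>1 i)\<^sup>2 + wt i powr s\<^sub>2 * (fcoeff f\<^sub>2 i)\<^sup>2 + wt i powr s\<^sub>3 * (fcoeff f\<^sub>3 i)\<^sup>2)"
    and sum: "summable (\<lambda>i. wt i powr s\<^sub>1 * (fcoeff f\<^sub>1 i)\<^sup>2)" "summable (\<lambda>i. wt i powr s\<^sub>2 * (fcoeff f\<^sub>2 i)\<^sup>2)"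
      "summable (\<lambda>i. wt i powr s\<^sub>3 * (fcoeff f\<^sub>3 i)\<^sup>2)" and C: "C \<ge> 0"
  shows "sobolev_norm \<phi> lam s f
    \<le> sqrt C * (sobolev_norm \<phi> lam s\<^sub>1 f\<^sub>1 + sobolev_norm \<phi> lam s\<^sub>2 f\<^sub>2 + sobolev_norm \<phi> lam s\<^sub>3 f\<^sub>3)"
proof -
  define a b c where "a = (\<Sum>i. wt i powr s\<^sub>1 * (fcoeff f\<^sub>1 i)\<^sup>2)" and "b = (\<Sum>i. wt i powr s\<^sub>2 * (fcoeff f\<^sub>2 i)\<^sup>2)"
    and "c = (\<Sum>i. wt i powr s\<^sub>3 * (fcoeff f\<^sub>3 i)\<^sup>2)"
  have nn: "0 \<le> a" "0 \<le> b" "0 \<le> c"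
    unfolding a_def b_def c_def by (intro suminf_nonneg sum; simp)+
  have S: "(\<lambda>i. C * (wt i powr s\<^sub>1 * (fcoeff f\<^sub>1 i)\<^sup>2 + wt i powr s\<^sub>2 * (fcoeff f\<^sub>2 i)\<^sup>2 + wt i powr s\<^sub>3 * (fcoeff f\<^sub>3 i)\<^sup>2))
      sums (C * (a + b + c))"
    unfolding a_def b_def c_def by (intro sums_mult sums_add summable_sums sum)
  have "summable (\<lambda>i. wt i powr s * (fcoeff f i)\<^sup>2)"
    by (rule summable_comparison_test'[OF sums_summable[OF S], of 0]) (use le in simp)
  then have "(\<Sum>i. wt i powr s * (fcoeff f i)\<^sup>2) \<le> C * (a + b + c)"
    using suminf_le[OF le _ sums_summable[OF S]] sums_unique[OF S] by simp
  then have "sobolev_norm \<phi> lam s f \<le> sqrt C * sqrt (a + b + c)"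
    by (simp add: sobolev_norm_eq flip: real_sqrt_mult)
  also have "sqrt (a + b + c) \<le> sqrt a + sqrt b + sqrt c"
    using nn sqrt_add_le_add_sqrt[of "a + b" c] sqrt_add_le_add_sqrt[of a b] by linarith
  finally show ?thesis
    using C by (simp add: sobolev_norm_eq a_def b_def c_def mult_left_mono)
qed

text \<open>The renormalised datum is known only through its coefficients, so
  \<open>summable_sobolev\<close> does not apply to it. The multiplier is at most (C + 1) * wt in
  absolute value, and its square costs the \<O> term two units of s.\<close>

lemma summable_sobolev_log_nabla:
  assumes f: "smooth_sphere f" and h: "smooth_sphere h"
  shows "summable (\<lambda>i. wt i powr s * (fcoeff (\<lambda>x. h x - log_nabla \<phi> lam f x) i)\<^sup>2)"
proof -
  obtain C where C: "C \<ge> 0" "\<And>i. \<bar>logmult i - ln (max 1 (lam i))\<bar> \<le> C"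
    using logmult_approx by blast
  have "summable (\<lambda>i. 2 * (wt i powr s * (fcoeff h i)\<^sup>2) + 2 * (C + 1)\<^sup>2 * (wt i powr (s + 2) * (fcoeff f i)\<^sup>2))"
    by (intro summable_add summable_mult summable_sobolev f h)
  then show ?thesis
  proof (rule summable_comparison_test'[of _ 0])
    fix i
    have "ln (max 1 (lam i)) \<le> max 1 (lam i)"
      by (rule order.trans[OF ln_le_minus_one]) auto
    also have "\<dots> \<le> wt i"
    proof -
      have "0 \<le> (lam i - 1 / 2)\<^sup>2" by simp
      then have "lam i \<le> wt i" by (simp add: wt_def power2_eq_square algebra_simps)
      then show ?thesis using wt(1)[of i] by simp
    qed
    finally have "logmult i \<le> C + wt i" using C(2)[of i] by linarith
    moreover have "C \<le> C * wt i" using C(1) wt(1)[of i] by (simp add: mult_le_cancel_left1)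
    ultimately have "logmult i \<le> (C + 1) * wt i" by (simp add: algebra_simps)
    moreover have "- ((C + 1) * wt i) \<le> logmult i"
    proof -
      have "0 \<le> ln (max 1 (lam i))" by simp
      then have "- C \<le> logmult i" using C(2)[of i] by linarith
      then show ?thesis using \<open>C \<le> C * wt i\<close> wt(2)[of i] by (simp add: algebra_simps)
    qed
    ultimately have "(logmult i)\<^sup>2 \<le> ((C + 1) * wt i)\<^sup>2"
      by (intro power2_le_iff_abs_le[THEN iffD2]) (use C wt(2)[of i] in auto)
    then have "(logmult i)\<^sup>2 * (fcoeff f i)\<^sup>2 \<le> ((C + 1) * wt i)\<^sup>2 * (fcoeff f i)\<^sup>2"
      by (rule mult_right_mono) simp
    moreover have "(fcoeff h i - logmult i * fcoeff f i)\<^sup>2 \<le> 2 * (fcoeff h i)\<^sup>2 + 2 * ((logmult i)\<^sup>2 * (fcoeff f i)\<^sup>2)"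
      using zero_le_power2[of "fcoeff h i + logmult i * fcoeff f i"]
      by (simp add: power2_sum power2_diff power_mult_distrib)
    ultimately have "(fcoeff h i - logmult i * fcoeff f i)\<^sup>2 \<le> 2 * (fcoeff h i)\<^sup>2 + 2 * (((C + 1) * wt i)\<^sup>2 * (fcoeff f i)\<^sup>2)"
      by linarith
    then have "wt i powr s * (fcoeff h i - logmult i * fcoeff f i)\<^sup>2
        \<le> wt i powr s * (2 * (fcoeff h i)\<^sup>2 + 2 * (((C + 1) * wt i)\<^sup>2 * (fcoeff f i)\<^sup>2))"
      by (rule mult_left_mono) simp
    also have "\<dots> = 2 * (wt i powr s * (fcoeff h i)\<^sup>2) + 2 * (C + 1)\<^sup>2 * (wt i powr (s + 2) * (fcoeff f i)\<^sup>2)"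
      using wt(2)[of i] by (simp add: powr_add power2_eq_square algebra_simps)
    finally show "norm (wt i powr s * (fcoeff (\<lambda>x. h x - log_nabla \<phi> lam f x) i)\<^sup>2)
        \<le> 2 * (wt i powr s * (fcoeff h i)\<^sup>2) + 2 * (C + 1)\<^sup>2 * (wt i powr (s + 2) * (fcoeff f i)\<^sup>2)"
      by (simp add: fcoeff_log_nabla[OF f h])
  qed
qed

section \<open>The Fourier coefficients of a solution\<close>

context
  fixes q' B :: real and f1 f2 f3 :: "real \<Rightarrow> real" and chi0 \<O> h :: "'a \<Rightarrow> real" and \<alpha> chi :: "real \<Rightarrow> 'a \<Rightarrow> real"
  assumes q': "q' \<ge> 1" and B: "B \<ge> 0"
    and fb: "\<And>t. t > 0 \<Longrightarrow> \<bar>f1 t\<bar> \<le> B" "\<And>t. t > 0 \<Longrightarrow> \<bar>f2 t\<bar> \<le> B" "\<And>t. t > 0 \<Longrightarrow> \<bar>f3 t\<bar> \<le> B"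
    and sol: "smooth_solution \<phi> lam q' f1 f2 f3 chi0 \<O> h \<alpha> chi"
begin

lemma solution_smooth: "smooth_sphere chi0" "smooth_sphere \<O>" "smooth_sphere h"
    "smooth_time_sphere \<alpha>" "smooth_time_sphere chi"
  using sol by (auto simp: smooth_solution_def)

lemma time_deriv_smooth: "smooth_time_sphere (time_deriv \<alpha>)" "smooth_time_sphere (time_deriv (time_deriv \<alpha>))"
proof -
  show 1: "smooth_time_sphere (time_deriv \<alpha>)"
    using smooth_time_sphere_deriv[OF solution_smooth(4)] by (simp add: time_deriv_def[abs_def])
  show "smooth_time_sphere (time_deriv (time_deriv \<alpha>))"
    using smooth_time_sphere_deriv[OF 1] by (simp add: time_deriv_def[abs_def])
qed

lemma cont_slice:
  assumes "t > 0"
  shows "continuous_on (sphere 0 1) (\<alpha> t)" "continuous_on (sphere 0 1) (time_deriv \<alpha> t)"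
    "continuous_on (sphere 0 1) (time_deriv (time_deriv \<alpha>) t)" "continuous_on (sphere 0 1) (chi t)"
  using smooth_time_sphere_slice[OF _ assms] solution_smooth(4,5) time_deriv_smooth by (auto intro: smooth_sphere_continuous)

lemma mode_ode: "freq_mode q' B (lam i) f1 f2 f3 (\<lambda>t. fcoeff (\<alpha> t) i) (\<lambda>t. fcoeff (time_deriv \<alpha> t) i)
  (\<lambda>t. fcoeff (time_deriv (time_deriv \<alpha>) t) i) (\<lambda>t. fcoeff (chi t) i)"
proof
  fix t :: real assume t: "t > 0"
  note cs = cont_slice[OF t] smooth_sphere_continuous[OF smooth_sphere_laplace_beltrami[OF smooth_time_sphere_slice[OF solution_smooth(4) t]]]
  show "((\<lambda>t. fcoeff (\<alpha> t) i) has_real_derivative fcoeff (time_deriv \<alpha> t) i) (at t)"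
    using inner_sphere_has_derivative[OF solution_smooth(4) phi_cont t] by (simp add: fcoeff_def time_deriv_def[abs_def])
  show "((\<lambda>t. fcoeff (time_deriv \<alpha> t) i) has_real_derivative fcoeff (time_deriv (time_deriv \<alpha>) t) i) (at t)"
    using inner_sphere_has_derivative[OF time_deriv_smooth(1) phi_cont t] by (simp add: fcoeff_def time_deriv_def[abs_def])
  have eqs: "time_deriv (time_deriv \<alpha>) t x + 1 / t * time_deriv \<alpha> t x + 4 * q' * \<alpha> t x - 4 / (t\<^sup>2 + 1)\<^sup>2 * laplace_beltrami (\<alpha> t) x
        = f1 t * t * time_deriv \<alpha> t x + f2 t * t\<^sup>2 * \<alpha> t x + f3 t * chi t x"
      "deriv (\<lambda>t. chi t x) t = 2 * t * \<alpha> t x" if "x \<in> sphere 0 1" for x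
    using sol t that by (auto simp: smooth_solution_def solves_M_def time_deriv_def[abs_def])
  have "fcoeff (\<lambda>x. deriv (\<lambda>t. chi t x) t) i = fcoeff (\<lambda>x. (2 * t) * \<alpha> t x) i"
    unfolding fcoeff_def by (rule inner_sphere_cong) (simp add: eqs(2))
  then show "((\<lambda>t. fcoeff (chi t) i) has_real_derivative 2 * t * fcoeff (\<alpha> t) i) (at t)"
    using inner_sphere_has_derivative[OF solution_smooth(5) phi_cont[of i] t] by (simp add: fcoeff_cmult flip: fcoeff_def)
  \<comment> \<open>The equation is solved for the second time derivative, so that the right-hand
    side is a linear combination of functions continuous on the sphere and can be projected term by
    term.\<close>
  have "fcoeff (time_deriv (time_deriv \<alpha>) t) i = fcoeff (\<lambda>x. ((4 / (t\<^sup>2 + 1)\<^sup>2) * laplace_beltrami (\<alpha> t) x + (f1 t * t - 1 / t) * time_deriv \<alpha> t x)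
      + ((f2 t * t\<^sup>2 - 4 * q') * \<alpha> t x + f3 t * chi t x)) i"
    unfolding fcoeff_def
  proof (rule inner_sphere_cong)
    fix x :: 'a assume "x \<in> sphere 0 1"
    from eqs(1)[OF this] show "time_deriv (time_deriv \<alpha>) t x = ((4 / (t\<^sup>2 + 1)\<^sup>2) * laplace_beltrami (\<alpha> t) x + (f1 t * t - 1 / t) * time_deriv \<alpha> t x)
      + ((f2 t * t\<^sup>2 - 4 * q') * \<alpha> t x + f3 t * chi t x)"
      by (simp add: algebra_simps)
  qed
  also have "\<dots> = (4 / (t\<^sup>2 + 1)\<^sup>2) * (- (lam i)\<^sup>2 * fcoeff (\<alpha> t) i) + (f1 t * t - 1 / t) * fcoeff (time_deriv \<alpha> t) i
      + ((f2 t * t\<^sup>2 - 4 * q') * fcoeff (\<alpha> t) i + f3 t * fcoeff (chi t) i)"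
    by (simp only: fcoeff_add fcoeff_cmult continuous_on_add continuous_on_mult continuous_on_const cs
        fcoeff_laplace[OF smooth_time_sphere_slice[OF solution_smooth(4) t]])
  finally show "fcoeff (time_deriv (time_deriv \<alpha>) t) i + 1 / t * fcoeff (time_deriv \<alpha> t) i + 4 * q' * fcoeff (\<alpha> t) i
        + 4 / (t\<^sup>2 + 1)\<^sup>2 * ((lam i)\<^sup>2 * fcoeff (\<alpha> t) i)
      = f1 t * t * fcoeff (time_deriv \<alpha> t) i + f2 t * t\<^sup>2 * fcoeff (\<alpha> t) i + f3 t * fcoeff (chi t) i"
    by (simp add: algebra_simps)
qed (use q' B fb lam_nonneg in auto)

text \<open>The order 0 norms dominate each coefficient. After multiplication by t, the error of the
  time derivative is of size \<open>t\<^sup>2 * |ln t|\<^sup>2\<close>, which leaves a power of t to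
  absorb the additional logarithm of the second limit.\<close>

lemma mode_limits:
  shows "((\<lambda>t. fcoeff (\<alpha> t) i - (fcoeff \<O> i * ln t + fcoeff h i)) \<longlongrightarrow> 0) (at_right 0)"
    and "((\<lambda>t. (t * fcoeff (time_deriv \<alpha> t) i - fcoeff \<O> i) * ln t) \<longlongrightarrow> 0) (at_right 0)"
    and "((\<lambda>t. t * fcoeff (time_deriv \<alpha> t) i) \<longlongrightarrow> fcoeff \<O> i) (at_right 0)"
    and "((\<lambda>t. fcoeff (chi t) i) \<longlongrightarrow> fcoeff chi0 i) (at_right 0)"
proof -
  note cs = solution_smooth(1-3)[THEN smooth_sphere_continuous]
  have "(\<lambda>\<tau>. sobolev_norm \<phi> lam (real 0) (\<lambda>x. \<alpha> \<tau> x - (\<O> x * ln \<tau> + h x))) \<in> O[at_right 0](\<lambda>\<tau>. \<tau>\<^sup>2 * \<bar>ln \<tau>\<bar>\<^sup>2)"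
    using sol unfolding smooth_solution_def by blast
  then obtain C where C: "C > 0" "\<forall>\<^sub>F t in at_right 0. norm (sobolev_norm \<phi> lam (real 0) (\<lambda>x. \<alpha> t x - (\<O> x * ln t + h x)))
      \<le> C * norm (t\<^sup>2 * \<bar>ln t\<bar>\<^sup>2)"
    by (auto elim!: landau_o.bigE)
  have y: "\<forall>\<^sub>F t in at_right 0. norm (fcoeff (\<alpha> t) i - (fcoeff \<O> i * ln t + fcoeff h i)) \<le> norm (sqrt t) * (4 * C)"
    using C(2) eventually_at_right_0_le_1
  proof eventually_elim
    case (elim t)
    then have t: "0 < t" "t \<le> 1" by auto
    have c: "continuous_on (sphere 0 1) (\<lambda>x. ln t * \<O> x + h x)" by (intro continuous_intros cs)
    have "fcoeff (\<lambda>x. \<alpha> t x - (ln t * \<O> x + h x)) i = fcoeff (\<alpha> t) i - (fcoeff \<O> i * ln t + fcoeff h i)"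
      by (subst fcoeff_diff[OF cont_slice(1)[OF t(1)] c], subst fcoeff_add)
         (auto simp: fcoeff_cmult intro!: continuous_intros cs)
    moreover have "\<bar>fcoeff (\<lambda>x. \<alpha> t x - (ln t * \<O> x + h x)) i\<bar> \<le> sobolev_norm \<phi> lam (real 0) (\<lambda>x. \<alpha> t x - (ln t * \<O> x + h x))"
      by (intro fcoeff_le_sobolev_0 continuous_intros cont_slice t cs)
    ultimately have "\<bar>fcoeff (\<alpha> t) i - (fcoeff \<O> i * ln t + fcoeff h i)\<bar> \<le> C * norm (t\<^sup>2 * \<bar>ln t\<bar>\<^sup>2)"
      using elim(1) by (simp add: mult.commute)
    also have "t\<^sup>2 * \<bar>ln t\<bar>\<^sup>2 = t * (t * \<bar>ln t\<bar>\<^sup>2)" by (simp add: power2_eq_square)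
    also have "C * norm (t * (t * \<bar>ln t\<bar>\<^sup>2)) \<le> C * (sqrt t * 4)"
    proof -
      have "t * t \<le> t" using t by (simp add: mult_left_le)
      then have "t \<le> sqrt t" using t by (intro real_le_rsqrt) (simp add: power2_eq_square)
      then have "t * (t * \<bar>ln t\<bar>\<^sup>2) \<le> sqrt t * 4"
        using mult_abs_ln_le(1)[OF t] t by (intro mult_mono) auto
      then show ?thesis using C t by (intro mult_left_mono) auto
    qed
    finally show ?case using t by (simp add: mult_ac)
  qed
  show "((\<lambda>t. fcoeff (\<alpha> t) i - (fcoeff \<O> i * ln t + fcoeff h i)) \<longlongrightarrow> 0) (at_right 0)"
    by (rule tendsto_0_le[OF sqrt_at_right_0 y])
  have "(\<lambda>\<tau>. sobolev_norm \<phi> lam (real 0) (\<lambda>x. deriv (\<lambda>t. \<alpha> t x) \<tau> - \<O> x / \<tau>)) \<in> O[at_right 0](\<lambda>\<tau>. \<tau> * \<bar>ln \<tau>\<bar>\<^sup>2)"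
    using sol unfolding smooth_solution_def by blast
  then obtain D where D: "D > 0" "\<forall>\<^sub>F t in at_right 0. norm (sobolev_norm \<phi> lam (real 0) (\<lambda>x. time_deriv \<alpha> t x - \<O> x / t))
      \<le> D * norm (t * \<bar>ln t\<bar>\<^sup>2)"
    unfolding time_deriv_def by (auto elim!: landau_o.bigE)
  have w: "\<forall>\<^sub>F t in at_right 0. \<bar>t * fcoeff (time_deriv \<alpha> t) i - fcoeff \<O> i\<bar> \<le> t * (D * 4) \<and>
      \<bar>t * fcoeff (time_deriv \<alpha> t) i - fcoeff \<O> i\<bar> * \<bar>ln t\<bar> \<le> sqrt t * (D * 8)"
    using D(2) eventually_at_right_0_le_1
  proof eventually_elim
    case (elim t)
    then have t: "0 < t" "t \<le> 1" by auto
    have c: "continuous_on (sphere 0 1) (\<lambda>x. (1 / t) * \<O> x)" by (intro continuous_intros cs)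
    have "fcoeff (\<lambda>x. time_deriv \<alpha> t x - (1 / t) * \<O> x) i = fcoeff (time_deriv \<alpha> t) i - (1 / t) * fcoeff \<O> i"
      by (simp only: fcoeff_diff[OF cont_slice(2)[OF t(1)] c] fcoeff_cmult)
    moreover have "\<bar>fcoeff (\<lambda>x. time_deriv \<alpha> t x - (1 / t) * \<O> x) i\<bar> \<le> sobolev_norm \<phi> lam (real 0) (\<lambda>x. time_deriv \<alpha> t x - (1 / t) * \<O> x)"
      by (intro fcoeff_le_sobolev_0 continuous_intros cont_slice t cs)
    ultimately have "\<bar>fcoeff (time_deriv \<alpha> t) i - (1 / t) * fcoeff \<O> i\<bar> \<le> D * norm (t * \<bar>ln t\<bar>\<^sup>2)"
      using elim(1) by simp
    also have "norm (t * \<bar>ln t\<bar>\<^sup>2) = t * \<bar>ln t\<bar>\<^sup>2" using t by simp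
    finally have "t * \<bar>fcoeff (time_deriv \<alpha> t) i - (1 / t) * fcoeff \<O> i\<bar> \<le> t * (D * (t * \<bar>ln t\<bar>\<^sup>2))"
      using t by (intro mult_left_mono) auto
    moreover have "t * \<bar>fcoeff (time_deriv \<alpha> t) i - (1 / t) * fcoeff \<O> i\<bar> = \<bar>t * fcoeff (time_deriv \<alpha> t) i - fcoeff \<O> i\<bar>"
    proof -
      have "t * \<bar>fcoeff (time_deriv \<alpha> t) i - (1 / t) * fcoeff \<O> i\<bar> = \<bar>t * (fcoeff (time_deriv \<alpha> t) i - (1 / t) * fcoeff \<O> i)\<bar>"
        using t by (simp add: abs_mult)
      then show ?thesis using t by (simp add: right_diff_distrib)
    qed
    ultimately have w1: "\<bar>t * fcoeff (time_deriv \<alpha> t) i - fcoeff \<O> i\<bar> \<le> t * (D * (t * \<bar>ln t\<bar>\<^sup>2))" by simp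
    have "t * (D * (t * \<bar>ln t\<bar>\<^sup>2)) \<le> t * (D * 4)"
      using mult_abs_ln_le(1)[OF t] t D by (intro mult_left_mono) auto
    with w1 have w2: "\<bar>t * fcoeff (time_deriv \<alpha> t) i - fcoeff \<O> i\<bar> \<le> t * (D * 4)" by linarith
    then have "\<bar>t * fcoeff (time_deriv \<alpha> t) i - fcoeff \<O> i\<bar> * \<bar>ln t\<bar> \<le> t * (D * 4) * \<bar>ln t\<bar>"
      by (rule mult_right_mono) simp
    also have "\<dots> = (t * \<bar>ln t\<bar>) * (D * 4)" by simp
    also have "\<dots> \<le> (2 * sqrt t) * (D * 4)"
      using mult_abs_ln_le(2)[OF t] D by (intro mult_right_mono) auto
    finally show ?case using w2 by simp
  qed
  show "((\<lambda>t. (t * fcoeff (time_deriv \<alpha> t) i - fcoeff \<O> i) * ln t) \<longlongrightarrow> 0) (at_right 0)"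
  proof (rule tendsto_0_le[OF sqrt_at_right_0])
    show "\<forall>\<^sub>F t in at_right 0. norm ((t * fcoeff (time_deriv \<alpha> t) i - fcoeff \<O> i) * ln t) \<le> norm (sqrt t) * (D * 8)"
      using w eventually_at_right_0_le_1 by eventually_elim (simp add: abs_mult)
  qed
  have "((\<lambda>t. t * fcoeff (time_deriv \<alpha> t) i - fcoeff \<O> i) \<longlongrightarrow> 0) (at_right 0)"
  proof (rule tendsto_0_le[OF tendsto_ident_at])
    show "\<forall>\<^sub>F t in at_right 0. norm (t * fcoeff (time_deriv \<alpha> t) i - fcoeff \<O> i) \<le> norm t * (D * 4)"
      using w eventually_at_right_0_le_1 by eventually_elim simp
  qed
  then show "((\<lambda>t. t * fcoeff (time_deriv \<alpha> t) i) \<longlongrightarrow> fcoeff \<O> i) (at_right 0)"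
    by (simp add: LIM_zero_iff)
  obtain w where w: "C1_smooth \<phi> lam w" "\<And>t x. t > 0 \<Longrightarrow> x \<in> sphere 0 1 \<Longrightarrow> w t x = chi t x"
      "\<And>x. x \<in> sphere 0 1 \<Longrightarrow> w 0 x = chi0 x"
    using sol unfolding smooth_solution_def by blast
  then obtain v where v: "\<And>t. t \<ge> 0 \<Longrightarrow> smooth_sphere (w t) \<and> smooth_sphere (v t)"
    "((\<lambda>r. sobolev_norm \<phi> lam (real 0) (\<lambda>x. (w r x - w 0 x) / (r - 0) - v 0 x)) \<longlongrightarrow> 0) (at 0 within {0..})"
    unfolding C1_smooth_def by blast
  define q where "q r = sobolev_norm \<phi> lam (real 0) (\<lambda>x. (w r x - w 0 x) / (r - 0) - v 0 x)" for r
  have ql: "(q \<longlongrightarrow> 0) (at_right 0)"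
    using v(2) by (simp add: q_def[abs_def] at_within_Ici_at_right)
  have lim: "((\<lambda>r. r * (q r + \<bar>fcoeff (v 0) i\<bar>)) \<longlongrightarrow> 0 * (0 + \<bar>fcoeff (v 0) i\<bar>)) (at_right 0)"
    by (intro tendsto_intros ql)
  \<comment> \<open>No rate is prescribed for \<chi>, but its extension is C^1 at 0: the difference
    quotient is within \<open>q r\<close> of the derivative \<open>v 0\<close>, which makes the
    difference O(r).\<close>
  have "((\<lambda>t. fcoeff (chi t) i - fcoeff chi0 i) \<longlongrightarrow> 0) (at_right 0)"
  proof (rule tendsto_0_le[where K = 1])
    show "((\<lambda>r. r * (q r + \<bar>fcoeff (v 0) i\<bar>)) \<longlongrightarrow> 0) (at_right 0)" using lim by simp
    show "\<forall>\<^sub>F r in at_right 0. norm (fcoeff (chi r) i - fcoeff chi0 i) \<le> norm (r * (q r + \<bar>fcoeff (v 0) i\<bar>)) * 1"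
      using eventually_at_right_0_le_1
    proof eventually_elim
      case (elim r)
      then have r: "r > 0" by simp
      have cw: "continuous_on (sphere 0 1) (w r)" "continuous_on (sphere 0 1) (w 0)" "continuous_on (sphere 0 1) (v 0)"
        using v(1) r by (auto intro: smooth_sphere_continuous)
      have "\<bar>fcoeff (\<lambda>x. (w r x - w 0 x) / (r - 0) - v 0 x) i\<bar> \<le> q r"
        unfolding q_def using r by (intro fcoeff_le_sobolev_0 continuous_intros cw) auto
      moreover have "fcoeff (\<lambda>x. (w r x - w 0 x) / (r - 0) - v 0 x) i = (1 / r) * (fcoeff (w r) i - fcoeff (w 0) i) - fcoeff (v 0) i"
      proof -
        have "fcoeff (\<lambda>x. (w r x - w 0 x) / (r - 0) - v 0 x) i = fcoeff (\<lambda>x. (1 / r) * (w r x - w 0 x) - v 0 x) i"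
          by simp
        also have "\<dots> = fcoeff (\<lambda>x. (1 / r) * (w r x - w 0 x)) i - fcoeff (v 0) i"
          by (intro fcoeff_diff continuous_intros cw)
        finally show ?thesis
          by (simp only: fcoeff_cmult fcoeff_diff[OF cw(1,2)])
      qed
      moreover have "fcoeff (w r) i = fcoeff (chi r) i" "fcoeff (w 0) i = fcoeff chi0 i"
        unfolding fcoeff_def using w r by (auto intro: inner_sphere_cong)
      ultimately have "\<bar>(1 / r) * (fcoeff (chi r) i - fcoeff chi0 i) - fcoeff (v 0) i\<bar> \<le> q r"
        by simp
      then have "\<bar>(1 / r) * (fcoeff (chi r) i - fcoeff chi0 i)\<bar> \<le> q r + \<bar>fcoeff (v 0) i\<bar>"
        using abs_triangle_ineq2[of "(1 / r) * (fcoeff (chi r) i - fcoeff chi0 i)" "fcoeff (v 0) i"]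
        by (simp only: diff_le_eq[symmetric])
      then have "\<bar>fcoeff (chi r) i - fcoeff chi0 i\<bar> \<le> r * (q r + \<bar>fcoeff (v 0) i\<bar>)"
        using r by (simp add: abs_mult abs_divide field_simps)
      then show ?case by simp
    qed
  qed
  then show "((\<lambda>t. fcoeff (chi t) i) \<longlongrightarrow> fcoeff chi0 i) (at_right 0)"
    by (simp add: LIM_zero_iff)
qed

text \<open>The first two bounds are \<open>mode_bound\<close> with r = 1/\<mu>, the third with r =
  \<mu>, multiplied by \<open>wt i powr s\<close>. Half powers of the weight replace \<mu> because
  \<mu> \<le> sqrt (wt i) \<le> 2 \<mu>; two such replacements make the factor 4. The factor
  \<open>3 + 2 * C\<^sup>2\<close> comes from replacing h - \<O> ln \<mu> by the coefficient of the
  renormalised datum. The constant is spelled out in q', B and C so that it is visibly the same for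
  all modes and solutions.\<close>

lemma solution_mode_bound:
  assumes C: "C \<ge> 0" "\<And>i. \<bar>logmult i - ln (max 1 (lam i))\<bar> \<le> C"
    and A: "A = 20 * exp (12 * (2 * (4 * q' + 4 + B) + 4)) * exp (4 * q' + 5 * B + 3)" "A' = 4 * A * (3 + 2 * C\<^sup>2)"
  defines "H \<equiv> fcoeff (\<lambda>x. h x - log_nabla \<phi> lam \<O> x)"
  shows "wt i powr (s + 1/2) * (fcoeff (\<alpha> 1) i)\<^sup>2
      \<le> A' * (wt i powr s * (H i)\<^sup>2 + wt i powr s * (fcoeff \<O> i)\<^sup>2 + wt i powr (s - 1/2) * (fcoeff chi0 i)\<^sup>2)" (is ?th1)
    and "wt i powr (s - 1/2) * (fcoeff (time_deriv \<alpha> 1) i)\<^sup>2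
      \<le> A' * (wt i powr s * (H i)\<^sup>2 + wt i powr s * (fcoeff \<O> i)\<^sup>2 + wt i powr (s - 1/2) * (fcoeff chi0 i)\<^sup>2)" (is ?th2)
    and "wt i powr (s + 1/2) * (fcoeff (chi 1) i)\<^sup>2
      \<le> A' * (wt i powr s * (H i)\<^sup>2 + wt i powr s * (fcoeff \<O> i)\<^sup>2 + wt i powr (s + 1/2) * (fcoeff chi0 i)\<^sup>2)" (is ?th3)
proof -
  interpret m: freq_mode q' B "lam i" f1 f2 f3 "\<lambda>t. fcoeff (\<alpha> t) i" "\<lambda>t. fcoeff (time_deriv \<alpha> t) i"
    "\<lambda>t. fcoeff (time_deriv (time_deriv \<alpha>) t) i" "\<lambda>t. fcoeff (chi t) i"
    by (rule mode_ode)
  define q where "q = sqrt (wt i)"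
  define \<mu> where "\<mu> = m.\<mu>"
  define a where "a = wt i powr s"
  have mu: "\<mu> \<ge> 1" "\<mu> = max 1 (lam i)" using m.mu by (auto simp: \<mu>_def m.\<mu>_def)
  have A0: "A \<ge> 0" and AG: "A = 20 * m.G\<^sub>1 * m.G\<^sub>2"
    by (simp_all add: A m.G\<^sub>1_def m.G\<^sub>2_def m.K_def)
  have q: "\<mu> \<le> q" "q \<le> 2 * \<mu>" "q > 0"
  proof -
    have "\<mu>\<^sup>2 \<le> wt i" using lam_nonneg[of i] by (auto simp: mu(2) wt_def max_def)
    then show "\<mu> \<le> q" unfolding q_def by (rule real_le_rsqrt)
    have "(lam i)\<^sup>2 \<le> \<mu>\<^sup>2" "1 \<le> \<mu>\<^sup>2" using lam_nonneg[of i] mu by (auto intro!: power_mono)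
    then have "wt i \<le> (2 * \<mu>)\<^sup>2" by (simp add: wt_def power_mult_distrib)
    then show "q \<le> 2 * \<mu>" unfolding q_def using mu by (intro real_le_lsqrt) auto
    show "q > 0" using wt(2) by (simp add: q_def)
  qed
  have a: "a \<ge> 0" "wt i powr (s + 1/2) = a * q" "wt i powr (s - 1/2) = a / q"
    using wt(2)[of i] by (auto simp: a_def q_def powr_add powr_diff powr_half_sqrt)
  have hH: "(fcoeff h i - fcoeff \<O> i * ln \<mu>)\<^sup>2 \<le> 2 * (H i)\<^sup>2 + 2 * C\<^sup>2 * (fcoeff \<O> i)\<^sup>2"
  proof -
    have "(logmult i - ln \<mu>)\<^sup>2 \<le> C\<^sup>2"
      using C(2)[of i] C(1) by (intro power2_le_iff_abs_le[THEN iffD2]) (auto simp: mu(2))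
    then have "(logmult i - ln \<mu>)\<^sup>2 * (fcoeff \<O> i)\<^sup>2 \<le> C\<^sup>2 * (fcoeff \<O> i)\<^sup>2"
      by (rule mult_right_mono) simp
    then have "((logmult i - ln \<mu>) * fcoeff \<O> i)\<^sup>2 \<le> C\<^sup>2 * (fcoeff \<O> i)\<^sup>2"
      by (simp add: power_mult_distrib)
    moreover have eq: "fcoeff h i - fcoeff \<O> i * ln \<mu> = H i + (logmult i - ln \<mu>) * fcoeff \<O> i"
      by (simp add: H_def fcoeff_log_nabla[OF solution_smooth(2,3)] algebra_simps)
    have "(H i + z)\<^sup>2 \<le> 2 * (H i)\<^sup>2 + 2 * z\<^sup>2" for z
      using zero_le_power2[of "H i - z"] by (simp add: power2_sum power2_diff)
    from this[of "(logmult i - ln \<mu>) * fcoeff \<O> i"] calculation show ?thesis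
      unfolding eq by linarith
  qed
  have main: "\<mu> * (fcoeff (\<alpha> 1) i)\<^sup>2 + (fcoeff (time_deriv \<alpha> 1) i)\<^sup>2 / \<mu> + r * (fcoeff (chi 1) i)\<^sup>2
      \<le> A * (3 + 2 * C\<^sup>2) * ((H i)\<^sup>2 + (fcoeff \<O> i)\<^sup>2 + r * (fcoeff chi0 i)\<^sup>2)"
    if r: "1 / \<mu> \<le> r" "r \<le> \<mu>" for r
  proof -
    have r0: "r \<ge> 0" using r mu by (auto intro: order.trans[of _ "1/\<mu>"])
    have "\<mu> * (fcoeff (\<alpha> 1) i)\<^sup>2 + (fcoeff (time_deriv \<alpha> 1) i)\<^sup>2 / \<mu> + r * (fcoeff (chi 1) i)\<^sup>2
        \<le> A * ((fcoeff h i - fcoeff \<O> i * ln \<mu>)\<^sup>2 + (fcoeff \<O> i)\<^sup>2 + r * (fcoeff chi0 i)\<^sup>2)"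
      using m.mode_bound[OF _ _ mode_limits, of r] r by (simp add: \<mu>_def AG)
    also have "\<dots> \<le> A * ((3 + 2 * C\<^sup>2) * ((H i)\<^sup>2 + (fcoeff \<O> i)\<^sup>2 + r * (fcoeff chi0 i)\<^sup>2))"
    proof (rule mult_left_mono[OF _ A0])
      have "0 \<le> r * (fcoeff chi0 i)\<^sup>2" "0 \<le> C\<^sup>2 * (r * (fcoeff chi0 i)\<^sup>2)" "0 \<le> C\<^sup>2 * (H i)\<^sup>2" using r0 by auto
      moreover have "(3 + 2 * C\<^sup>2) * ((H i)\<^sup>2 + (fcoeff \<O> i)\<^sup>2 + r * (fcoeff chi0 i)\<^sup>2)
          = (2 * (H i)\<^sup>2 + 2 * C\<^sup>2 * (fcoeff \<O> i)\<^sup>2) + (H i)\<^sup>2 + 3 * (fcoeff \<O> i)\<^sup>2 + 3 * (r * (fcoeff chi0 i)\<^sup>2)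
            + 2 * (C\<^sup>2 * (H i)\<^sup>2) + 2 * (C\<^sup>2 * (r * (fcoeff chi0 i)\<^sup>2))"
        by (simp add: algebra_simps)
      ultimately show "(fcoeff h i - fcoeff \<O> i * ln \<mu>)\<^sup>2 + (fcoeff \<O> i)\<^sup>2 + r * (fcoeff chi0 i)\<^sup>2
          \<le> (3 + 2 * C\<^sup>2) * ((H i)\<^sup>2 + (fcoeff \<O> i)\<^sup>2 + r * (fcoeff chi0 i)\<^sup>2)"
        using hH zero_le_power2[of "H i"] zero_le_power2[of "fcoeff \<O> i"] by linarith
    qed
    finally show ?thesis by simp
  qed
  define A2 where "A2 = A * (3 + 2 * C\<^sup>2)"
  have A2: "A2 \<ge> 0" "A' = 4 * A2" using A0 A(2) by (auto simp: A2_def)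
  define X where "X = (H i)\<^sup>2 + (fcoeff \<O> i)\<^sup>2"
  have X: "X \<ge> 0" by (simp add: X_def)
  let ?b = "(fcoeff chi0 i)\<^sup>2" and ?y = "(fcoeff (\<alpha> 1) i)\<^sup>2" and ?d = "(fcoeff (time_deriv \<alpha> 1) i)\<^sup>2" and ?c = "(fcoeff (chi 1) i)\<^sup>2"
  have low: "\<mu> * ?y + ?d / \<mu> \<le> A2 * (X + ?b * 2 / q)"
  proof -
    have "1 / \<mu> \<le> \<mu>" using mu(1) by (simp add: divide_le_eq) (metis mult_mono mult_1 zero_le_one order.trans)
    then have "\<mu> * ?y + ?d / \<mu> + 1 / \<mu> * ?c \<le> A2 * (X + 1 / \<mu> * ?b)"
      using main[of "1/\<mu>"] by (simp add: A2_def X_def)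
    moreover have "0 \<le> 1 / \<mu> * ?c" using mu by simp
    moreover have "A2 * (X + 1 / \<mu> * ?b) \<le> A2 * (X + ?b * 2 / q)"
    proof (intro mult_left_mono add_left_mono A2(1))
      have "1 / \<mu> \<le> 2 / q" using q mu by (simp add: field_simps)
      then show "1 / \<mu> * ?b \<le> ?b * 2 / q" using mult_right_mono[of "1/\<mu>" "2/q" ?b] by (simp add: mult_ac)
    qed
    ultimately show ?thesis by linarith
  qed
  have nn: "0 \<le> \<mu> * ?y" "0 \<le> ?d / \<mu>" using mu by auto
  have up: "2 * (A2 * (X + ?b * 2 / q)) \<le> A' * (X + ?b / q)"
  proof -
    have "A2 * (2 * X) \<le> A2 * (4 * X)" using X A2 by (intro mult_left_mono) auto
    then show ?thesis by (simp add: A2(2) algebra_simps)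
  qed
  have "q * ?y \<le> 2 * \<mu> * ?y" using q by (intro mult_right_mono) auto
  then have "q * ?y \<le> A' * (X + ?b / q)" using low nn up by linarith
  then have "a * (q * ?y) \<le> a * (A' * (X + ?b / q))" using a by (intro mult_left_mono)
  then show ?th1 by (simp add: a X_def algebra_simps flip: a_def)
  have "?d / q \<le> ?d / \<mu>" using q mu by (intro divide_left_mono) auto
  then have "?d / q \<le> A' * (X + ?b / q)" using low nn up by linarith
  then have "a * (?d / q) \<le> a * (A' * (X + ?b / q))" using a by (intro mult_left_mono)
  then show ?th2 by (simp add: a X_def algebra_simps flip: a_def)
  have "q * ?c \<le> A' * (X + q * ?b)"
  proof -
    have "1 / \<mu> \<le> \<mu>" using mu(1) by (simp add: divide_le_eq) (metis mult_mono mult_1 zero_le_one order.trans)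
    then have "\<mu> * ?y + ?d / \<mu> + \<mu> * ?c \<le> A2 * (X + \<mu> * ?b)"
      using main[of \<mu>] by (simp add: A2_def X_def)
    moreover have "A2 * (X + \<mu> * ?b) \<le> A2 * (X + q * ?b)"
      using A2 q by (intro mult_left_mono add_left_mono mult_right_mono) auto
    moreover have "q * ?c \<le> 2 * \<mu> * ?c" using q by (intro mult_right_mono) auto
    moreover have "0 \<le> A2 * (X + q * ?b)" using A2 X q by simp
    ultimately show ?thesis using nn unfolding A2(2) by linarith
  qed
  then have "a * (q * ?c) \<le> a * (A' * (X + q * ?b))" using a by (intro mult_left_mono)
  then show ?th3 by (simp add: a X_def algebra_simps flip: a_def)
qed

end
end

theorem theorem3p1:
  fixes n :: nat
    and q' s :: real
    and f1 f2 f3 :: "real \<Rightarrow> real"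
    and \<phi> :: "nat \<Rightarrow> 'a::euclidean_space \<Rightarrow> real"
    and lam :: "nat \<Rightarrow> real"
  assumes "DIM('a) = n + 1" and "n \<ge> 4" and "even n"
    and "q' \<ge> 1" and "s \<ge> 1"
    and "smooth_half_line f1" and "bounded (f1 ` {0..})"
    and "smooth_half_line f2" and "bounded (f2 ` {0..})"
    and "smooth_half_line f3" and "bounded (f3 ` {0..})"
    and "laplace_eigenbasis \<phi> lam"
  shows "\<exists>C>0. \<forall>chi0 \<O> h \<alpha> chi.
    smooth_solution \<phi> lam q' f1 f2 f3 chi0 \<O> h \<alpha> chi \<longrightarrow>
    (let H = sobolev_norm \<phi> lam;
         \<hh> = (\<lambda>x. h x - log_nabla \<phi> lam \<O> x)
     in H (s + 1/2) (\<alpha> 1) + H (s - 1/2) (\<lambda>x. deriv (\<lambda>t. \<alpha> t x) 1)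
          \<le> C * (H s \<hh> + H s \<O> + H (s - 1/2) chi0) \<and>
        H (s + 1/2) (chi 1) \<le> C * (H s \<hh> + H s \<O> + H (s + 1/2) chi0))"
proof -
  interpret eigenbasis \<phi> lam by unfold_locales (rule assms)
  obtain b1 b2 b3 where b: "\<And>t. t \<ge> 0 \<Longrightarrow> \<bar>f1 t\<bar> \<le> b1" "\<And>t. t \<ge> 0 \<Longrightarrow> \<bar>f2 t\<bar> \<le> b2" "\<And>t. t \<ge> 0 \<Longrightarrow> \<bar>f3 t\<bar> \<le> b3"
    using \<open>bounded (f1 ` {0..})\<close> \<open>bounded (f2 ` {0..})\<close> \<open>bounded (f3 ` {0..})\<close>
    by (force simp: bounded_iff)
  define B where "B = max 0 (max b1 (max b2 b3))"
  have B: "B \<ge> 0" "\<And>t. t > 0 \<Longrightarrow> \<bar>f1 t\<bar> \<le> B" "\<And>t. t > 0 \<Longrightarrow> \<bar>f2 t\<bar> \<le> B" "\<And>t. t > 0 \<Longrightarrow> \<bar>f3 t\<bar> \<le> B"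
    using b[OF less_imp_le] by (fastforce simp: B_def le_max_iff_disj)+
  obtain C where C: "C \<ge> 0" "\<And>i. \<bar>logmult i - ln (max 1 (lam i))\<bar> \<le> C"
    using logmult_approx by blast
  define A where "A = 4 * (20 * exp (12 * (2 * (4 * q' + 4 + B) + 4)) * exp (4 * q' + 5 * B + 3)) * (3 + 2 * C\<^sup>2)"
  have A: "A > 0"
    unfolding A_def by (intro mult_pos_pos add_pos_nonneg) auto
  \<comment> \<open>Each of the three norms is bounded with the factor \<open>sqrt A\<close>. The
    first estimate adds two of them, hence the factor 2 in the witness.\<close>
  show ?thesis
  proof (intro exI[of _ "2 * sqrt A"] conjI allI impI)
    fix chi0 \<O> h :: "'a \<Rightarrow> real" and \<alpha> chi :: "real \<Rightarrow> 'a \<Rightarrow> real"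
    assume sol: "smooth_solution \<phi> lam q' f1 f2 f3 chi0 \<O> h \<alpha> chi"
    let ?H = "sobolev_norm \<phi> lam" and ?h = "\<lambda>x. h x - log_nabla \<phi> lam \<O> x"
    have smooth: "smooth_sphere chi0" "smooth_sphere \<O>" "smooth_sphere h"
      using sol by (auto simp: smooth_solution_def)
    note sums = summable_sobolev_log_nabla[OF smooth(2,3)] summable_sobolev[OF smooth(2)] summable_sobolev[OF smooth(1)]
    note mb = solution_mode_bound[OF \<open>q' \<ge> 1\<close> B sol C refl A_def]
    have 1: "?H (s + 1/2) (\<alpha> 1) \<le> sqrt A * (?H s ?h + ?H s \<O> + ?H (s - 1/2) chi0)"
      by (rule sobolev_norm_le[OF mb(1) sums less_imp_le[OF A]])
    have 2: "?H (s - 1/2) (\<lambda>x. deriv (\<lambda>t. \<alpha> t x) 1) \<le> sqrt A * (?H s ?h + ?H s \<O> + ?H (s - 1/2) chi0)"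
      using sobolev_norm_le[OF mb(2) sums less_imp_le[OF A]] by (simp add: time_deriv_def[abs_def])
    have 3: "?H (s + 1/2) (chi 1) \<le> sqrt A * (?H s ?h + ?H s \<O> + ?H (s + 1/2) chi0)"
      by (rule sobolev_norm_le[OF mb(3) sums less_imp_le[OF A]])
    have nn: "0 \<le> ?H t chi0" "0 \<le> ?H t \<O>" "0 \<le> ?H t ?h" for t
      using sums by (simp_all add: sobolev_norm_eq suminf_nonneg)
    have "sqrt A * (?H s ?h + ?H s \<O> + ?H (s + 1/2) chi0) \<le> 2 * sqrt A * (?H s ?h + ?H s \<O> + ?H (s + 1/2) chi0)"
      using nn A by (intro mult_right_mono) auto
    with 1 2 3 show "let H = sobolev_norm \<phi> lam;
         \<hh> = (\<lambda>x. h x - log_nabla \<phi> lam \<O> x)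
     in H (s + 1/2) (\<alpha> 1) + H (s - 1/2) (\<lambda>x. deriv (\<lambda>t. \<alpha> t x) 1)
          \<le> 2 * sqrt A * (H s \<hh> + H s \<O> + H (s - 1/2) chi0) \<and>
        H (s + 1/2) (chi 1) \<le> 2 * sqrt A * (H s \<hh> + H s \<O> + H (s + 1/2) chi0)"
      unfolding Let_def by (simp add: mult.assoc)
  qed (use A in simp)
qed

end
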